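(* Let $t$ be a real number. Suppose $\beta=\{\beta(n)\}_{n=0}^\infty$ is a sequence of positive numbers such that $$\lim_{n\to\infty}\frac{\beta(n)}{n^t}=\ell,\qquad\text{where } 0<\ell<\infty.$$ Let $\varphi(z)=\dfrac{az+b}{cz+d}$ be a linear fractional self-map of the unit disk $\mathbb{D}$, and let $\sigma(z)=\dfrac{\bar a z-\bar c}{-\bar b z+\bar d}$ be its Kreĭn adjoint. Let $g(z)=(-\bar b z+\bar d)^{2t-1}$ and $h(z)=(cz+d)^{-2t+1}$, where the holomorphic branches of the powers on $\mathbb{D}$ are chosen compatibly, i.e. so that $g(0)\overline{h(0)}=1$. Then the difference $C_\varphi^{*}-M_gC_\sigma M_h^{*}$ is a compact operator on $H^2(\beta)$.
   Context: $\mathbb{D}$ is the open unit disk in $\mathbb{C}$. The weighted Hardy space $H^2(\beta)$ is the Hilbert space of analytic functions $f(z)=\sum_{n\ge0} a_nz^n$ on $\mathbb{D}$ with $\sum_n|a_n|^2\beta(n)^2<\infty$, in which the monomials $z^n$, $n\geq 0$, form an orthogonal basis with $\|z^n\|=\beta(n)$. A linear fractional self-map of $\mathbb{D}$ is a map $\varphi(z)=(az+b)/(cz+d)$ with $a,b,c,d\in\mathbb{C}$, $ad-bc\neq 0$ and $\varphi(\mathbb{D})\subset\mathbb{D}$; its Kreĭn adjoint $\sigma$ is then also a self-map of $\mathbb{D}$, and $cz+d$ and $-\bar bz+\bar d$ do not vanish on the closed unit disk. For an analytic $\psi:\mathbb{D}\to\mathbb{D}$, $C_\psi f=f\circ\psi$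 is the composition operator; $M_u f=uf$ is the multiplication operator with symbol $u$. Adjoints are taken in $H^2(\beta)$; the operators $C_\varphi,C_\sigma,M_g,M_h$ are bounded on $H^2(\beta)$. *)

theory Defs
  imports "HOL-Complex_Analysis.Complex_Analysis"
begin

abbreviation unit_disk :: "complex set" ("\<D>")
  where "\<D> \<equiv> ball 0 1"

abbreviation taylor_coeff :: "(complex \<Rightarrow> complex) \<Rightarrow> nat \<Rightarrow> complex"
  where "taylor_coeff f n \<equiv> fps_nth (fps_expansion f 0) n"

(* A function on the disk is represented by its extension by 0 to the whole plane, so that
   equality in the space is equality of HOL functions and the space is closed under the
   pointwise vector operations. *)
definition weighted_hardy :: "(nat \<Rightarrow> real) \<Rightarrow> (complex \<Rightarrow> complex) set"
  where "weighted_hardy \<beta> =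
    {f. f holomorphic_on \<D> \<and> (\<forall>z. z \<notin> \<D> \<longrightarrow> f z = 0) \<and>
        summable (\<lambda>n. (cmod (taylor_coeff f n))\<^sup>2 * (\<beta> n)\<^sup>2)}"

definition wh_inner :: "(nat \<Rightarrow> real) \<Rightarrow> (complex \<Rightarrow> complex) \<Rightarrow> (complex \<Rightarrow> complex) \<Rightarrow> complex"
  where "wh_inner \<beta> f g =
    (\<Sum>n. taylor_coeff f n * cnj (taylor_coeff g n) * complex_of_real ((\<beta> n)\<^sup>2))"

definition wh_norm :: "(nat \<Rightarrow> real) \<Rightarrow> (complex \<Rightarrow> complex) \<Rightarrow> real"
  where "wh_norm \<beta> f = sqrt (\<Sum>n. (cmod (taylor_coeff f n))\<^sup>2 * (\<beta> n)\<^sup>2)"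

definition comp_op :: "(complex \<Rightarrow> complex) \<Rightarrow> (complex \<Rightarrow> complex) \<Rightarrow> complex \<Rightarrow> complex"
  where "comp_op \<psi> f = (\<lambda>z. if z \<in> \<D> then f (\<psi> z) else 0)"

definition mult_op :: "(complex \<Rightarrow> complex) \<Rightarrow> (complex \<Rightarrow> complex) \<Rightarrow> complex \<Rightarrow> complex"
  where "mult_op u f = (\<lambda>z. if z \<in> \<D> then u z * f z else 0)"

(* The Hilbert space adjoint. For bounded T the description is uniquely satisfied for every
   k in the space, by the Riesz representation theorem; nothing is claimed for k outside it. *)
definition wh_adjoint ::
    "(nat \<Rightarrow> real) \<Rightarrow> ((complex \<Rightarrow> complex) \<Rightarrow> complex \<Rightarrow> complex)
      \<Rightarrow> (complex \<Rightarrow> complex) \<Rightarrow> complex \<Rightarrow> complex"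
  where "wh_adjoint \<beta> T k =
    (THE k'. k' \<in> weighted_hardy \<beta> \<and>
       (\<forall>f\<in>weighted_hardy \<beta>. wh_inner \<beta> (T f) k = wh_inner \<beta> f k'))"

definition wh_linear ::
    "(nat \<Rightarrow> real) \<Rightarrow> ((complex \<Rightarrow> complex) \<Rightarrow> complex \<Rightarrow> complex) \<Rightarrow> bool"
  where "wh_linear \<beta> T \<longleftrightarrow>
    (\<forall>f\<in>weighted_hardy \<beta>. T f \<in> weighted_hardy \<beta>) \<and>
    (\<forall>f\<in>weighted_hardy \<beta>. \<forall>k\<in>weighted_hardy \<beta>. T (\<lambda>z. f z + k z) = (\<lambda>z. T f z + T k z)) \<and>
    (\<forall>f\<in>weighted_hardy \<beta>. \<forall>s. T (\<lambda>z. s * f z) = (\<lambda>z. s * T f z))"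

definition wh_compact ::
    "(nat \<Rightarrow> real) \<Rightarrow> ((complex \<Rightarrow> complex) \<Rightarrow> complex \<Rightarrow> complex) \<Rightarrow> bool"
  where "wh_compact \<beta> T \<longleftrightarrow>
    wh_linear \<beta> T \<and>
    (\<forall>F B. (\<forall>n::nat. F n \<in> weighted_hardy \<beta> \<and> wh_norm \<beta> (F n) \<le> B) \<longrightarrow>
       (\<exists>r k. strict_mono r \<and> k \<in> weighted_hardy \<beta> \<and>
          (\<lambda>n. wh_norm \<beta> (\<lambda>z. T (F (r n)) z - k z)) \<longlonglongrightarrow> 0))"

(* The nonvanishing of the denominator rules out values arising from x / 0 = 0. *)
definition lin_frac_self_map :: "complex \<Rightarrow> complex \<Rightarrow> complex \<Rightarrow> complex \<Rightarrow> bool"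
  where "lin_frac_self_map a b c d \<longleftrightarrow>
    a * d - b * c \<noteq> 0 \<and> (\<forall>z\<in>\<D>. c * z + d \<noteq> 0 \<and> (a * z + b) / (c * z + d) \<in> \<D>)"

(* p is a holomorphic branch on the disk of the s-th power of u, obtained from a holomorphic
   logarithm L of u. *)
definition power_branch :: "(complex \<Rightarrow> complex) \<Rightarrow> real \<Rightarrow> (complex \<Rightarrow> complex) \<Rightarrow> bool"
  where "power_branch u s p \<longleftrightarrow>
    (\<exists>L. L holomorphic_on \<D> \<and>
       (\<forall>z\<in>\<D>. exp (L z) = u z \<and> p z = exp (complex_of_real s * L z)))"

end

theory Submission
  imports Defs "HOL-Real_Asymp.Real_Asymp"
begin

text \<open>
  The Krein adjoint satisfies
  \<open>(1 - cnj w * \<phi> z) (c z + d) = cnj (- cnj b * w + cnj d) (1 - cnj (\<sigma> w) * z)\<close>. Hence, if the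
  space had the reproducing kernel \<open>k (cnj w * z)\<close> with \<open>k x = (1 - x) powr (2 t - 1)\<close>, the operator
  would vanish. The coefficients of \<open>k\<close> are asymptotic to a nonzero multiple of \<open>n powr (- 2 t)\<close>,
  so replacing the true kernel by \<open>k\<close> costs only a diagonal operator with entries tending to \<open>0\<close>.
  Positivity of the coefficients plays no role, so this covers all \<open>t\<close> except those where
  \<open>m = 2 t - 1\<close> is a natural number and \<open>k\<close> is a polynomial; there \<open>k x = (1 - x) ^ m * Ln (1 - x)\<close>
  is used instead, which satisfies the kernel identity up to a finite rank kernel.

  Boundedness of \<open>C\<^sub>\<phi>\<close> is first obtained on the classical Hardy space, moved to the weights
  \<open>(n + 1) ^ k\<close> for integers \<open>k\<close> through \<open>(f \<circ> \<phi>)' = \<phi>' * (f' \<circ> \<phi>)\<close>, and interpolated in between.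
\<close>

subsection \<open>Weighted square-summable sequences\<close>

text \<open>Boundedness has to be proved first: the adjoint is a definite description that is
  informative only for bounded operators, and the correction terms are compact only because every
  other factor is bounded. It is obtained entirely from coefficient estimates.

  The obstacle is that the reproducing kernel has no closed form, since \<open>\<beta>\<close> is
  prescribed only asymptotically. The exact limit matters in the quotient of the kernel
  coefficients, which must tend to a nonzero \<mu>; boundedness relies on comparability with
  \<open>(1 + n) powr t\<close> alone.

  The kernel identity survives real powers because all factors, once normalised, have the form
  \<open>1 + x\<close> with \<open>cmod x < 1\<close>, so principal logarithms add up. The branches
  of \<open>g\<close> and \<open>h\<close> then contribute one constant, which the normalisation at
  0 makes 1.

  If \<open>k\<close> is a polynomial, its coefficients vanish eventually and \<mu> would be 0. The
  logarithmic kernel is the derivative of \<open>(1 - x) powr r\<close> in \<open>r\<close> at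
  \<open>m\<close>. The logarithm of the Krein identity splits into a function of \<open>w\<close>
  plus a function of \<open>z\<close>, so the defect is a polynomial in
  \<open>cnj w * \<phi> z\<close> times such a sum, which has finite rank.\<close>

definition wsq :: "(nat \<Rightarrow> real) \<Rightarrow> (nat \<Rightarrow> complex) \<Rightarrow> real"
  where "wsq \<beta> a = (\<Sum>n. (cmod (a n))\<^sup>2 * (\<beta> n)\<^sup>2)"

definition wsummable :: "(nat \<Rightarrow> real) \<Rightarrow> (nat \<Rightarrow> complex) \<Rightarrow> bool"
  where "wsummable \<beta> a \<longleftrightarrow> summable (\<lambda>n. (cmod (a n))\<^sup>2 * (\<beta> n)\<^sup>2)"

definition winner :: "(nat \<Rightarrow> real) \<Rightarrow> (nat \<Rightarrow> complex) \<Rightarrow> (nat \<Rightarrow> complex) \<Rightarrow> complex"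
  where "winner \<beta> a b = (\<Sum>n. a n * cnj (b n) * complex_of_real ((\<beta> n)\<^sup>2))"

lemma wsq_nonneg: "wsummable \<beta> a \<Longrightarrow> wsq \<beta> a \<ge> 0"
  unfolding wsq_def wsummable_def by (rule suminf_nonneg) auto

lemma wsq_sums: "wsummable \<beta> a \<Longrightarrow> (\<lambda>n. (cmod (a n))\<^sup>2 * (\<beta> n)\<^sup>2) sums wsq \<beta> a"
  by (simp add: wsummable_def wsq_def summable_sums)

lemma wsq_sum_le:
  "wsummable \<beta> a \<Longrightarrow> finite A \<Longrightarrow> (\<Sum>n\<in>A. (cmod (a n))\<^sup>2 * (\<beta> n)\<^sup>2) \<le> wsq \<beta> a"
  unfolding wsummable_def wsq_def by (rule sum_le_suminf) auto

lemma wsq_term_le: "wsummable \<beta> a \<Longrightarrow> (cmod (a n))\<^sup>2 * (\<beta> n)\<^sup>2 \<le> wsq \<beta> a"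
  using wsq_sum_le[of \<beta> a "{n}"] by simp

text \<open>Used as a Fatou lemma: a bound on all finite sections survives coefficientwise limits
  and yields summability and the norm bound together.\<close>

lemma wsq_leI:
  assumes "\<And>N. (\<Sum>n<N. (cmod (a n))\<^sup>2 * (\<beta> n)\<^sup>2) \<le> C"
  shows "wsummable \<beta> a" "wsq \<beta> a \<le> C"
proof -
  have "(\<Sum>n\<le>N. (cmod (a n))\<^sup>2 * (\<beta> n)\<^sup>2) \<le> C" for N
    using assms[of "Suc N"] by (simp add: lessThan_Suc_atMost)
  then show *: "wsummable \<beta> a"
    unfolding wsummable_def by (intro bounded_imp_summable[of _ C]) auto
  then show "wsq \<beta> a \<le> C"
    using assms unfolding wsummable_def wsq_def by (intro suminf_le_const) auto
qed

lemma wsq_dominated: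
  assumes "wsummable \<gamma> b" "\<And>n. (cmod (a n))\<^sup>2 * (\<beta> n)\<^sup>2 \<le> K * ((cmod (b n))\<^sup>2 * (\<gamma> n)\<^sup>2)"
  shows "wsummable \<beta> a" "wsq \<beta> a \<le> K * wsq \<gamma> b"
proof -
  have s: "summable (\<lambda>n. K * ((cmod (b n))\<^sup>2 * (\<gamma> n)\<^sup>2))"
    using assms(1) unfolding wsummable_def by (rule summable_mult)
  show *: "wsummable \<beta> a"
    unfolding wsummable_def by (rule summable_comparison_test'[OF s]) (use assms(2) in auto)
  then show "wsq \<beta> a \<le> K * wsq \<gamma> b"
    using assms s unfolding wsummable_def wsq_def
    by (subst suminf_mult[symmetric]) (auto intro!: suminf_le)
qed

lemma wsq_cmult:
  assumes "wsummable \<beta> a"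
  shows "wsummable \<beta> (\<lambda>n. c * a n)" "wsq \<beta> (\<lambda>n. c * a n) = (cmod c)\<^sup>2 * wsq \<beta> a"
proof -
  have "(\<lambda>n. (cmod c)\<^sup>2 * ((cmod (a n))\<^sup>2 * (\<beta> n)\<^sup>2)) sums ((cmod c)\<^sup>2 * wsq \<beta> a)"
    using assms by (intro sums_mult wsq_sums)
  then have *: "(\<lambda>n. (cmod (c * a n))\<^sup>2 * (\<beta> n)\<^sup>2) sums ((cmod c)\<^sup>2 * wsq \<beta> a)"
    by (simp add: norm_mult power_mult_distrib mult.assoc)
  then show "wsummable \<beta> (\<lambda>n. c * a n)" "wsq \<beta> (\<lambda>n. c * a n) = (cmod c)\<^sup>2 * wsq \<beta> a"
    by (auto simp: wsummable_def wsq_def sums_iff)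
qed

lemma cmod_add_sq_le: "(cmod (x + y))\<^sup>2 \<le> 2 * (cmod x)\<^sup>2 + 2 * (cmod y)\<^sup>2"
proof -
  have "(cmod (x + y))\<^sup>2 \<le> (cmod x + cmod y)\<^sup>2"
    by (intro power_mono norm_triangle_ineq) auto
  also have "\<dots> \<le> 2 * (cmod x)\<^sup>2 + 2 * (cmod y)\<^sup>2"
    using sum_squares_bound[of "cmod x" "cmod y"] by (simp add: power2_sum)
  finally show ?thesis .
qed

text \<open>A crude substitute for the triangle inequality that keeps norms squared. It suffices
  wherever only the existence of a constant matters; sharp constants come from
  \<open>wsq_add_eq\<close>.\<close>

lemma wsq_add:
  assumes "wsummable \<beta> a" "wsummable \<beta> b"
  shows "wsummable \<beta> (\<lambda>n. a n + b n)"
    and "wsq \<beta> (\<lambda>n. a n + b n) \<le> 2 * wsq \<beta> a + 2 * wsq \<beta> b"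
proof -
  have s: "(\<lambda>n. 2 * ((cmod (a n))\<^sup>2 * (\<beta> n)\<^sup>2) + 2 * ((cmod (b n))\<^sup>2 * (\<beta> n)\<^sup>2)) sums
      (2 * wsq \<beta> a + 2 * wsq \<beta> b)"
    using assms by (intro sums_add sums_mult wsq_sums)
  have le: "(cmod (a n + b n))\<^sup>2 * (\<beta> n)\<^sup>2 \<le>
      2 * ((cmod (a n))\<^sup>2 * (\<beta> n)\<^sup>2) + 2 * ((cmod (b n))\<^sup>2 * (\<beta> n)\<^sup>2)" for n
    using mult_right_mono[OF cmod_add_sq_le[of "a n" "b n"], of "(\<beta> n)\<^sup>2"]
    by (simp add: algebra_simps)
  show *: "wsummable \<beta> (\<lambda>n. a n + b n)"
    unfolding wsummable_def
    by (rule summable_comparison_test'[OF sums_summable[OF s]]) (use le in auto)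
  show "wsq \<beta> (\<lambda>n. a n + b n) \<le> 2 * wsq \<beta> a + 2 * wsq \<beta> b"
    by (rule sums_le[OF le wsq_sums[OF *] s])
qed

lemma winner_sums:
  assumes "wsummable \<beta> a" "wsummable \<beta> b"
  shows "(\<lambda>n. a n * cnj (b n) * complex_of_real ((\<beta> n)\<^sup>2)) sums winner \<beta> a b"
proof -
  have "summable (\<lambda>n. (cmod (a n))\<^sup>2 * (\<beta> n)\<^sup>2 + (cmod (b n))\<^sup>2 * (\<beta> n)\<^sup>2)"
    using assms unfolding wsummable_def by (rule summable_add)
  then have "summable (\<lambda>n. a n * cnj (b n) * complex_of_real ((\<beta> n)\<^sup>2))"
  proof (rule summable_comparison_test')
    fix n
    have "cmod (a n) * cmod (b n) \<le> (cmod (a n))\<^sup>2 + (cmod (b n))\<^sup>2"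
      using sum_squares_bound[of "cmod (a n)" "cmod (b n)"]
        mult_nonneg_nonneg[OF norm_ge_zero[of "a n"] norm_ge_zero[of "b n"]] by linarith
    then have "cmod (a n) * cmod (b n) * (\<beta> n)\<^sup>2 \<le> ((cmod (a n))\<^sup>2 + (cmod (b n))\<^sup>2) * (\<beta> n)\<^sup>2"
      by (rule mult_right_mono) simp
    then show "norm (a n * cnj (b n) * complex_of_real ((\<beta> n)\<^sup>2)) \<le>
        (cmod (a n))\<^sup>2 * (\<beta> n)\<^sup>2 + (cmod (b n))\<^sup>2 * (\<beta> n)\<^sup>2"
      by (simp add: norm_mult norm_power distrib_right)
  qed
  then show ?thesis by (simp add: winner_def summable_sums)
qed

lemma winner_add_left:
  assumes "wsummable \<beta> a" "wsummable \<beta> b" "wsummable \<beta> k"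
  shows "winner \<beta> (\<lambda>n. a n + b n) k = winner \<beta> a k + winner \<beta> b k"
  using sums_add[OF winner_sums[OF assms(1,3)] winner_sums[OF assms(2,3)]]
    winner_sums[OF wsq_add(1)[OF assms(1,2)] assms(3)]
  by (auto simp: algebra_simps intro: sums_unique2)

lemma winner_cmult_left:
  assumes "wsummable \<beta> a" "wsummable \<beta> k"
  shows "winner \<beta> (\<lambda>n. c * a n) k = c * winner \<beta> a k"
  using sums_mult[OF winner_sums[OF assms], of c]
    winner_sums[OF wsq_cmult(1)[OF assms(1)] assms(2)]
  by (auto simp: algebra_simps intro: sums_unique2)

lemma winner_cnj:
  assumes "wsummable \<beta> a" "wsummable \<beta> k"
  shows "winner \<beta> k a = cnj (winner \<beta> a k)"
proof -
  have "(\<lambda>n. cnj (a n * cnj (k n) * complex_of_real ((\<beta> n)\<^sup>2))) sums cnj (winner \<beta> a k)"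
    using winner_sums[OF assms] by (subst sums_cnj)
  moreover have "(\<lambda>n. cnj (a n * cnj (k n) * complex_of_real ((\<beta> n)\<^sup>2))) =
      (\<lambda>n. k n * cnj (a n) * complex_of_real ((\<beta> n)\<^sup>2))" by (auto simp: mult_ac)
  ultimately show ?thesis
    using winner_sums[OF assms(2,1)] sums_unique2 by metis
qed

lemma winner_self:
  assumes "wsummable \<beta> a"
  shows "winner \<beta> a a = complex_of_real (wsq \<beta> a)"
proof -
  have "(\<lambda>n. complex_of_real ((cmod (a n))\<^sup>2 * (\<beta> n)\<^sup>2)) sums complex_of_real (wsq \<beta> a)"
    using wsq_sums[OF assms] by (rule sums_of_real)
  moreover have "(\<lambda>n. complex_of_real ((cmod (a n))\<^sup>2 * (\<beta> n)\<^sup>2)) =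
      (\<lambda>n. a n * cnj (a n) * complex_of_real ((\<beta> n)\<^sup>2))"
    by (auto simp flip: complex_norm_square)
  ultimately show ?thesis
    using winner_sums[OF assms assms] sums_unique2 by metis
qed

lemma winner_cauchy_schwarz:
  assumes "wsummable \<beta> a" "wsummable \<beta> b"
  shows "(cmod (winner \<beta> a b))\<^sup>2 \<le> wsq \<beta> a * wsq \<beta> b"
proof -
  let ?s = "\<lambda>N. \<Sum>n<N. a n * cnj (b n) * complex_of_real ((\<beta> n)\<^sup>2)"
  have "(\<lambda>N. (cmod (?s N))\<^sup>2) \<longlonglongrightarrow> (cmod (winner \<beta> a b))\<^sup>2"
    using winner_sums[OF assms] unfolding sums_def by (intro tendsto_intros)
  moreover have "(cmod (?s N))\<^sup>2 \<le> wsq \<beta> a * wsq \<beta> b" for N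
  proof -
    have "cmod (?s N) \<le> (\<Sum>n<N. (cmod (a n) * \<bar>\<beta> n\<bar>) * (cmod (b n) * \<bar>\<beta> n\<bar>))"
      by (rule order_trans[OF norm_sum]) (auto simp: norm_mult norm_power power2_eq_square mult_ac intro!: sum_mono)
    then have "(cmod (?s N))\<^sup>2 \<le> (\<Sum>n<N. (cmod (a n) * \<bar>\<beta> n\<bar>) * (cmod (b n) * \<bar>\<beta> n\<bar>))\<^sup>2"
      by (rule power_mono) simp
    also have "\<dots> \<le> (\<Sum>n<N. (cmod (a n) * \<bar>\<beta> n\<bar>)\<^sup>2) * (\<Sum>n<N. (cmod (b n) * \<bar>\<beta> n\<bar>)\<^sup>2)"
      by (rule Cauchy_Schwarz_ineq_sum)
    also have "\<dots> \<le> wsq \<beta> a * wsq \<beta> b"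
      using wsq_sum_le[OF assms(1), of "{..<N}"] wsq_sum_le[OF assms(2), of "{..<N}"]
      by (intro mult_mono) (auto simp: power_mult_distrib assms wsq_nonneg intro: sum_nonneg)
    finally show ?thesis .
  qed
  ultimately show ?thesis
    by (intro LIMSEQ_le_const2) auto
qed

subsection \<open>Taylor coefficients of functions on the disk\<close>

lemma taylor_coeff_cong:
  assumes "\<And>z. z \<in> \<D> \<Longrightarrow> f z = g z"
  shows "taylor_coeff f = taylor_coeff g"
proof -
  have "\<forall>\<^sub>F z in nhds 0. f z = g z"
    using eventually_nhds_in_open[of \<D> 0] by (rule eventually_mono[rotated 2]) (use assms in auto)
  then show ?thesis using fps_expansion_cong by metis
qed

lemma taylor_has_fps:
  assumes "f holomorphic_on \<D>"
  shows "f has_fps_expansion fps_expansion f 0"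
  using has_fps_expansion_fps_expansion[OF _ _ assms] by simp

lemma taylor_coeff_sums:
  assumes "f holomorphic_on \<D>" "z \<in> \<D>"
  shows "(\<lambda>n. taylor_coeff f n * z ^ n) sums f z"
  by (rule has_fps_expansion_imp_sums_complex[OF taylor_has_fps[OF assms(1)], of 1])
    (use assms in \<open>auto simp: one_ereal_def\<close>)

lemma taylor_coeff_add:
  assumes "f holomorphic_on \<D>" "g holomorphic_on \<D>"
  shows "taylor_coeff (\<lambda>z. f z + g z) = (\<lambda>n. taylor_coeff f n + taylor_coeff g n)"
  using fps_expansion_eqI[OF has_fps_expansion_add[OF assms[THEN taylor_has_fps]]] by auto

lemma taylor_coeff_diff:
  assumes "f holomorphic_on \<D>" "g holomorphic_on \<D>"
  shows "taylor_coeff (\<lambda>z. f z - g z) = (\<lambda>n. taylor_coeff f n - taylor_coeff g n)"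
  using fps_expansion_eqI[OF has_fps_expansion_diff[OF assms[THEN taylor_has_fps]]] by auto

lemma taylor_coeff_cmult:
  assumes "f holomorphic_on \<D>"
  shows "taylor_coeff (\<lambda>z. c * f z) = (\<lambda>n. c * taylor_coeff f n)"
  using fps_expansion_eqI[OF has_fps_expansion_cmult_left[OF assms[THEN taylor_has_fps]]] by auto

lemma taylor_coeff_mult:
  assumes "f holomorphic_on \<D>" "g holomorphic_on \<D>"
  shows "taylor_coeff (\<lambda>z. f z * g z) n = (\<Sum>i\<le>n. taylor_coeff f i * taylor_coeff g (n - i))"
  using fps_expansion_eqI[OF has_fps_expansion_mult[OF assms[THEN taylor_has_fps]]]
  by (auto simp: fps_mult_nth atLeast0AtMost)

lemma taylor_coeff_deriv:
  assumes "f holomorphic_on \<D>"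
  shows "taylor_coeff (deriv f) n = of_nat (Suc n) * taylor_coeff f (Suc n)"
  using fps_expansion_eqI[OF has_fps_expansion_deriv[OF taylor_has_fps[OF assms]]] by auto

lemma taylor_coeff_0: "taylor_coeff f 0 = f 0"
  by (simp add: fps_expansion_def)

lemma taylor_coeffI:
  assumes "\<And>z. z \<in> \<D> \<Longrightarrow> (\<lambda>n. a n * z ^ n) sums f z"
  shows "f holomorphic_on \<D>" "taylor_coeff f = a"
proof -
  show "f holomorphic_on \<D>"
    using assms by (intro power_series_holomorphic[of 0 1 a]) auto
  have "\<forall>\<^sub>F u in nhds 0. (\<lambda>n. fps_nth (Abs_fps a) n * u ^ n) sums f u"
    using eventually_nhds_in_open[of \<D> 0] by (rule eventually_mono[rotated 2]) (use assms in auto)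
  then have "f has_fps_expansion Abs_fps a" by (rule has_fps_expansionI)
  from fps_expansion_eqI[OF this] show "taylor_coeff f = a" by (simp add: fun_eq_iff)
qed

lemma taylor_coeff_poly: "taylor_coeff (poly p) = coeff p"
proof (rule taylor_coeffI(2))
  fix z
  have "(\<lambda>n. coeff p n * z ^ n) sums (\<Sum>n\<le>degree p. coeff p n * z ^ n)"
    by (rule sums_finite) (auto simp: coeff_eq_0)
  then show "(\<lambda>n. coeff p n * z ^ n) sums poly p z" by (simp add: poly_altdef)
qed

text \<open>The exact expansion is needed for Pythagoras and for the contraction estimate, where a
  lost factor 2 would be multiplied at every Horner step.\<close>

lemma wsq_add_eq:
  assumes "wsummable \<beta> a" "wsummable \<beta> b"
  shows "wsq \<beta> (\<lambda>n. a n + b n) = wsq \<beta> a + 2 * Re (winner \<beta> a b) + wsq \<beta> b"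
proof -
  note s = wsq_add(1)[OF assms]
  have "winner \<beta> (\<lambda>n. a n + b n) (\<lambda>n. a n + b n) =
      winner \<beta> a (\<lambda>n. a n + b n) + winner \<beta> b (\<lambda>n. a n + b n)"
    by (rule winner_add_left) (use assms s in auto)
  also have "winner \<beta> a (\<lambda>n. a n + b n) = cnj (winner \<beta> a a + winner \<beta> b a)"
    using winner_cnj[OF s assms(1)] winner_add_left[OF assms assms(1)] by simp
  also have "winner \<beta> b (\<lambda>n. a n + b n) = cnj (winner \<beta> a b + winner \<beta> b b)"
    using winner_cnj[OF s assms(2)] winner_add_left[OF assms assms(2)] by simp
  also have "winner \<beta> b a = cnj (winner \<beta> a b)" by (rule winner_cnj[OF assms])
  finally have "complex_of_real (wsq \<beta> (\<lambda>n. a n + b n)) =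
      cnj (winner \<beta> a a + cnj (winner \<beta> a b)) + cnj (winner \<beta> a b + winner \<beta> b b)"
    using winner_self[OF s] by simp
  then have "Re (complex_of_real (wsq \<beta> (\<lambda>n. a n + b n))) = 
     Re (cnj (winner \<beta> a a + cnj (winner \<beta> a b)) + cnj (winner \<beta> a b + winner \<beta> b b))" by simp
  then show ?thesis
    using winner_self[OF assms(1)] winner_self[OF assms(2)] by simp
qed

subsection \<open>Holomorphic functions with weighted square-summable coefficients\<close>

text \<open>Leaves the values outside the disk free, so that products and compositions can be
  written without truncation; \<open>weighted_hardy_iff\<close> restores the convention of extension
  by 0.\<close>

definition hardy_fun :: "(nat \<Rightarrow> real) \<Rightarrow> (complex \<Rightarrow> complex) \<Rightarrow> bool"
  where "hardy_fun \<beta> f \<longleftrightarrow> f holomorphic_on \<D> \<and> wsummable \<beta> (taylor_coeff f)"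

abbreviation nsq :: "(nat \<Rightarrow> real) \<Rightarrow> (complex \<Rightarrow> complex) \<Rightarrow> real"
  where "nsq \<beta> f \<equiv> wsq \<beta> (taylor_coeff f)"

lemma hardy_fun_cong:
  assumes "\<And>z. z \<in> \<D> \<Longrightarrow> f z = g z"
  shows "hardy_fun \<beta> f = hardy_fun \<beta> g"
  using taylor_coeff_cong[OF assms] holomorphic_cong[OF refl assms, of \<D>]
  by (simp add: hardy_fun_def)

lemma hardy_fun_add:
  assumes "hardy_fun \<beta> f" "hardy_fun \<beta> g"
  shows "hardy_fun \<beta> (\<lambda>z. f z + g z)" "nsq \<beta> (\<lambda>z. f z + g z) \<le> 2 * nsq \<beta> f + 2 * nsq \<beta> g"
  using assms wsq_add[of \<beta> "taylor_coeff f" "taylor_coeff g"]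
  by (auto simp: hardy_fun_def taylor_coeff_add intro!: holomorphic_intros)

lemma hardy_fun_cmult:
  assumes "hardy_fun \<beta> f"
  shows "hardy_fun \<beta> (\<lambda>z. c * f z)" "nsq \<beta> (\<lambda>z. c * f z) = (cmod c)\<^sup>2 * nsq \<beta> f"
  using assms wsq_cmult[of \<beta> "taylor_coeff f" c]
  by (auto simp: hardy_fun_def taylor_coeff_cmult intro!: holomorphic_intros)

lemma hardy_fun_poly: "hardy_fun \<beta> (poly p)"
proof -
  have "wsummable \<beta> (coeff p)" unfolding wsummable_def
    by (rule summable_finite[of "{..degree p}"]) (auto simp: coeff_eq_0)
  then show ?thesis
    unfolding hardy_fun_def taylor_coeff_poly poly_altdef by (auto intro!: holomorphic_intros)
qed

subsection \<open>Multiplication by functions holomorphic beyond the closed disk\<close>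

text \<open>Says that the shift by \<open>j\<close> places has norm of at most polynomial growth in
  \<open>j\<close>, which a multiplier with geometrically decaying coefficients can absorb.\<close>

definition moderate :: "(nat \<Rightarrow> real) \<Rightarrow> bool"
  where "moderate \<beta> \<longleftrightarrow> (\<forall>n. \<beta> n > 0) \<and>
    (\<exists>K s. \<forall>n j. \<beta> (n + j) \<le> K * (1 + real j) ^ s * \<beta> n)"

text \<open>Choose \<open>1 < q < r < R\<close>: the coefficients are O(r^-j) by convergence at
  \<open>r\<close>, the polynomial factor is O(q^j), and a geometric series with ratio
  \<open>q / r\<close> remains.\<close>

lemma summable_taylor_coeff_moderate:
  assumes "u holomorphic_on ball 0 R" "R > 1"
  shows "summable (\<lambda>j. cmod (taylor_coeff u j) * (1 + real j) ^ s)"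
proof -
  obtain r where r: "1 < r" "r < R" using dense[OF assms(2)] by blast
  have "u has_fps_expansion fps_expansion u 0"
    using has_fps_expansion_fps_expansion[OF _ _ assms(1)] assms(2) by simp
  then have "(\<lambda>n. taylor_coeff u n * (complex_of_real r) ^ n) sums u (complex_of_real r)"
    by (rule has_fps_expansion_imp_sums_complex[where r = R]) (use assms r in auto)
  then have "Bseq (\<lambda>n. taylor_coeff u n * (complex_of_real r) ^ n)"
    by (intro convergent_imp_Bseq convergentI[OF summable_LIMSEQ_zero] sums_summable)
  then obtain B where B: "\<And>n. cmod (taylor_coeff u n * (complex_of_real r) ^ n) \<le> B"
    unfolding Bseq_def by blast
  have B0: "B \<ge> 0" using order_trans[OF norm_ge_zero B[of 0]] .
  obtain q where q: "1 < q" "q < r" using dense[OF r(1)] by blast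
  have "(\<lambda>n. (1 + real n) ^ s * (1/q) ^ n) \<longlonglongrightarrow> 0"
  proof -
    have "(\<lambda>n. (1 + real n) ^ s / q powr (real n)) \<longlonglongrightarrow> 0"
      using q by real_asymp
    then show ?thesis using q by (simp add: powr_realpow power_divide)
  qed
  then have "Bseq (\<lambda>n. (1 + real n) ^ s * (1/q) ^ n)"
    by (intro convergent_imp_Bseq convergentI)
  then obtain E where E: "\<And>n. norm ((1 + real n) ^ s * (1/q) ^ n) \<le> E"
    unfolding Bseq_def by blast
  have E0: "E \<ge> 0" using order_trans[OF norm_ge_zero E[of 0]] .
  have "summable (\<lambda>n. B * E * (q / r) ^ n)"
    using q r by (intro summable_mult summable_geometric) auto
  then show ?thesis
  proof (rule summable_comparison_test')
    fix n
    have "cmod (taylor_coeff u n) * (1 + real n) ^ s =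
      cmod (taylor_coeff u n * (complex_of_real r) ^ n) * ((1 + real n) ^ s * (1/q) ^ n) * (q/r) ^ n"
      using q r by (simp add: norm_mult norm_power power_divide field_simps)
    also have "\<dots> \<le> B * E * (q/r) ^ n"
      using B[of n] E[of n] B0 E0 q r by (intro mult_right_mono mult_mono) auto
    finally show "norm (cmod (taylor_coeff u n) * (1 + real n) ^ s) \<le> B * E * (q/r) ^ n"
      by simp
  qed
qed

text \<open>Young's inequality for the convolution of an \<open>\<ell>\<^sup>1\<close> with an \<open>\<ell>\<^sup>2\<close> sequence.\<close>
lemma mult_bounded:
  assumes u: "u holomorphic_on ball 0 R" "R > 1" and \<beta>: "moderate \<beta>"
  shows "\<exists>M\<ge>0. \<forall>f. hardy_fun \<beta> f \<longrightarrow> hardy_fun \<beta> (\<lambda>z. u z * f z) \<and>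
    nsq \<beta> (\<lambda>z. u z * f z) \<le> M * nsq \<beta> f"
proof -
  obtain K0 s where K0: "\<And>n j. \<beta> (n + j) \<le> K0 * (1 + real j) ^ s * \<beta> n" and pos: "\<And>n. \<beta> n > 0"
    using \<beta> unfolding moderate_def by blast
  define K where "K = max K0 0"
  have K: "\<beta> (n + j) \<le> K * (1 + real j) ^ s * \<beta> n" for n j
    using K0[of n j] pos[of n] unfolding K_def
    by (smt (verit, best) mult_right_mono zero_le_power of_nat_0_le_iff)
  have K_nn: "K \<ge> 0" by (simp add: K_def)
  define A where "A j = K * (cmod (taylor_coeff u j) * (1 + real j) ^ s)" for j
  have A_nn: "A j \<ge> 0" for j using K_nn by (simp add: A_def)
  have A_s: "summable A"
    unfolding A_def by (intro summable_mult summable_taylor_coeff_moderate[OF u])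
  have hu: "u holomorphic_on \<D>" using u by (auto intro: holomorphic_on_subset)
  show ?thesis
  proof (intro exI[of _ "(suminf A)\<^sup>2"] conjI allI impI)
    fix f assume f: "hardy_fun \<beta> f"
    then have hf: "f holomorphic_on \<D>" and sf: "wsummable \<beta> (taylor_coeff f)"
      by (auto simp: hardy_fun_def)
    define x where "x n = cmod (taylor_coeff f n) * \<beta> n" for n
    have x_sums: "(\<lambda>n. (x n)\<^sup>2) sums nsq \<beta> f"
      using wsq_sums[OF sf] by (simp add: x_def power_mult_distrib)
    have tm: "cmod (taylor_coeff (\<lambda>z. u z * f z) n) * \<beta> n \<le> (\<Sum>i\<le>n. A i * x (n - i))" for n
    proof -
      have "cmod (taylor_coeff (\<lambda>z. u z * f z) n) * \<beta> n \<le>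
          (\<Sum>i\<le>n. cmod (taylor_coeff u i) * cmod (taylor_coeff f (n - i))) * \<beta> n"
        unfolding taylor_coeff_mult[OF hu hf] using pos[of n]
        by (intro mult_right_mono order_trans[OF norm_sum]) (auto simp: norm_mult)
      also have "\<dots> = (\<Sum>i\<le>n. cmod (taylor_coeff u i) * cmod (taylor_coeff f (n - i)) * \<beta> n)"
        by (rule sum_distrib_right)
      also have "\<dots> \<le> (\<Sum>i\<le>n. A i * x (n - i))"
      proof (rule sum_mono)
        fix i assume "i \<in> {..n}"
        then have "\<beta> n \<le> K * (1 + real i) ^ s * \<beta> (n - i)" using K[of "n - i" i] by simp
        then have "cmod (taylor_coeff u i) * cmod (taylor_coeff f (n - i)) * \<beta> n \<le>
          cmod (taylor_coeff u i) * cmod (taylor_coeff f (n - i)) * (K * (1 + real i) ^ s * \<beta> (n - i))"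
          by (intro mult_left_mono) auto
        then show "cmod (taylor_coeff u i) * cmod (taylor_coeff f (n - i)) * \<beta> n \<le> A i * x (n - i)"
          by (simp add: A_def x_def mult_ac)
      qed
      finally show ?thesis .
    qed
    have sq: "(cmod (taylor_coeff (\<lambda>z. u z * f z) n))\<^sup>2 * (\<beta> n)\<^sup>2 \<le>
        suminf A * (\<Sum>i\<le>n. A i * (x (n - i))\<^sup>2)" for n
    proof -
      have "(cmod (taylor_coeff (\<lambda>z. u z * f z) n))\<^sup>2 * (\<beta> n)\<^sup>2 \<le> (\<Sum>i\<le>n. A i * x (n - i))\<^sup>2"
        using power_mono[OF tm[of n], of 2] pos[of n] by (simp add: power_mult_distrib)
      \<comment> \<open>Splitting \<open>A i\<close> into two square roots makes Cauchy-Schwarz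
        produce the sum of \<open>A\<close> times the convolution of \<open>A\<close> with the
        squares of \<open>x\<close>. The Cauchy product supplies the second factor
        \<open>suminf A\<close>.\<close>
      also have "(\<Sum>i\<le>n. A i * x (n - i)) = (\<Sum>i\<le>n. sqrt (A i) * (sqrt (A i) * x (n - i)))"
        using A_nn by (intro sum.cong) (auto simp flip: mult.assoc)
      also have "\<dots>\<^sup>2 \<le> (\<Sum>i\<le>n. (sqrt (A i))\<^sup>2) * (\<Sum>i\<le>n. (sqrt (A i) * x (n - i))\<^sup>2)"
        by (rule Cauchy_Schwarz_ineq_sum)
      also have "\<dots> = (\<Sum>i\<le>n. A i) * (\<Sum>i\<le>n. A i * (x (n - i))\<^sup>2)"
        using A_nn by (simp add: power_mult_distrib)
      also have "\<dots> \<le> suminf A * (\<Sum>i\<le>n. A i * (x (n - i))\<^sup>2)"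
        using A_nn A_s by (intro mult_right_mono sum_le_suminf sum_nonneg) auto
      finally show ?thesis .
    qed
    have "(\<lambda>n. \<Sum>i\<le>n. A i * (x (n - i))\<^sup>2) sums (suminf A * (\<Sum>n. (x n)\<^sup>2))"
      using A_s A_nn sums_summable[OF x_sums] by (intro Cauchy_product_sums) auto
    then have "(\<lambda>n. suminf A * (\<Sum>i\<le>n. A i * (x (n - i))\<^sup>2)) sums (suminf A * (suminf A * nsq \<beta> f))"
      using sums_unique[OF x_sums] by (intro sums_mult) simp
    then have S: "(\<lambda>n. suminf A * (\<Sum>i\<le>n. A i * (x (n - i))\<^sup>2)) sums ((suminf A)\<^sup>2 * nsq \<beta> f)"
      by (simp add: power2_eq_square mult.assoc)
    have *: "wsummable \<beta> (taylor_coeff (\<lambda>z. u z * f z))"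
      unfolding wsummable_def
      by (rule summable_comparison_test'[OF sums_summable[OF S]]) (use sq in auto)
    then show "hardy_fun \<beta> (\<lambda>z. u z * f z)"
      using hu hf by (auto simp: hardy_fun_def intro!: holomorphic_intros)
    show "nsq \<beta> (\<lambda>z. u z * f z) \<le> (suminf A)\<^sup>2 * nsq \<beta> f"
      by (rule sums_le[OF sq wsq_sums[OF *] S])
  qed simp
qed

subsection \<open>Composition operators\<close>

definition taylor_poly :: "(complex \<Rightarrow> complex) \<Rightarrow> nat \<Rightarrow> complex poly"
  where "taylor_poly f N = Poly (map (taylor_coeff f) [0..<N])"

lemma coeff_taylor_poly: "coeff (taylor_poly f N) n = (if n < N then taylor_coeff f n else 0)"
  by (auto simp: taylor_poly_def nth_default_def)

lemma poly_taylor_poly: "poly (taylor_poly f N) z = (\<Sum>n<N. taylor_coeff f n * z ^ n)"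
proof -
  have "(\<lambda>n. coeff (taylor_poly f N) n * z ^ n) sums (\<Sum>n<N. coeff (taylor_poly f N) n * z ^ n)"
    by (rule sums_finite) (auto simp: coeff_taylor_poly)
  moreover have "(\<lambda>n. coeff (taylor_poly f N) n * z ^ n) sums
      (\<Sum>n\<le>degree (taylor_poly f N). coeff (taylor_poly f N) n * z ^ n)"
    by (rule sums_finite) (auto simp: coeff_eq_0)
  ultimately show ?thesis by (simp add: sums_unique2 poly_altdef coeff_taylor_poly)
qed

definition comp_bounded :: "(nat \<Rightarrow> real) \<Rightarrow> (complex \<Rightarrow> complex) \<Rightarrow> bool"
  where "comp_bounded \<beta> \<phi> \<longleftrightarrow> (\<exists>M\<ge>0. \<forall>f. hardy_fun \<beta> f \<longrightarrow>
    hardy_fun \<beta> (\<lambda>z. f (\<phi> z)) \<and> nsq \<beta> (\<lambda>z. f (\<phi> z)) \<le> M * nsq \<beta> f)"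

text \<open>Each Taylor coefficient of the composite is the limit of those of the composed Taylor
  polynomials, so the uniform bound passes to finite sections and from there to the whole
  norm.\<close>

lemma comp_bounded_if_poly:
  assumes \<phi>: "\<phi> holomorphic_on \<D>" "\<phi> ` \<D> \<subseteq> \<D>" and M: "M \<ge> 0"
    and le: "\<And>p. hardy_fun \<beta> (\<lambda>z. poly p (\<phi> z)) \<and> nsq \<beta> (\<lambda>z. poly p (\<phi> z)) \<le> M * wsq \<beta> (coeff p)"
  shows "comp_bounded \<beta> \<phi>"
  unfolding comp_bounded_def
proof (intro exI[of _ M] conjI allI impI M)
  fix f assume f: "hardy_fun \<beta> f"
  then have hf: "f holomorphic_on \<D>" and sf: "wsummable \<beta> (taylor_coeff f)"
    by (auto simp: hardy_fun_def)
  define p where "p N = taylor_poly f N" for N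
  have cp: "coeff (p N) n = (if n < N then taylor_coeff f n else 0)" for N n
    by (simp add: p_def coeff_taylor_poly)
  have pp: "poly (p N) z = (\<Sum>n<N. taylor_coeff f n * z ^ n)" for N z
    by (simp add: p_def poly_taylor_poly)
  have wp: "wsq \<beta> (coeff (p N)) \<le> nsq \<beta> f" for N
    using wsq_dominated(2)[OF sf, of "coeff (p N)" \<beta> 1] by (auto simp: cp)
  have hc: "(\<lambda>z. f (\<phi> z)) holomorphic_on \<D>"
    using holomorphic_on_compose_gen[OF \<phi>(1) hf \<phi>(2)] by (simp add: o_def)
  have lim: "(\<lambda>N. taylor_coeff (\<lambda>z. poly (p N) (\<phi> z)) m) \<longlonglongrightarrow> taylor_coeff (\<lambda>z. f (\<phi> z)) m" for m
  proof -
    \<comment> \<open>Coefficients at 0 only see a neighbourhood of 0. The image of a small closed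
      disk is compact, hence lies in some \<open>cball 0 r\<close> with \<open>r < 1\<close>, where
      the Taylor polynomials converge uniformly.\<close>
    have "compact (\<phi> ` cball 0 (1/2))"
      using \<phi>(1) by (intro compact_continuous_image holomorphic_on_imp_continuous_on)
        (auto intro: holomorphic_on_subset)
    moreover have "\<phi> ` cball 0 (1/2) \<subseteq> \<D>" using \<phi>(2) by (auto simp: image_subset_iff)
    ultimately obtain r where r: "r < 1" "\<phi> ` cball 0 (1/2) \<subseteq> cball 0 r"
    proof -
      assume *: "compact (\<phi> ` cball 0 (1/2))" "\<phi> ` cball 0 (1/2) \<subseteq> \<D>"
        and **: "\<And>r. r < 1 \<Longrightarrow> \<phi> ` cball 0 (1 / 2) \<subseteq> cball 0 r \<Longrightarrow> thesis"
      have "compact ((\<lambda>z. norm z) ` \<phi> ` cball 0 (1/2))"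
        by (intro compact_continuous_image *) (auto intro!: continuous_intros)
      then obtain y where "y \<in> (\<lambda>z. norm z) ` \<phi> ` cball 0 (1/2)"
         "\<And>x. x \<in> (\<lambda>z. norm z) ` \<phi> ` cball 0 (1/2) \<Longrightarrow> x \<le> y"
        using compact_attains_sup[of "(\<lambda>z. norm z) ` \<phi> ` cball 0 (1/2)"] by force
      with *(2) show thesis by (intro **[of y]) (auto simp: image_subset_iff)
    qed
    have "ereal r < ereal 1" using r(1) by simp
    also have "\<dots> \<le> conv_radius (taylor_coeff f)"
      using conv_radius_fps_expansion[of f 0 1] hf by (simp add: one_ereal_def fps_conv_radius_def)
    finally have "ereal r < conv_radius (taylor_coeff f)" .
    then have "uniform_limit (cball 0 r) (\<lambda>N z. \<Sum>n<N. taylor_coeff f n * (z - 0) ^ n)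
        (\<lambda>z. suminf (\<lambda>n. taylor_coeff f n * (z - 0) ^ n)) sequentially"
      by (rule powser_uniform_limit)
    then have "uniform_limit (cball 0 r) (\<lambda>N z. poly (p N) z) f sequentially"
    proof (rule uniform_limit_cong'[THEN iffD1, rotated 2])
      fix z :: complex assume "z \<in> cball 0 r"
      then show "(\<Sum>n. taylor_coeff f n * (z - 0) ^ n) = f z"
        using taylor_coeff_sums[OF hf, of z] r(1) by (auto simp: sums_iff)
    qed (simp add: pp)
    then have "uniform_limit (cball 0 (1/2)) (\<lambda>N z. poly (p N) (\<phi> z)) (\<lambda>z. f (\<phi> z)) sequentially"
      by (rule uniform_limit_compose') (use r(2) in blast)
    then have "uniform_limit (ball 0 (1/2)) (\<lambda>N z. poly (p N) (\<phi> z)) (\<lambda>z. f (\<phi> z)) sequentially"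
      by (rule uniform_limit_on_subset) auto
    then have "(\<lambda>N. (deriv ^^ m) (\<lambda>z. poly (p N) (\<phi> z)) 0) \<longlonglongrightarrow> (deriv ^^ m) (\<lambda>z. f (\<phi> z)) 0"
      by (rule higher_deriv_complex_uniform_limit)
        (use \<phi> in \<open>auto simp: poly_altdef intro!: always_eventually holomorphic_intros
           intro: holomorphic_on_subset\<close>)
    then show ?thesis by (auto simp: fps_expansion_def intro!: tendsto_intros)
  qed
  have part: "(\<Sum>n<K. (cmod (taylor_coeff (\<lambda>z. f (\<phi> z)) n))\<^sup>2 * (\<beta> n)\<^sup>2) \<le> M * nsq \<beta> f" for K
  proof (rule LIMSEQ_le_const2)
    show "(\<lambda>N. \<Sum>n<K. (cmod (taylor_coeff (\<lambda>z. poly (p N) (\<phi> z)) n))\<^sup>2 * (\<beta> n)\<^sup>2)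
        \<longlonglongrightarrow> (\<Sum>n<K. (cmod (taylor_coeff (\<lambda>z. f (\<phi> z)) n))\<^sup>2 * (\<beta> n)\<^sup>2)"
      by (intro tendsto_intros lim)
    have "(\<Sum>n<K. (cmod (taylor_coeff (\<lambda>z. poly (p N) (\<phi> z)) n))\<^sup>2 * (\<beta> n)\<^sup>2) \<le> M * nsq \<beta> f" for N
    proof -
      have "(\<Sum>n<K. (cmod (taylor_coeff (\<lambda>z. poly (p N) (\<phi> z)) n))\<^sup>2 * (\<beta> n)\<^sup>2) \<le>
          nsq \<beta> (\<lambda>z. poly (p N) (\<phi> z))"
        using le[of "p N"] by (intro wsq_sum_le) (auto simp: hardy_fun_def)
      also have "\<dots> \<le> M * wsq \<beta> (coeff (p N))" using le by blast
      also have "\<dots> \<le> M * nsq \<beta> f" by (intro mult_left_mono wp M)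
      finally show ?thesis .
    qed
    then show "\<exists>N. \<forall>n\<ge>N. (\<Sum>na<K. (cmod (taylor_coeff (\<lambda>z. poly (p n) (\<phi> z)) na))\<^sup>2 * (\<beta> na)\<^sup>2)
        \<le> M * nsq \<beta> f" by blast
  qed
  show "hardy_fun \<beta> (\<lambda>z. f (\<phi> z))"
    using wsq_leI(1)[OF part] hc by (simp add: hardy_fun_def)
  show "nsq \<beta> (\<lambda>z. f (\<phi> z)) \<le> M * nsq \<beta> f"
    by (rule wsq_leI(2)[OF part])
qed

subsection \<open>Linear fractional maps on the Hardy space\<close>

text \<open>The self-map property is an inequality between numerator and denominator, so that it
  becomes a quadratic form. Nonvanishing is demanded on the closed disk to make
  \<open>1 / (c * z + d)\<close> holomorphic on a larger one and thus a bounded multiplier.\<close>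

definition lft_self :: "complex \<Rightarrow> complex \<Rightarrow> complex \<Rightarrow> complex \<Rightarrow> bool"
  where "lft_self a b c d \<longleftrightarrow>
    (\<forall>z\<in>cball 0 1. c * z + d \<noteq> 0) \<and> (\<forall>z\<in>\<D>. cmod (a * z + b) < cmod (c * z + d))"

lemma linear_nonzero_iff: "(\<forall>z\<in>cball 0 1. c * z + d \<noteq> 0) \<longleftrightarrow> cmod c < cmod d" for c d :: complex
proof
  assume *: "\<forall>z\<in>cball 0 1. c * z + d \<noteq> 0"
  show "cmod c < cmod d"
  proof (rule ccontr)
    assume n: "\<not> cmod c < cmod d"
    show False
    proof (cases "c = 0")
      case True
      then show False using n *[rule_format, of 0] by auto
    next
      case False
      then show False using n *[rule_format, of "- d / c"] by (auto simp: norm_divide)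
    qed
  qed
next
  assume *: "cmod c < cmod d"
  show "\<forall>z\<in>cball 0 1. c * z + d \<noteq> 0"
  proof
    fix z :: complex assume "z \<in> cball 0 1"
    then have "cmod (c * z) \<le> cmod c" by (auto simp: norm_mult mult_left_le)
    then show "c * z + d \<noteq> 0" using * by (metis add_eq_0_iff linorder_not_less norm_minus_cancel)
  qed
qed

text \<open>The root \<open>- d / c\<close> has modulus above 1, and that modulus serves as
  \<open>R\<close>. The second conclusion places \<open>1 + c / d * z\<close> in the right
  half-plane and lets geometric series converge.\<close>

lemma linear_nonzero_beyond:
  assumes "cmod c < cmod d"
  shows "\<exists>R>1. \<forall>z\<in>ball 0 R. c * z + d \<noteq> 0 \<and> cmod (c * z) < cmod d"
proof -
  define R where "R = (if c = 0 then 2 else cmod d / cmod c)"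
  have lt: "cmod (c * z) < cmod d" if "z \<in> ball 0 R" for z
    using that assms by (auto simp: R_def norm_mult field_simps split: if_splits)
  moreover have "c * z + d \<noteq> 0" if "z \<in> ball 0 R" for z
    using lt[OF that] by (metis add_eq_0_iff order_less_irrefl norm_minus_cancel)
  moreover have "R > 1" using assms by (auto simp: R_def field_simps)
  ultimately show ?thesis by blast
qed

lemma cmod_add_sq: "(cmod (x + y))\<^sup>2 = (cmod x)\<^sup>2 + (cmod y)\<^sup>2 + 2 * Re (x * cnj y)"
  unfolding cmod_power2 by (simp add: power2_eq_square algebra_simps)

text \<open>On the unit circle, |cz + d|^2 - |az + b|^2 is a constant plus
  \<open>2 * Re (q * z)\<close>. It is nonnegative there by continuity, and the claim is this fact
  at the point where it is smallest.\<close>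

lemma lft_self_form:
  assumes "lft_self a b c d"
  shows "2 * cmod (c * cnj d - a * cnj b) \<le>
    (cmod c)\<^sup>2 + (cmod d)\<^sup>2 - (cmod a)\<^sup>2 - (cmod b)\<^sup>2"
proof -
  define q where "q = c * cnj d - a * cnj b"
  \<comment> \<open>The point of the circle where \<open>Re (q * z)\<close> attains its minimum
    \<open>- cmod q\<close>.\<close>
  define z where "z = (if q = 0 then 1 else - cnj q / complex_of_real (cmod q))"
  have z: "cmod z = 1" by (auto simp: z_def norm_divide)
  have qz: "Re (q * z) = - cmod q"
  proof (cases "q = 0")
    case False
    have "q * z = - (q * cnj q) / complex_of_real (cmod q)" using False by (simp add: z_def)
    also have "q * cnj q = complex_of_real ((cmod q)\<^sup>2)" by (rule complex_norm_square[symmetric])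
    finally have "q * z = complex_of_real (- cmod q)" using False by (simp add: power2_eq_square)
    then show ?thesis by simp
  qed simp
  have "(cmod (c * w + d))\<^sup>2 - (cmod (a * w + b))\<^sup>2 \<ge> 0" if "w \<in> closure \<D>" for w
  proof (rule continuous_ge_on_closure[OF _ that])
    fix x assume "x \<in> \<D>"
    then have "cmod (a * x + b) \<le> cmod (c * x + d)" using assms unfolding lft_self_def by force
    then show "0 \<le> (cmod (c * x + d))\<^sup>2 - (cmod (a * x + b))\<^sup>2" by (simp add: power_mono)
  qed (intro continuous_intros)
  then have "(cmod (c * z + d))\<^sup>2 - (cmod (a * z + b))\<^sup>2 \<ge> 0" using z by simp
  moreover have "(cmod (c * z + d))\<^sup>2 - (cmod (a * z + b))\<^sup>2 =
     (cmod c)\<^sup>2 + (cmod d)\<^sup>2 - (cmod a)\<^sup>2 - (cmod b)\<^sup>2 + 2 * Re (q * z)"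
    unfolding cmod_add_sq by (simp add: norm_mult z q_def algebra_simps)
  ultimately show ?thesis unfolding qz q_def[symmetric] by linarith
qed

abbreviation unit_weight :: "nat \<Rightarrow> real"
  where "unit_weight \<equiv> (\<lambda>_. 1)"

lemma moderate_unit: "moderate unit_weight"
  unfolding moderate_def
  by (intro conjI allI exI[of _ "1 :: real"] exI[of _ "0 :: nat"]) auto

lemma taylor_coeff_times_z:
  assumes "f holomorphic_on \<D>"
  shows "taylor_coeff (\<lambda>z. z * f z) n = (case n of 0 \<Rightarrow> 0 | Suc m \<Rightarrow> taylor_coeff f m)"
proof -
  have "(\<lambda>z. z * f z) has_fps_expansion fps_X * fps_expansion f 0"
    by (intro has_fps_expansion_mult has_fps_expansion_fps_X taylor_has_fps assms)
  from fps_expansion_eqI[OF this] show ?thesis by (auto split: nat.split)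
qed

lemma hardy_times_z:
  assumes "hardy_fun unit_weight f"
  shows "hardy_fun unit_weight (\<lambda>z. z * f z)" "nsq unit_weight (\<lambda>z. z * f z) = nsq unit_weight f"
proof -
  have hf: "f holomorphic_on \<D>" and sf: "wsummable unit_weight (taylor_coeff f)"
    using assms by (auto simp: hardy_fun_def)
  have "(\<lambda>n. (cmod (taylor_coeff (\<lambda>z. z * f z) (Suc n)))\<^sup>2) sums nsq unit_weight f"
    using wsq_sums[OF sf] by (simp add: taylor_coeff_times_z[OF hf])
  then have *: "(\<lambda>n. (cmod (taylor_coeff (\<lambda>z. z * f z) n))\<^sup>2) sums nsq unit_weight f"
    by (subst (asm) sums_Suc_iff) (simp add: taylor_coeff_times_z[OF hf])
  then show "hardy_fun unit_weight (\<lambda>z. z * f z)" "nsq unit_weight (\<lambda>z. z * f z) = nsq unit_weight f"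
    using hf by (auto simp: hardy_fun_def wsummable_def wsq_def sums_iff intro!: holomorphic_intros)
qed

text \<open>The shift is isometric, so both squares are multiples of the norm of \<open>y\<close>,
  and the only other datum is the pairing of \<open>z * y z\<close> with \<open>y\<close>, which is
  the same for all \<open>p\<close> and \<open>q\<close>.\<close>

lemma hardy_linear_mult:
  assumes "hardy_fun unit_weight y"
  shows "hardy_fun unit_weight (\<lambda>z. (p * z + q) * y z)"
    and "nsq unit_weight (\<lambda>z. (p * z + q) * y z) = ((cmod p)\<^sup>2 + (cmod q)\<^sup>2) * nsq unit_weight y
      + 2 * Re (p * cnj q * winner unit_weight (taylor_coeff (\<lambda>z. z * y z)) (taylor_coeff y))"
proof -
  let ?a = "taylor_coeff (\<lambda>z. z * y z)" and ?b = "taylor_coeff y"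
  note S = hardy_times_z[OF assms]
  have hy: "y holomorphic_on \<D>" and hz: "(\<lambda>z. z * y z) holomorphic_on \<D>"
    and b: "wsummable unit_weight ?b" and a: "wsummable unit_weight ?a"
    using assms S by (auto simp: hardy_fun_def)
  have eq: "(\<lambda>z. (p * z + q) * y z) = (\<lambda>z. p * (z * y z) + q * y z)"
    by (simp add: algebra_simps)
  have tc: "taylor_coeff (\<lambda>z. (p * z + q) * y z) = (\<lambda>n. p * ?a n + q * ?b n)"
    unfolding eq
    by (subst taylor_coeff_add) (use hy hz in \<open>auto simp: taylor_coeff_cmult intro!: holomorphic_intros\<close>)
  show "hardy_fun unit_weight (\<lambda>z. (p * z + q) * y z)"
    unfolding eq by (intro hardy_fun_add hardy_fun_cmult assms S)
  have ap: "wsummable unit_weight (\<lambda>n. p * ?a n)" and bq: "wsummable unit_weight (\<lambda>n. q * ?b n)"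
    by (intro wsq_cmult a b)+
  have "winner unit_weight (\<lambda>n. p * ?a n) (\<lambda>n. q * ?b n) = p * winner unit_weight ?a (\<lambda>n. q * ?b n)"
    by (rule winner_cmult_left[OF a bq])
  also have "winner unit_weight ?a (\<lambda>n. q * ?b n) = cnj (q * winner unit_weight ?b ?a)"
    unfolding winner_cnj[OF bq a] winner_cmult_left[OF b a] ..
  also have "winner unit_weight ?b ?a = cnj (winner unit_weight ?a ?b)"
    by (rule winner_cnj[OF a b])
  finally have w: "winner unit_weight (\<lambda>n. p * ?a n) (\<lambda>n. q * ?b n) = p * cnj q * winner unit_weight ?a ?b"
    by simp
  show "nsq unit_weight (\<lambda>z. (p * z + q) * y z) = ((cmod p)\<^sup>2 + (cmod q)\<^sup>2) * nsq unit_weight y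
      + 2 * Re (p * cnj q * winner unit_weight ?a ?b)"
    unfolding tc wsq_add_eq[OF ap bq] w wsq_cmult(2)[OF a] wsq_cmult(2)[OF b] S(2)
    by (simp add: algebra_simps)
qed

text \<open>Multiplication by \<open>\<phi>\<close> is \<open>(aS + b)(cS + d)\<^sup>-\<^sup>1\<close> with the isometric shift \<open>S\<close>, so the
  contraction property is the positivity of a quadratic form in \<open>1\<close> and \<open>S\<close>.\<close>
lemma lft_mult_contraction:
  assumes \<phi>: "lft_self a b c d" and f: "hardy_fun unit_weight f"
  shows "hardy_fun unit_weight (\<lambda>z. (a * z + b) / (c * z + d) * f z)"
    and "nsq unit_weight (\<lambda>z. (a * z + b) / (c * z + d) * f z) \<le> nsq unit_weight f"
proof -
  have cd: "cmod c < cmod d" using \<phi> linear_nonzero_iff unfolding lft_self_def by blast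
  obtain R where R: "R > 1" "\<And>z. z \<in> ball 0 R \<Longrightarrow> c * z + d \<noteq> 0"
    using linear_nonzero_beyond[OF cd] by blast
  \<comment> \<open>Both \<open>f\<close> and \<open>\<phi> * f\<close> are linear polynomials times
    this \<open>y\<close>, so their norms involve the same two numbers \<open>Y\<close> and
    \<open>W\<close>, and \<open>cmod W \<le> Y\<close>.\<close>
  define y where "y z = 1 / (c * z + d) * f z" for z
  have "(\<lambda>z. 1 / (c * z + d)) holomorphic_on ball 0 R"
    using R(2) by (intro holomorphic_intros) auto
  then have y: "hardy_fun unit_weight y"
    using mult_bounded[OF _ R(1) moderate_unit] f unfolding y_def by blast
  have nz: "c * z + d \<noteq> 0" if "z \<in> \<D>" for z using that R by auto
  have e1: "(a * z + b) / (c * z + d) * f z = (a * z + b) * y z" for z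
    by (simp add: y_def)
  have e2: "(c * z + d) * y z = f z" if "z \<in> \<D>" for z using nz[OF that] by (simp add: y_def)
  note A = hardy_linear_mult[OF y, of a b] and C = hardy_linear_mult[OF y, of c d]
  show "hardy_fun unit_weight (\<lambda>z. (a * z + b) / (c * z + d) * f z)"
    unfolding e1 by (rule A)
  define W where "W = winner unit_weight (taylor_coeff (\<lambda>z. z * y z)) (taylor_coeff y)"
  define Y where "Y = nsq unit_weight y"
  have Y: "Y \<ge> 0" using y by (auto simp: Y_def hardy_fun_def intro: wsq_nonneg)
  have "(cmod W)\<^sup>2 \<le> Y * Y"
    using winner_cauchy_schwarz[of unit_weight "taylor_coeff (\<lambda>z. z * y z)" "taylor_coeff y"]
      y hardy_times_z[OF y] by (simp add: W_def Y_def hardy_fun_def)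
  then have W: "cmod W \<le> Y" using Y by (metis power2_eq_square power2_le_imp_le)
  have "nsq unit_weight f = nsq unit_weight (\<lambda>z. (c * z + d) * y z)"
    using taylor_coeff_cong[of "\<lambda>z. (c * z + d) * y z" f] e2 by simp
  then have "nsq unit_weight f - nsq unit_weight (\<lambda>z. (a * z + b) * y z) =
      ((cmod c)\<^sup>2 + (cmod d)\<^sup>2 - (cmod a)\<^sup>2 - (cmod b)\<^sup>2) * Y + 2 * Re ((c * cnj d - a * cnj b) * W)"
    using A(2) C(2) by (simp add: W_def Y_def algebra_simps)
  moreover have "\<bar>Re ((c * cnj d - a * cnj b) * W)\<bar> \<le> cmod (c * cnj d - a * cnj b) * Y"
    using abs_Re_le_cmod[of "(c * cnj d - a * cnj b) * W"] mult_left_mono[OF W norm_ge_zero[of "c * cnj d - a * cnj b"]]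
    by (simp add: norm_mult)
  moreover have "2 * cmod (c * cnj d - a * cnj b) * Y \<le>
      ((cmod c)\<^sup>2 + (cmod d)\<^sup>2 - (cmod a)\<^sup>2 - (cmod b)\<^sup>2) * Y"
    by (rule mult_right_mono[OF lft_self_form[OF \<phi>] Y])
  ultimately show "nsq unit_weight (\<lambda>z. (a * z + b) / (c * z + d) * f z) \<le> nsq unit_weight f"
    unfolding e1 by linarith
qed

lemma lft_self_holomorphic:
  assumes "lft_self a b c d"
  shows "(\<lambda>z. (a * z + b) / (c * z + d)) holomorphic_on \<D>"
    and "(\<lambda>z. (a * z + b) / (c * z + d)) ` \<D> \<subseteq> \<D>"
  using assms unfolding lft_self_def
  by (auto intro!: holomorphic_intros simp: norm_divide divide_simps)

text \<open>If \<open>\<phi>\<close> vanishes at \<open>e\<close>, then multiples of \<open>\<phi>\<close> are orthogonal to the Szego kernel \<open>v\<close> at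
  \<open>e\<close>, and \<open>p \<mapsto> v (p \<circ> \<phi>)\<close> is bounded by Horner's scheme and Pythagoras.\<close>
lemma hardy_comp_bounded_zero:
  assumes \<phi>: "lft_self a b c d" and e: "e \<in> \<D>" "a * e + b = 0"
  shows "comp_bounded unit_weight (\<lambda>z. (a * z + b) / (c * z + d))"
proof -
  define \<phi> where "\<phi> z = (a * z + b) / (c * z + d)" for z
  define v where "v z = 1 / (1 - cnj e * z)" for z
  have ec: "cmod (- cnj e) < cmod 1" using e by simp
  obtain R where R: "R > 1" "\<And>z. z \<in> ball 0 R \<Longrightarrow> - cnj e * z + 1 \<noteq> 0"
    using linear_nonzero_beyond[OF ec] by blast
  have nz: "1 - cnj e * z \<noteq> 0" if "z \<in> ball 0 R" for z using R(2)[OF that] by simp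
  have tv: "v holomorphic_on \<D>" "taylor_coeff v = (\<lambda>n. cnj e ^ n)"
  proof -
    have "(\<lambda>n. cnj e ^ n * z ^ n) sums v z" if "z \<in> \<D>" for z
    proof -
      have "cmod (cnj e * z) < 1" using that e
        by (simp add: norm_mult) (metis mult_strict_mono' mult_1 norm_ge_zero)
      from geometric_sums[OF this] show ?thesis by (simp add: v_def power_mult_distrib)
    qed
    from taylor_coeffI[OF this] show "v holomorphic_on \<D>" "taylor_coeff v = (\<lambda>n. cnj e ^ n)" by auto
  qed
  have "summable (\<lambda>n. ((cmod e)\<^sup>2) ^ n)"
    using e by (intro summable_geometric) (simp add: power_less_one_iff abs_square_less_1)
  then have hv: "hardy_fun unit_weight v"
    using tv by (simp add: hardy_fun_def wsummable_def norm_power power_mult_distrib flip: power_mult)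
      (simp add: mult.commute)
  define V where "V = nsq unit_weight v"
  have main: "hardy_fun unit_weight (\<lambda>z. v z * poly p (\<phi> z)) \<and>
     nsq unit_weight (\<lambda>z. v z * poly p (\<phi> z)) \<le> V * wsq unit_weight (coeff p)" for p
  proof (induction p)
    case 0
    show ?case using hardy_fun_cmult[OF hv, of 0] by (simp add: wsq_def)
  next
    case (pCons c0 q)
    define G where "G z = v z * poly q (\<phi> z)" for z
    have G: "hardy_fun unit_weight G" "nsq unit_weight G \<le> V * wsq unit_weight (coeff q)"
      using pCons unfolding G_def by auto
    have G2: "hardy_fun unit_weight (\<lambda>z. \<phi> z * G z)" "nsq unit_weight (\<lambda>z. \<phi> z * G z) \<le> nsq unit_weight G"
      using lft_mult_contraction[OF \<phi> G(1)] unfolding \<phi>_def by auto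
    have eq: "(\<lambda>z. v z * poly (pCons c0 q) (\<phi> z)) = (\<lambda>z. c0 * v z + \<phi> z * G z)"
      by (simp add: G_def algebra_simps)
    have h: "hardy_fun unit_weight (\<lambda>z. c0 * v z)" by (rule hardy_fun_cmult[OF hv])
    have s: "wsummable unit_weight (taylor_coeff (\<lambda>z. c0 * v z))"
      "wsummable unit_weight (taylor_coeff (\<lambda>z. \<phi> z * G z))" "wsummable unit_weight (taylor_coeff v)"
      "(\<lambda>z. c0 * v z) holomorphic_on \<D>" "(\<lambda>z. \<phi> z * G z) holomorphic_on \<D>"
      using G2 h hv by (auto simp: hardy_fun_def)
    \<comment> \<open>The coefficients of \<open>v\<close> are \<open>cnj e ^ n\<close>, so pairing
      with \<open>v\<close> is evaluation at \<open>e\<close>, a zero of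
      \<open>\<phi>\<close>.\<close>
    have orth: "winner unit_weight (taylor_coeff (\<lambda>z. \<phi> z * G z)) (taylor_coeff v) = 0"
    proof -
      have "(\<lambda>n. taylor_coeff (\<lambda>z. \<phi> z * G z) n * e ^ n) sums (\<phi> e * G e)"
        by (rule taylor_coeff_sums[OF s(5) e(1)])
      moreover have "\<phi> e = 0" using e by (simp add: \<phi>_def)
      ultimately show ?thesis
        unfolding winner_def tv(2) by (simp add: sums_iff)
    qed
    have "nsq unit_weight (\<lambda>z. v z * poly (pCons c0 q) (\<phi> z)) = nsq unit_weight (\<lambda>z. c0 * v z) +
       2 * Re (winner unit_weight (taylor_coeff (\<lambda>z. c0 * v z)) (taylor_coeff (\<lambda>z. \<phi> z * G z)))
       + nsq unit_weight (\<lambda>z. \<phi> z * G z)"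
      unfolding eq taylor_coeff_add[OF s(4,5)] by (rule wsq_add_eq[OF s(1,2)])
    also have "winner unit_weight (taylor_coeff (\<lambda>z. c0 * v z)) (taylor_coeff (\<lambda>z. \<phi> z * G z)) = 0"
      unfolding taylor_coeff_cmult[OF tv(1)] winner_cmult_left[OF s(3,2)]
      using winner_cnj[OF s(2,3)] orth by simp
    also have "nsq unit_weight (\<lambda>z. c0 * v z) = (cmod c0)\<^sup>2 * V"
      unfolding V_def by (rule hardy_fun_cmult[OF hv])
    also have "(cmod c0)\<^sup>2 * V + 2 * Re 0 + nsq unit_weight (\<lambda>z. \<phi> z * G z) \<le>
        V * ((cmod c0)\<^sup>2 + wsq unit_weight (coeff q))"
      using G(2) G2(2) by (simp add: algebra_simps)
    also have "(cmod c0)\<^sup>2 + wsq unit_weight (coeff q) = wsq unit_weight (coeff (pCons c0 q))"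
    proof -
      have "wsummable unit_weight (coeff q)"
        using hardy_fun_poly[of unit_weight q] by (simp add: hardy_fun_def taylor_coeff_poly)
      then have "(\<lambda>n. (cmod (coeff (pCons c0 q) (Suc n)))\<^sup>2) sums wsq unit_weight (coeff q)"
        using wsq_sums by fastforce
      then have "(\<lambda>n. (cmod (coeff (pCons c0 q) n))\<^sup>2) sums (wsq unit_weight (coeff q) + (cmod c0)\<^sup>2)"
        by (subst (asm) sums_Suc_iff) simp
      then show ?thesis by (simp add: wsq_def sums_iff)
    qed
    finally show ?case
      unfolding eq using hardy_fun_add(1)[OF h G2(1)] by simp
  qed
  \<comment> \<open>Multiplication by this polynomial removes the factor \<open>v\<close> again, at
    the cost of \<open>M\<close>.\<close>
  have "(\<lambda>z. 1 - cnj e * z) holomorphic_on ball 0 R" by (intro holomorphic_intros)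
  then obtain M where M: "M \<ge> 0" "\<And>f. hardy_fun unit_weight f \<Longrightarrow>
       hardy_fun unit_weight (\<lambda>z. (1 - cnj e * z) * f z) \<and>
       nsq unit_weight (\<lambda>z. (1 - cnj e * z) * f z) \<le> M * nsq unit_weight f"
    using mult_bounded[OF _ R(1) moderate_unit] by blast
  have "comp_bounded unit_weight \<phi>"
  proof (rule comp_bounded_if_poly)
    show "\<phi> holomorphic_on \<D>" "\<phi> ` \<D> \<subseteq> \<D>"
      using lft_self_holomorphic[OF \<phi>] by (simp_all add: \<phi>_def[abs_def])
    show "M * V \<ge> 0" using M hv by (simp add: V_def wsq_nonneg hardy_fun_def)
    fix p
    have eq: "(1 - cnj e * z) * (v z * poly p (\<phi> z)) = poly p (\<phi> z)" if "z \<in> \<D>" for z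
      using nz[of z] that R(1) by (simp add: v_def)
    note * = M(2)[OF main[THEN conjunct1], of p]
    have "nsq unit_weight (\<lambda>z. poly p (\<phi> z)) \<le> M * nsq unit_weight (\<lambda>z. v z * poly p (\<phi> z))"
      using * taylor_coeff_cong[OF eq] by simp
    also have "\<dots> \<le> M * (V * wsq unit_weight (coeff p))"
      using main M(1) by (intro mult_left_mono) auto
    finally show "hardy_fun unit_weight (\<lambda>z. poly p (\<phi> z)) \<and>
        nsq unit_weight (\<lambda>z. poly p (\<phi> z)) \<le> M * V * wsq unit_weight (coeff p)"
      using * hardy_fun_cong[OF eq] by (simp add: mult.assoc)
  qed
  then show ?thesis by (simp add: \<phi>_def[abs_def])
qed

lemma comp_bounded_compose:
  assumes "comp_bounded \<beta> \<phi>" "comp_bounded \<beta> \<psi>"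
  shows "comp_bounded \<beta> (\<lambda>z. \<phi> (\<psi> z))"
proof -
  obtain M N where M: "M \<ge> 0" "\<And>f. hardy_fun \<beta> f \<Longrightarrow>
      hardy_fun \<beta> (\<lambda>z. f (\<phi> z)) \<and> nsq \<beta> (\<lambda>z. f (\<phi> z)) \<le> M * nsq \<beta> f"
    and N: "N \<ge> 0" "\<And>f. hardy_fun \<beta> f \<Longrightarrow>
      hardy_fun \<beta> (\<lambda>z. f (\<psi> z)) \<and> nsq \<beta> (\<lambda>z. f (\<psi> z)) \<le> N * nsq \<beta> f"
    using assms unfolding comp_bounded_def by blast
  show ?thesis unfolding comp_bounded_def
  proof (intro exI[of _ "N * M"] conjI allI impI)
    fix f assume f: "hardy_fun \<beta> f"
    show "hardy_fun \<beta> (\<lambda>z. f (\<phi> (\<psi> z)))" using M(2)[OF f] N(2) by blast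
    have "nsq \<beta> (\<lambda>z. f (\<phi> (\<psi> z))) \<le> N * nsq \<beta> (\<lambda>z. f (\<phi> z))"
      using M(2)[OF f] N(2)[of "\<lambda>z. f (\<phi> z)"] by blast
    also have "\<dots> \<le> N * (M * nsq \<beta> f)" using M(2)[OF f] N(1) by (intro mult_left_mono) auto
    finally show "nsq \<beta> (\<lambda>z. f (\<phi> (\<psi> z))) \<le> N * M * nsq \<beta> f" by (simp add: mult.assoc)
  qed (use M N in auto)
qed

lemma comp_bounded_cong:
  assumes "\<And>z. z \<in> \<D> \<Longrightarrow> \<phi> z = \<psi> z"
  shows "comp_bounded \<beta> \<phi> \<longleftrightarrow> comp_bounded \<beta> \<psi>"
proof -
  have "taylor_coeff (\<lambda>z. f (\<phi> z)) = taylor_coeff (\<lambda>z. f (\<psi> z))"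
    "hardy_fun \<beta> (\<lambda>z. f (\<phi> z)) = hardy_fun \<beta> (\<lambda>z. f (\<psi> z))" for f
    by (rule taylor_coeff_cong hardy_fun_cong; use assms in simp)+
  then show ?thesis by (simp add: comp_bounded_def)
qed

section \<open>Disk automorphisms and maps without a zero in the disk\<close>

lemma disk_automorphism_form:
  assumes "p \<in> \<D>"
  shows "(cmod (1 - cnj p * w))\<^sup>2 - (cmod (p - w))\<^sup>2 = (1 - (cmod p)\<^sup>2) * (1 - (cmod w)\<^sup>2)"
  unfolding cmod_power2 by (simp add: power2_eq_square algebra_simps)

lemma disk_automorphism_less:
  assumes "p \<in> \<D>" "cmod w < 1"
  shows "cmod (p - w) < cmod (1 - cnj p * w)"
proof -
  have "(1 - (cmod p)\<^sup>2) * (1 - (cmod w)\<^sup>2) > 0"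
    using assms by (intro mult_pos_pos) (auto simp: abs_square_less_1)
  then have "(cmod (p - w))\<^sup>2 < (cmod (1 - cnj p * w))\<^sup>2"
    using disk_automorphism_form[OF assms(1), of w] by simp
  then show ?thesis by (simp add: power_less_imp_less_base)
qed

lemma lft_self_closed:
  assumes "lft_self a b c d" "z \<in> cball 0 1"
  shows "cmod ((a * z + b) / (c * z + d)) \<le> 1"
proof -
  have "cmod (c * z + d) - cmod (a * z + b) \<ge> 0"
  proof (rule continuous_ge_on_closure[of \<D> "\<lambda>z. cmod (c * z + d) - cmod (a * z + b)"])
    fix x assume "x \<in> \<D>"
    then show "0 \<le> cmod (c * x + d) - cmod (a * x + b)" using assms unfolding lft_self_def by force
  qed (use assms in \<open>auto intro!: continuous_intros\<close>)
  then show ?thesis using assms by (auto simp: lft_self_def norm_divide divide_simps)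
qed

text \<open>With \<open>p = \<phi> 0\<close>, the automorphism \<open>\<psi>\<close> exchanges 0 and
  \<open>p\<close> and is its own inverse, so \<open>\<phi>\<close> is \<open>\<psi>\<close>
  composed with \<open>\<psi> \<circ> \<phi>\<close>. The first factor vanishes at \<open>p\<close>,
  the second at 0, and the previous case covers both.\<close>

lemma hardy_comp_bounded:
  assumes \<phi>: "lft_self a b c d"
  shows "comp_bounded unit_weight (\<lambda>z. (a * z + b) / (c * z + d))"
proof -
  define \<phi> where "\<phi> z = (a * z + b) / (c * z + d)" for z
  define p where "p = \<phi> 0"
  have \<phi>_less: "cmod (\<phi> z) < 1" if "z \<in> \<D>" for z
    using lft_self_holomorphic(2)[OF \<phi>] that unfolding \<phi>_def image_subset_iff by simp
  have p: "p \<in> \<D>" using \<phi>_less[of 0] by (simp add: p_def)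
  have cd: "c * z + d \<noteq> 0" if "z \<in> cball 0 1" for z using \<phi> that unfolding lft_self_def by blast
  then have d: "d \<noteq> 0" using cd[of 0] by simp
  have pd: "p * d = b" using d by (simp add: p_def \<phi>_def)
  define \<psi> where "\<psi> z = ((-1) * z + p) / ((- cnj p) * z + 1)" for z
  have \<psi>_eq: "\<psi> u = (p - u) / (1 - cnj p * u)" for u
    by (simp add: \<psi>_def)
  have L1: "lft_self (-1) p (- cnj p) 1"
    unfolding lft_self_def linear_nonzero_iff
    using p disk_automorphism_less[OF p] by auto
  have B1: "comp_bounded unit_weight \<psi>"
    unfolding \<psi>_def using hardy_comp_bounded_zero[OF L1 p] by simp
  \<comment> \<open>Denominator and numerator of \<open>\<psi> (\<phi> z)\<close> after clearing
    \<open>c * z + d\<close>.\<close>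
  have den: "(c - cnj p * a) * z + (d - cnj p * b) = (c * z + d) * (1 - cnj p * \<phi> z)"
    and num: "(p * c - a) * z + (p * d - b) = (c * z + d) * (p - \<phi> z)" if "z \<in> cball 0 1" for z
    using cd[OF that] by (auto simp: \<phi>_def field_simps)
  have nz: "1 - cnj p * w \<noteq> 0" if "cmod w \<le> 1" for w
  proof -
    have "cmod (cnj p * w) < 1" using p that
      by (simp add: norm_mult) (meson mult_left_le norm_ge_zero order.strict_trans1)
    then show ?thesis by (metis eq_iff_diff_eq_0 norm_one order_less_irrefl)
  qed
  have L2: "lft_self (p * c - a) (p * d - b) (c - cnj p * a) (d - cnj p * b)"
    unfolding lft_self_def
  proof (intro conjI ballI)
    fix z :: complex assume z: "z \<in> cball 0 1"
    show "(c - cnj p * a) * z + (d - cnj p * b) \<noteq> 0"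
      unfolding den[OF z] using cd[OF z] nz[of "\<phi> z"] lft_self_closed[OF \<phi> z]
      by (metis \<phi>_def mult_eq_0_iff)
  next
    fix z :: complex assume z: "z \<in> \<D>"
    then have z': "z \<in> cball 0 1" by simp
    have "cmod (\<phi> z) < 1" by (rule \<phi>_less[OF z])
    from disk_automorphism_less[OF p this]
    show "cmod ((p * c - a) * z + (p * d - b)) < cmod ((c - cnj p * a) * z + (d - cnj p * b))"
      unfolding den[OF z'] num[OF z'] norm_mult using cd[OF z'] by simp
  qed
  have B2: "comp_bounded unit_weight (\<lambda>z. ((p * c - a) * z + (p * d - b)) / ((c - cnj p * a) * z + (d - cnj p * b)))"
    by (rule hardy_comp_bounded_zero[OF L2, of 0]) (simp_all add: pd)
  have "comp_bounded unit_weight \<phi>"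
  proof (rule comp_bounded_cong[THEN iffD1, OF _ comp_bounded_compose[OF B1 B2]])
    fix z assume z: "z \<in> \<D>"
    then have z': "z \<in> cball 0 1" by simp
    define w where "w = \<phi> z"
    have w: "cmod w < 1" using \<phi>_less[OF z] by (simp add: w_def)
    have n1: "1 - cnj p * w \<noteq> 0" using nz w by simp
    have n2: "1 - cnj p * p \<noteq> 0" using nz p by simp
    have "((p * c - a) * z + (p * d - b)) / ((c - cnj p * a) * z + (d - cnj p * b)) = (p - w) / (1 - cnj p * w)"
      unfolding den[OF z'] num[OF z'] using cd[OF z'] by (simp add: w_def)
    then have "\<psi> (((p * c - a) * z + (p * d - b)) / ((c - cnj p * a) * z + (d - cnj p * b))) =
       \<psi> ((p - w) / (1 - cnj p * w))" by simp
    also have "\<dots> = (p - (p - w) / (1 - cnj p * w)) / (1 - cnj p * ((p - w) / (1 - cnj p * w)))"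
      by (rule \<psi>_eq)
    also have "\<dots> = ((1 - cnj p * p) * w) / (1 - cnj p * p)"
    proof -
      have "p - (p - w) / (1 - cnj p * w) = ((1 - cnj p * p) * w) / (1 - cnj p * w)"
        using n1 by (simp add: field_simps)
      moreover have "1 - cnj p * ((p - w) / (1 - cnj p * w)) = (1 - cnj p * p) / (1 - cnj p * w)"
        using n1 by (simp add: field_simps)
      ultimately show ?thesis using n1 by simp
    qed
    finally show "\<psi> (((p * c - a) * z + (p * d - b)) / ((c - cnj p * a) * z + (d - cnj p * b))) = \<phi> z"
      using n2 by (simp add: w_def)
  qed
  then show ?thesis by (simp add: \<phi>_def[abs_def])
qed

subsection \<open>Power weights\<close>

text \<open>The shift by one keeps the weight positive at 0 and makes the derivative rule
  \<open>pw_deriv\<close> an exact equation.\<close>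

definition pw :: "real \<Rightarrow> nat \<Rightarrow> real"
  where "pw t n = (1 + real n) powr t"

lemma pw_pos [simp]: "pw t n > 0"
  by (simp add: pw_def)

lemma pw_sq: "(pw t n)\<^sup>2 = (1 + real n) powr (2 * t)"
  by (simp add: pw_def powr_power mult.commute)

lemma pw_add: "pw (s + t) n = pw s n * pw t n"
  by (simp add: pw_def powr_add)

text \<open>For nonnegative \<open>t\<close> this is submultiplicativity of \<open>1 + n\<close>;
  for negative \<open>t\<close> the weight decreases and the extra factor is at least 1.\<close>

lemma pw_Suc_le: "pw t (n + j) \<le> (1 + real j) powr \<bar>t\<bar> * pw t n"
proof (cases "t \<ge> 0")
  case True
  have "1 + real (n + j) \<le> (1 + real j) * (1 + real n)" by (simp add: algebra_simps)
  then have "pw t (n + j) \<le> ((1 + real j) * (1 + real n)) powr t"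
    unfolding pw_def using True by (intro powr_mono2) auto
  then show ?thesis using True by (simp add: pw_def powr_mult)
next
  case False
  have "pw t (n + j) \<le> pw t n"
    unfolding pw_def using False by (intro powr_mono2') auto
  also have "\<dots> \<le> (1 + real j) powr \<bar>t\<bar> * pw t n"
    using ge_one_powr_ge_zero[of "1 + real j" "\<bar>t\<bar>"] by (simp add: pw_def mult_le_cancel_right1)
  finally show ?thesis .
qed

lemma moderate_pw: "moderate (pw t)"
  unfolding moderate_def
proof (intro conjI allI exI)
  fix n j
  have "(1 + real j) powr \<bar>t\<bar> \<le> (1 + real j) powr real (nat \<lceil>\<bar>t\<bar>\<rceil>)"
    by (intro powr_mono real_nat_ceiling_ge) auto
  also have "\<dots> = (1 + real j) ^ nat \<lceil>\<bar>t\<bar>\<rceil>" by (rule powr_realpow) simp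
  finally show "pw t (n + j) \<le> 1 * (1 + real j) ^ nat \<lceil>\<bar>t\<bar>\<rceil> * pw t n"
    using pw_Suc_le[of t n j] by (smt (verit) mult_right_mono pw_pos)
qed simp

text \<open>The numbers \<open>r ^ n\<close> are the Taylor coefficients of
  \<open>1 / (1 - r * z)\<close>, which is holomorphic beyond the closed disk, so the estimate for
  coefficients against polynomial growth applies.\<close>

lemma summable_power_pw:
  assumes "0 \<le> r" "r < 1"
  shows "summable (\<lambda>n. r ^ n * pw t n)"
proof (cases "r = 0")
  case True
  then show ?thesis by (intro summable_finite[of "{0}"]) (auto simp: power_0_left)
next
  case False
  define u where "u z = 1 / (1 - complex_of_real r * z)" for z
  have "cmod (- complex_of_real r) < cmod 1" using assms by simp
  from linear_nonzero_beyond[OF this] obtain R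
    where R: "R > 1" "\<And>z. z \<in> ball 0 R \<Longrightarrow> - complex_of_real r * z + 1 \<noteq> 0"
      "\<And>z. z \<in> ball 0 R \<Longrightarrow> cmod (- complex_of_real r * z) < cmod 1" by blast
  have hu: "u holomorphic_on ball 0 R"
    unfolding u_def using R(2) by (intro holomorphic_intros) force
  have "(\<lambda>n. complex_of_real r ^ n * z ^ n) sums u z" if "z \<in> \<D>" for z
  proof -
    have "cmod (complex_of_real r * z) < 1" using R(3)[of z] R(1) that by simp
    from geometric_sums[OF this] show ?thesis by (simp add: u_def power_mult_distrib)
  qed
  from taylor_coeffI(2)[OF this]
  have s: "summable (\<lambda>n. r ^ n * (1 + real n) ^ nat \<lceil>\<bar>t\<bar>\<rceil>)"
    using summable_taylor_coeff_moderate[OF hu R(1), of "nat \<lceil>\<bar>t\<bar>\<rceil>"] assms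
    by (simp add: norm_power)
  show ?thesis
  proof (rule summable_comparison_test'[OF s])
    fix n
    have "pw t n \<le> (1 + real n) powr real (nat \<lceil>\<bar>t\<bar>\<rceil>)"
      unfolding pw_def by (rule powr_mono[OF order_trans[OF abs_ge_self real_nat_ceiling_ge]]) simp
    also have "\<dots> = (1 + real n) ^ nat \<lceil>\<bar>t\<bar>\<rceil>" by (rule powr_realpow) simp
    finally show "norm (r ^ n * pw t n) \<le> r ^ n * (1 + real n) ^ nat \<lceil>\<bar>t\<bar>\<rceil>"
      using assms by (simp add: abs_mult mult_left_mono less_imp_le)
  qed
qed

text \<open>Amounts to an equivalent norm: the same functions as for \<open>pw t\<close>, with norms
  comparable up to constants.\<close>

definition power_weight :: "real \<Rightarrow> (nat \<Rightarrow> real) \<Rightarrow> bool"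
  where "power_weight t \<beta> \<longleftrightarrow> (\<exists>c>0. \<exists>C>0. \<forall>n. c * pw t n \<le> \<beta> n \<and> \<beta> n \<le> C * pw t n)"

lemma power_weight_pw: "power_weight t (pw t)"
  unfolding power_weight_def by (intro exI[of _ "1 :: real"] conjI) simp_all

lemma power_weight_pos: "power_weight t \<beta> \<Longrightarrow> \<beta> n > 0"
  unfolding power_weight_def by (meson mult_pos_pos order.strict_trans2 pw_pos)

section \<open>The reproducing kernel\<close>

definition kernel_coeff :: "(nat \<Rightarrow> real) \<Rightarrow> complex \<Rightarrow> nat \<Rightarrow> complex"
  where "kernel_coeff \<beta> w n = cnj w ^ n / complex_of_real ((\<beta> n)\<^sup>2)"

lemma wsummable_kernel_coeff:
  assumes "power_weight t \<beta>" "w \<in> \<D>"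
  shows "wsummable \<beta> (kernel_coeff \<beta> w)"
proof -
  obtain c where c: "c > 0" "\<And>n. c * pw t n \<le> \<beta> n"
    using assms(1) unfolding power_weight_def by blast
  have "summable (\<lambda>n. ((cmod w)\<^sup>2) ^ n * pw (- 2 * t) n)"
    using assms(2) by (intro summable_power_pw) (auto simp: abs_square_less_1)
  then have s: "summable (\<lambda>n. 1 / c\<^sup>2 * (((cmod w)\<^sup>2) ^ n * pw (- 2 * t) n))"
    by (rule summable_mult)
  show ?thesis unfolding wsummable_def
  proof (rule summable_comparison_test'[OF s])
    fix n
    have b: "\<beta> n > 0" by (rule power_weight_pos[OF assms(1)])
    have "(cmod (kernel_coeff \<beta> w n))\<^sup>2 * (\<beta> n)\<^sup>2 = ((cmod w)\<^sup>2) ^ n * (1 / (\<beta> n)\<^sup>2)"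
    proof -
      have "cmod (kernel_coeff \<beta> w n) = cmod w ^ n / (\<beta> n)\<^sup>2"
        by (simp add: kernel_coeff_def norm_divide norm_power)
      moreover have "(cmod w ^ n)\<^sup>2 = ((cmod w)\<^sup>2) ^ n" by (simp add: mult.commute flip: power_mult)
      ultimately show ?thesis using b by (simp add: power_divide power2_eq_square)
    qed
    also have "\<dots> \<le> ((cmod w)\<^sup>2) ^ n * (1 / (c * pw t n)\<^sup>2)"
      using c b by (intro mult_left_mono divide_left_mono power_mono mult_pos_pos zero_less_power)
        (auto simp: less_imp_le)
    also have "1 / (c * pw t n)\<^sup>2 = 1 / c\<^sup>2 * pw (- 2 * t) n"
      by (simp add: power_mult_distrib pw_sq) (simp add: pw_def powr_minus divide_inverse)
    finally show "norm ((cmod (kernel_coeff \<beta> w n))\<^sup>2 * (\<beta> n)\<^sup>2) \<le>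
        1 / c\<^sup>2 * (((cmod w)\<^sup>2) ^ n * pw (- 2 * t) n)"
      by (simp add: mult_ac)
  qed
qed

lemma winner_kernel_coeff:
  assumes "power_weight t \<beta>" "f holomorphic_on \<D>" "w \<in> \<D>"
  shows "winner \<beta> (taylor_coeff f) (kernel_coeff \<beta> w) = f w"
proof -
  have "\<beta> n \<noteq> 0" for n using power_weight_pos[OF assms(1), of n] by simp
  then have "(\<lambda>n. taylor_coeff f n * cnj (kernel_coeff \<beta> w n) * complex_of_real ((\<beta> n)\<^sup>2)) =
      (\<lambda>n. taylor_coeff f n * w ^ n)" by (simp add: kernel_coeff_def)
  then show ?thesis
    using taylor_coeff_sums[OF assms(2,3)] unfolding winner_def by (simp add: sums_iff)
qed

text \<open>Cauchy-Schwarz against the reproducing kernel, whose squared norm is the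
  constant.\<close>

lemma point_evaluation_bounded:
  assumes "power_weight t \<beta>" "w \<in> \<D>"
  shows "\<exists>M\<ge>0. \<forall>f. hardy_fun \<beta> f \<longrightarrow> (cmod (f w))\<^sup>2 \<le> M * nsq \<beta> f"
proof (intro exI[of _ "wsq \<beta> (kernel_coeff \<beta> w)"] conjI allI impI)
  show "wsq \<beta> (kernel_coeff \<beta> w) \<ge> 0" by (rule wsq_nonneg[OF wsummable_kernel_coeff[OF assms]])
  fix f assume "hardy_fun \<beta> f"
  then show "(cmod (f w))\<^sup>2 \<le> wsq \<beta> (kernel_coeff \<beta> w) * nsq \<beta> f"
    using winner_cauchy_schwarz[OF _ wsummable_kernel_coeff[OF assms], of "taylor_coeff f"]
      winner_kernel_coeff[OF assms(1) _ assms(2), of f]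
    by (simp add: hardy_fun_def mult.commute)
qed

section \<open>Differentiation lowers the order of the weight by one\<close>

lemma pw_shift_le: "(pw t (Suc n))\<^sup>2 \<le> 4 powr \<bar>t\<bar> * (pw t n)\<^sup>2"
proof -
  have "pw (2 * t) (n + 1) \<le> 2 powr \<bar>2 * t\<bar> * pw (2 * t) n"
    using pw_Suc_le[of "2 * t" n 1] by simp
  also have "2 powr \<bar>2 * t\<bar> = (2 powr 2) powr \<bar>t\<bar>"
    by (subst powr_powr) (simp add: abs_mult)
  finally show ?thesis by (simp add: pw_sq) (simp add: pw_def)
qed

text \<open>The preceding bound for \<open>-t\<close>, with both sides inverted. The constant is the
  square of \<open>2 powr \<bar>t\<bar>\<close>, since neighbouring values of \<open>1 + n\<close>
  differ by at most a factor 2.\<close>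

lemma pw_shift_ge: "(pw t n)\<^sup>2 \<le> 4 powr \<bar>t\<bar> * (pw t (Suc n))\<^sup>2"
proof -
  have "(pw (-t) (Suc n))\<^sup>2 \<le> 4 powr \<bar>t\<bar> * (pw (-t) n)\<^sup>2"
    using pw_shift_le[of "-t" n] by simp
  moreover have "(pw (-t) m)\<^sup>2 = 1 / (pw t m)\<^sup>2" for m
    by (simp add: pw_sq powr_minus divide_inverse)
  ultimately have "1 / (pw t (Suc n))\<^sup>2 \<le> 4 powr \<bar>t\<bar> * (1 / (pw t n)\<^sup>2)" by simp
  moreover have "pw t m \<noteq> 0" for m using pw_pos[of t m] by linarith
  ultimately show ?thesis
    by (simp add: divide_simps mult.commute)
qed

lemma pw_deriv: "(real (Suc n))\<^sup>2 * (pw (t - 1) n)\<^sup>2 = (pw t n)\<^sup>2"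
proof -
  have "real (Suc n) * pw (t - 1) n = pw t n"
    by (simp add: pw_def powr_diff)
  then show ?thesis by (metis power_mult_distrib)
qed

text \<open>The factor \<open>Suc n\<close> produced by differentiation is exactly the quotient of
  the two weights, so only the index shift costs a constant.\<close>

lemma hardy_fun_deriv:
  assumes "hardy_fun (pw t) f"
  shows "hardy_fun (pw (t - 1)) (deriv f)"
    and "nsq (pw (t - 1)) (deriv f) \<le> 4 powr \<bar>t\<bar> * nsq (pw t) f"
proof -
  have hf: "f holomorphic_on \<D>" and sf: "wsummable (pw t) (taylor_coeff f)"
    using assms by (auto simp: hardy_fun_def)
  have s1: "(\<lambda>n. (cmod (taylor_coeff f n))\<^sup>2 * (pw t n)\<^sup>2) sums nsq (pw t) f" by (rule wsq_sums[OF sf])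
  have s2: "summable (\<lambda>n. (cmod (taylor_coeff f (Suc n)))\<^sup>2 * (pw t (Suc n))\<^sup>2)"
    using s1 by (subst summable_Suc_iff) (rule sums_summable)
  have s3: "(\<Sum>n. (cmod (taylor_coeff f (Suc n)))\<^sup>2 * (pw t (Suc n))\<^sup>2) \<le> nsq (pw t) f"
    using suminf_split_head[OF sums_summable[OF s1]] sums_unique[OF s1] by simp
  have le: "(cmod (taylor_coeff (deriv f) n))\<^sup>2 * (pw (t - 1) n)\<^sup>2 \<le>
     4 powr \<bar>t\<bar> * ((cmod (taylor_coeff f (Suc n)))\<^sup>2 * (pw t (Suc n))\<^sup>2)" for n
  proof -
    have "(cmod (taylor_coeff (deriv f) n))\<^sup>2 * (pw (t - 1) n)\<^sup>2 =
        (cmod (taylor_coeff f (Suc n)))\<^sup>2 * ((real (Suc n))\<^sup>2 * (pw (t - 1) n)\<^sup>2)"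
      unfolding taylor_coeff_deriv[OF hf] norm_mult norm_of_nat by (simp only: power_mult_distrib mult_ac)
    also have "\<dots> \<le> (cmod (taylor_coeff f (Suc n)))\<^sup>2 * (4 powr \<bar>t\<bar> * (pw t (Suc n))\<^sup>2)"
      unfolding pw_deriv by (intro mult_left_mono pw_shift_ge) auto
    finally show ?thesis by (simp add: mult_ac)
  qed
  have *: "wsummable (pw (t - 1)) (taylor_coeff (deriv f))"
    unfolding wsummable_def
    by (rule summable_comparison_test'[OF summable_mult[OF s2, of "4 powr \<bar>t\<bar>"]]) (use le in auto)
  then show "hardy_fun (pw (t - 1)) (deriv f)"
    using hf by (auto simp: hardy_fun_def intro: holomorphic_deriv)
  have "nsq (pw (t - 1)) (deriv f) \<le>
     4 powr \<bar>t\<bar> * (\<Sum>n. (cmod (taylor_coeff f (Suc n)))\<^sup>2 * (pw t (Suc n))\<^sup>2)"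
    by (rule sums_le[OF le wsq_sums[OF *] sums_mult[OF summable_sums[OF s2]]])
  also have "\<dots> \<le> 4 powr \<bar>t\<bar> * nsq (pw t) f" using s3 by (intro mult_left_mono) auto
  finally show "nsq (pw (t - 1)) (deriv f) \<le> 4 powr \<bar>t\<bar> * nsq (pw t) f" .
qed

text \<open>The derivative forgets only the constant coefficient, which returns as the term with
  \<open>f 0\<close>.\<close>

lemma hardy_fun_of_deriv:
  assumes "f holomorphic_on \<D>" "hardy_fun (pw (t - 1)) (deriv f)"
  shows "hardy_fun (pw t) f"
    and "nsq (pw t) f \<le> (cmod (f 0))\<^sup>2 + 4 powr \<bar>t\<bar> * nsq (pw (t - 1)) (deriv f)"
proof -
  have sf: "wsummable (pw (t - 1)) (taylor_coeff (deriv f))"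
    using assms by (auto simp: hardy_fun_def)
  note s = sums_mult[OF wsq_sums[OF sf], of "4 powr \<bar>t\<bar>"]
  have le: "(cmod (taylor_coeff f (Suc n)))\<^sup>2 * (pw t (Suc n))\<^sup>2 \<le>
     4 powr \<bar>t\<bar> * ((cmod (taylor_coeff (deriv f) n))\<^sup>2 * (pw (t - 1) n)\<^sup>2)" for n
  proof -
    have "(cmod (taylor_coeff f (Suc n)))\<^sup>2 * (pw t (Suc n))\<^sup>2 \<le>
       (cmod (taylor_coeff f (Suc n)))\<^sup>2 * (4 powr \<bar>t\<bar> * (pw t n)\<^sup>2)"
      by (intro mult_left_mono pw_shift_le) auto
    also have "\<dots> = 4 powr \<bar>t\<bar> * ((cmod (taylor_coeff (deriv f) n))\<^sup>2 * (pw (t - 1) n)\<^sup>2)"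
      unfolding taylor_coeff_deriv[OF assms(1)] norm_mult norm_of_nat pw_deriv[of n t, symmetric]
      by (simp only: power_mult_distrib mult_ac)
    finally show ?thesis .
  qed
  have sm: "summable (\<lambda>n. (cmod (taylor_coeff f (Suc n)))\<^sup>2 * (pw t (Suc n))\<^sup>2)"
    by (rule summable_comparison_test'[OF sums_summable[OF s]]) (use le in auto)
  then have *: "wsummable (pw t) (taylor_coeff f)"
    unfolding wsummable_def using summable_Suc_iff by blast
  then show "hardy_fun (pw t) f" using assms by (auto simp: hardy_fun_def)
  have "(\<Sum>n. (cmod (taylor_coeff f (Suc n)))\<^sup>2 * (pw t (Suc n))\<^sup>2) \<le>
      4 powr \<bar>t\<bar> * nsq (pw (t - 1)) (deriv f)"
    by (rule sums_le[OF le summable_sums[OF sm] s])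
  then show "nsq (pw t) f \<le> (cmod (f 0))\<^sup>2 + 4 powr \<bar>t\<bar> * nsq (pw (t - 1)) (deriv f)"
    using suminf_split_head[OF *[unfolded wsummable_def]]
    by (simp add: wsq_def pw_def taylor_coeff_0)
qed

subsection \<open>Changing the order of the weight by one\<close>

lemma lft_deriv:
  assumes "lft_self a b c d" "z \<in> \<D>"
  shows "((\<lambda>z. (a * z + b) / (c * z + d)) has_field_derivative (a * d - b * c) / (c * z + d)\<^sup>2) (at z)"
proof -
  have "c * z + d \<noteq> 0" using assms unfolding lft_self_def by auto
  then show ?thesis
    by (auto intro!: derivative_eq_intros simp: field_simps power2_eq_square)
qed

lemma deriv_comp_lft:
  assumes \<phi>: "lft_self a b c d" and f: "f holomorphic_on \<D>" and z: "z \<in> \<D>"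
  shows "deriv (\<lambda>z. f ((a * z + b) / (c * z + d))) z =
    (a * d - b * c) / (c * z + d)\<^sup>2 * deriv f ((a * z + b) / (c * z + d))"
proof -
  have "(a * z + b) / (c * z + d) \<in> \<D>" using lft_self_holomorphic(2)[OF \<phi>] z by blast
  then have "(f has_field_derivative deriv f ((a * z + b) / (c * z + d))) (at ((a * z + b) / (c * z + d)))"
    using f by (intro holomorphic_derivI) auto
  from DERIV_chain2[OF this lft_deriv[OF \<phi> z]] show ?thesis
    by (simp add: DERIV_imp_deriv mult.commute)
qed

text \<open>By the chain rule the derivative of the composite is \<open>\<phi>'\<close>, a bounded
  multiplier, times the composite of \<open>deriv f\<close>, to which the hypothesis applies. The
  value at 0 lost by differentiating is \<open>f (\<phi> 0)\<close>, controlled by point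
  evaluation.\<close>

lemma comp_bounded_raise:
  assumes \<phi>: "lft_self a b c d" and B: "comp_bounded (pw (t - 1)) (\<lambda>z. (a * z + b) / (c * z + d))"
  shows "comp_bounded (pw t) (\<lambda>z. (a * z + b) / (c * z + d))"
proof -
  define \<phi> where "\<phi> z = (a * z + b) / (c * z + d)" for z
  obtain M where M: "M \<ge> 0" "\<And>f. hardy_fun (pw (t - 1)) f \<Longrightarrow>
      hardy_fun (pw (t - 1)) (\<lambda>z. f (\<phi> z)) \<and> nsq (pw (t - 1)) (\<lambda>z. f (\<phi> z)) \<le> M * nsq (pw (t - 1)) f"
    using B unfolding comp_bounded_def \<phi>_def by blast
  have cd: "cmod c < cmod d" using \<phi> linear_nonzero_iff unfolding lft_self_def by blast
  obtain R where R: "R > 1" "\<And>z. z \<in> ball 0 R \<Longrightarrow> c * z + d \<noteq> 0"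
    using linear_nonzero_beyond[OF cd] by blast
  have "(\<lambda>z. (a * d - b * c) / (c * z + d)\<^sup>2) holomorphic_on ball 0 R"
    using R(2) by (intro holomorphic_intros) auto
  from mult_bounded[OF this R(1) moderate_pw] obtain N where N: "N \<ge> 0"
    "\<And>f. hardy_fun (pw (t - 1)) f \<Longrightarrow>
       hardy_fun (pw (t - 1)) (\<lambda>z. (a * d - b * c) / (c * z + d)\<^sup>2 * f z) \<and>
       nsq (pw (t - 1)) (\<lambda>z. (a * d - b * c) / (c * z + d)\<^sup>2 * f z) \<le> N * nsq (pw (t - 1)) f"
    by blast
  have \<phi>D: "\<phi> z \<in> \<D>" if "z \<in> \<D>" for z
    unfolding \<phi>_def using lft_self_holomorphic(2)[OF \<phi>] that by blast
  from point_evaluation_bounded[OF power_weight_pw, of "\<phi> 0" t] obtain E where E: "E \<ge> 0"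
    "\<And>f. hardy_fun (pw t) f \<Longrightarrow> (cmod (f (\<phi> 0)))\<^sup>2 \<le> E * nsq (pw t) f"
    using \<phi>D[of 0] by auto
  define C where "C = 4 powr \<bar>t\<bar>"
  have C: "C \<ge> 0" by (simp add: C_def)
  have "comp_bounded (pw t) \<phi>"
    unfolding comp_bounded_def
  \<comment> \<open>From the inside: differentiate (\<open>C\<close>), compose (\<open>M\<close>),
    multiply by \<open>\<phi>'\<close> (\<open>N\<close>), integrate (\<open>C\<close>);
    \<open>E\<close> pays for the value at 0.\<close>
  proof (intro exI[of _ "E + C * (N * (M * C))"] conjI allI impI)
    show "E + C * (N * (M * C)) \<ge> 0" using E M N C by simp
    fix f assume f: "hardy_fun (pw t) f"
    then have hf: "f holomorphic_on \<D>" by (simp add: hardy_fun_def)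
    note D = hardy_fun_deriv[OF f]
    define F where "F z = f (\<phi> z)" for z
    have hF: "F holomorphic_on \<D>"
      using holomorphic_on_compose_gen[OF lft_self_holomorphic(1)[OF \<phi>] hf lft_self_holomorphic(2)[OF \<phi>]]
      by (simp add: F_def[abs_def] \<phi>_def o_def)
    have dF: "(a * d - b * c) / (c * z + d)\<^sup>2 * deriv f (\<phi> z) = deriv F z" if "z \<in> \<D>" for z
      using deriv_comp_lft[OF \<phi> hf that] by (simp add: F_def[abs_def] \<phi>_def)
    note 1 = M(2)[OF D(1)]
    note 2 = N(2)[OF 1[THEN conjunct1]]
    have hd: "hardy_fun (pw (t - 1)) (deriv F)"
      using 2 hardy_fun_cong[of _ "deriv F", OF dF] by simp
    have "nsq (pw (t - 1)) (deriv F) \<le> N * nsq (pw (t - 1)) (\<lambda>z. deriv f (\<phi> z))"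
      using 2 taylor_coeff_cong[of _ "deriv F", OF dF] by simp
    also have "\<dots> \<le> N * (M * (C * nsq (pw t) f))"
      using 1 D(2) N(1) M(1) unfolding C_def by (intro mult_left_mono) (auto intro: order_trans mult_left_mono)
    finally have le: "nsq (pw (t - 1)) (deriv F) \<le> N * (M * (C * nsq (pw t) f))" .
    note 3 = hardy_fun_of_deriv[OF hF hd]
    show "hardy_fun (pw t) (\<lambda>z. f (\<phi> z))" using 3(1) by (simp add: F_def[abs_def])
    have "nsq (pw t) F \<le> (cmod (F 0))\<^sup>2 + C * nsq (pw (t - 1)) (deriv F)"
      using 3(2) by (simp add: C_def)
    also have "\<dots> \<le> E * nsq (pw t) f + C * (N * (M * (C * nsq (pw t) f)))"
      using E(2)[OF f] le C unfolding F_def by (intro add_mono mult_left_mono) auto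
    finally show "nsq (pw t) (\<lambda>z. f (\<phi> z)) \<le> (E + C * (N * (M * C))) * nsq (pw t) f"
      by (simp add: F_def[abs_def] algebra_simps)
  qed
  then show ?thesis by (simp add: \<phi>_def[abs_def])
qed

text \<open>The chain rule run backwards: compose a primitive of \<open>f\<close>, differentiate,
  and divide by \<open>\<phi>'\<close>. The reciprocal of \<open>\<phi>'\<close> is the polynomial
  \<open>(c * z + d)\<^sup>2 / (a * d - b * c)\<close>, hence a bounded multiplier; this is where
  the determinant enters.\<close>

lemma comp_bounded_lower:
  assumes \<phi>: "lft_self a b c d" "a * d - b * c \<noteq> 0"
    and B: "comp_bounded (pw t) (\<lambda>z. (a * z + b) / (c * z + d))"
  shows "comp_bounded (pw (t - 1)) (\<lambda>z. (a * z + b) / (c * z + d))"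
proof -
  define \<phi> where "\<phi> z = (a * z + b) / (c * z + d)" for z
  obtain M where M: "M \<ge> 0" "\<And>f. hardy_fun (pw t) f \<Longrightarrow>
      hardy_fun (pw t) (\<lambda>z. f (\<phi> z)) \<and> nsq (pw t) (\<lambda>z. f (\<phi> z)) \<le> M * nsq (pw t) f"
    using B unfolding comp_bounded_def \<phi>_def by blast
  have cd: "c * z + d \<noteq> 0" if "z \<in> \<D>" for z using \<phi>(1) that unfolding lft_self_def by auto
  have two_gt_one: "(1 :: real) < 2" by simp
  have "(\<lambda>z. (c * z + d)\<^sup>2 / (a * d - b * c)) holomorphic_on ball 0 2"
    by (intro holomorphic_intros) (use \<phi>(2) in auto)
  from mult_bounded[OF this two_gt_one moderate_pw] obtain N where N: "N \<ge> 0"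
    "\<And>f. hardy_fun (pw (t - 1)) f \<Longrightarrow>
       hardy_fun (pw (t - 1)) (\<lambda>z. (c * z + d)\<^sup>2 / (a * d - b * c) * f z) \<and>
       nsq (pw (t - 1)) (\<lambda>z. (c * z + d)\<^sup>2 / (a * d - b * c) * f z) \<le> N * nsq (pw (t - 1)) f"
    by blast
  define C where "C = 4 powr \<bar>t\<bar>"
  have C: "C \<ge> 0" by (simp add: C_def)
  have "comp_bounded (pw (t - 1)) \<phi>"
    unfolding comp_bounded_def
  proof (intro exI[of _ "N * (C * (M * C))"] conjI allI impI)
    show "N * (C * (M * C)) \<ge> 0" using M N C by simp
    fix f assume f: "hardy_fun (pw (t - 1)) f"
    then have hf: "f holomorphic_on \<D>" by (simp add: hardy_fun_def)
    obtain F0 where F0: "\<And>z. z \<in> \<D> \<Longrightarrow> (F0 has_field_derivative f z) (at z within \<D>)"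
      using holomorphic_convex_primitive'[of \<D> f] hf by auto
    \<comment> \<open>The primitive vanishing at 0, so that its norm is controlled by the derivative
      alone.\<close>
    define F where "F z = F0 z - F0 0" for z
    have F': "(F has_field_derivative f z) (at z)" if "z \<in> \<D>" for z
      using F0[OF that] that at_within_open[OF that open_ball] unfolding F_def
      by (auto intro!: derivative_eq_intros)
    have hF: "F holomorphic_on \<D>" using F' holomorphic_on_open by blast
    have dF: "deriv F z = f z" if "z \<in> \<D>" for z using F'[OF that] by (rule DERIV_imp_deriv)
    have hd: "hardy_fun (pw (t - 1)) (deriv F)"
      using f hardy_fun_cong[of "deriv F" f, OF dF] by simp
    have nd: "nsq (pw (t - 1)) (deriv F) = nsq (pw (t - 1)) f"
      using taylor_coeff_cong[of "deriv F" f, OF dF] by simp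
    have F: "hardy_fun (pw t) F" "nsq (pw t) F \<le> C * nsq (pw (t - 1)) f"
      using hardy_fun_of_deriv[OF hF hd] nd by (auto simp: C_def F_def)
    define G where "G z = F (\<phi> z)" for z
    have G: "hardy_fun (pw t) G" "nsq (pw t) G \<le> M * nsq (pw t) F"
      using M(2)[OF F(1)] by (simp_all add: G_def[abs_def])
    note D = hardy_fun_deriv[OF G(1)]
    have eq: "(c * z + d)\<^sup>2 / (a * d - b * c) * deriv G z = f (\<phi> z)" if "z \<in> \<D>" for z
    proof -
      have "\<phi> z \<in> \<D>" unfolding \<phi>_def using lft_self_holomorphic(2)[OF \<phi>(1)] that by blast
      then show ?thesis
        using deriv_comp_lft[OF \<phi>(1) hF that] cd[OF that] \<phi>(2) dF[of "\<phi> z"]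
        by (simp add: G_def[abs_def] \<phi>_def)
    qed
    note 1 = N(2)[OF D(1)]
    show "hardy_fun (pw (t - 1)) (\<lambda>z. f (\<phi> z))"
      using 1 hardy_fun_cong[of _ "\<lambda>z. f (\<phi> z)", OF eq] by simp
    have "nsq (pw (t - 1)) (\<lambda>z. f (\<phi> z)) \<le> N * nsq (pw (t - 1)) (deriv G)"
      using 1 taylor_coeff_cong[of _ "\<lambda>z. f (\<phi> z)", OF eq] by simp
    also have "nsq (pw (t - 1)) (deriv G) \<le> C * nsq (pw t) G" using D(2) by (simp add: C_def)
    also have "nsq (pw t) G \<le> M * nsq (pw t) F" by (rule G)
    also have "nsq (pw t) F \<le> C * nsq (pw (t - 1)) f" by (rule F)
    finally show "nsq (pw (t - 1)) (\<lambda>z. f (\<phi> z)) \<le> N * (C * (M * C)) * nsq (pw (t - 1)) f"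
      using N(1) M(1) C by (simp add: mult_left_mono mult.assoc)
  qed
  then show ?thesis by (simp add: \<phi>_def[abs_def])
qed

lemma comp_bounded_int:
  assumes \<phi>: "lft_self a b c d" "a * d - b * c \<noteq> 0"
  shows "comp_bounded (pw (of_int k)) (\<lambda>z. (a * z + b) / (c * z + d))"
proof (induction k rule: int_induct[where k = 0])
  case base
  have "pw (of_int 0) = unit_weight" by (auto simp: pw_def)
  then show ?case using hardy_comp_bounded[OF \<phi>(1)] by metis
next
  case (step1 i)
  then show ?case using comp_bounded_raise[OF \<phi>(1), of "of_int (i + 1)"] by simp
next
  case (step2 i)
  then show ?case using comp_bounded_lower[OF \<phi>, of "of_int i"] by simp
qed

subsection \<open>Interpolation between weights\<close>

text \<open>The summand grows like \<open>q ^ k\<close> while \<open>2 ^ k\<close> is below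
  \<open>1 + n\<close>, then decays with ratio \<open>q / 4 < 1\<close>. Both geometric pieces are
  comparable to their value at the crossover, which is about
  \<open>(1 + n) powr (2 * \<theta>)\<close>.\<close>

lemma dyadic_sum_upper:
  fixes q :: real
  assumes q: "1 < q" "q < 4" "q = 4 powr \<theta>" "\<theta> > 0"
  shows "\<exists>C\<ge>0. \<forall>n J. (\<Sum>k<J. q ^ k * min 1 ((1 + real n)\<^sup>2 / 4 ^ k)) \<le> C * pw (2 * \<theta>) n"
\<comment> \<open>The first fraction sums the growing part up to \<open>m\<close>, the second the
  tail. Its numerator 4 arises from \<open>x\<^sup>2 \<le> 4 * 4 ^ m\<close>, which leaves a factor
  \<open>q\<close>, bounded by 4.\<close>
proof (intro exI[of _ "q / (q - 1) + 4 / (1 - q / 4)"] conjI allI)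
  show "q / (q - 1) + 4 / (1 - q / 4) \<ge> 0" using q(1,2) by simp
  fix n J :: nat
  define x where "x = 1 + real n"
  obtain m where m: "2 ^ m \<le> Suc n" "Suc n < 2 ^ (m + 1)"
    using ex_power_ivl1[of 2 "Suc n"] by auto
  have xm: "2 ^ m \<le> x" "x \<le> 2 * 2 ^ m"
    using of_nat_mono[OF m(1), where 'a=real] of_nat_mono[OF less_imp_le[OF m(2)], where 'a=real]
    by (simp_all add: x_def)
  have qm: "q ^ m \<le> pw (2 * \<theta>) n"
  proof -
    have "q ^ m = (4 ^ m) powr \<theta>"
      unfolding q(3) by (simp add: powr_powr powr_realpow[symmetric] mult.commute)
    also have "(4 :: real) ^ m = (2 ^ m) powr 2" 
      by (simp add: powr_numeral power2_eq_square flip: power_mult_distrib)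
    also have "((2 ^ m) powr 2) powr \<theta> = (2 ^ m) powr (2 * \<theta>)" by (rule powr_powr)
    also have "\<dots> \<le> x powr (2 * \<theta>)" using xm(1) q(4) by (intro powr_mono2) auto
    finally show ?thesis by (simp add: pw_def x_def)
  qed
  define t where "t k = q ^ k * min 1 (x\<^sup>2 / 4 ^ k)" for k
  have t_nn: "t k \<ge> 0" for k using q by (simp add: t_def)
  have split: "(\<Sum>k<m + 1 + L. t k) = (\<Sum>k<m + 1. t k) + (\<Sum>j<L. t (m + 1 + j))" for L
    by (induction L) auto
  have "(\<Sum>k<J. t k) \<le> (\<Sum>k<m + 1 + J. t k)"
    by (rule sum_mono2) (auto simp: t_nn)
  also have "\<dots> = (\<Sum>k<m + 1. t k) + (\<Sum>j<J. t (m + 1 + j))" by (rule split)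
  also have "(\<Sum>k<m + 1. t k) \<le> q / (q - 1) * q ^ m"
  proof -
    have "(\<Sum>k<m + 1. t k) \<le> (\<Sum>k<m + 1. q ^ k)"
      using q by (intro sum_mono) (simp add: t_def mult_left_le)
    also have "\<dots> = (q ^ (m + 1) - 1) / (q - 1)" using q by (intro geometric_sum) simp
    also have "\<dots> \<le> q / (q - 1) * q ^ m" using q by (simp add: divide_simps)
    finally show ?thesis .
  qed
  also have "(\<Sum>j<J. t (m + 1 + j)) \<le> 4 / (1 - q / 4) * q ^ m"
  proof -
    have x2: "x\<^sup>2 \<le> 4 * 4 ^ m"
    proof -
      have "x\<^sup>2 \<le> (2 * 2 ^ m)\<^sup>2" using xm by (intro power_mono) (auto simp: x_def)
      also have "\<dots> = 4 * (2\<^sup>2) ^ m" by (simp only: power_mult_distrib power_mult[symmetric] mult.commute)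
         (simp add: power2_eq_square)
      finally show ?thesis by simp
    qed
    have "t (m + 1 + j) \<le> 4 * q ^ m * (q / 4) ^ j" for j
    proof -
      have "t (m + 1 + j) \<le> q ^ (m + 1 + j) * (x\<^sup>2 / 4 ^ (m + 1 + j))"
        unfolding t_def using q by (intro mult_left_mono) auto
      also have "\<dots> \<le> q ^ (m + 1 + j) * (4 * 4 ^ m / 4 ^ (m + 1 + j))"
        using q x2 by (intro mult_left_mono divide_right_mono) auto
      also have "\<dots> = q * q ^ m * (q / 4) ^ j"
        by (simp add: power_add power_divide field_simps)
      also have "\<dots> \<le> 4 * q ^ m * (q / 4) ^ j" using q by (intro mult_right_mono) auto
      finally show ?thesis .
    qed
    then have "(\<Sum>j<J. t (m + 1 + j)) \<le> (\<Sum>j<J. 4 * q ^ m * (q / 4) ^ j)" by (rule sum_mono)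
    also have "\<dots> = 4 * q ^ m * (\<Sum>j<J. (q / 4) ^ j)" by (simp add: sum_distrib_left)
    also have "\<dots> \<le> 4 * q ^ m * (\<Sum>j. (q / 4) ^ j)"
      using q by (intro mult_left_mono sum_le_suminf summable_geometric) auto
    also have "(\<Sum>j. (q / 4) ^ j) = 1 / (1 - q / 4)" using q by (intro suminf_geometric) auto
    finally show ?thesis by simp
  qed
  also have "q / (q - 1) * q ^ m + 4 / (1 - q / 4) * q ^ m = (q / (q - 1) + 4 / (1 - q / 4)) * q ^ m"
    by (simp add: distrib_right)
  also have "\<dots> \<le> (q / (q - 1) + 4 / (1 - q / 4)) * pw (2 * \<theta>) n"
    using q(1,2) by (intro mult_left_mono qm) auto
  finally show "(\<Sum>k<J. q ^ k * min 1 ((1 + real n)\<^sup>2 / 4 ^ k)) \<le>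
      (q / (q - 1) + 4 / (1 - q / 4)) * pw (2 * \<theta>) n"
    by (simp add: t_def x_def)
qed

text \<open>The single term at the crossover \<open>k = m\<close> is large enough, and the factor 4,
  at least \<open>q\<close>, pays for rounding \<open>1 + n\<close> down to a power of 2. Since
  \<open>m < 2 ^ m\<close>, this term is present in every sum with \<open>n < J\<close>.\<close>

lemma dyadic_sum_lower:
  fixes q :: real
  assumes q: "1 < q" "q < 4" "q = 4 powr \<theta>" "\<theta> > 0" and n: "n < J"
  shows "pw (2 * \<theta>) n \<le> 4 * (\<Sum>k<J. q ^ k * min 1 ((1 + real n)\<^sup>2 / 4 ^ k))"
proof -
  define x where "x = 1 + real n"
  obtain m where m: "2 ^ m \<le> Suc n" "Suc n < 2 ^ (m + 1)"
    using ex_power_ivl1[of 2 "Suc n"] by auto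
  have xm: "2 ^ m \<le> x" "x \<le> 2 * 2 ^ m"
    using of_nat_mono[OF m(1), where 'a=real] of_nat_mono[OF less_imp_le[OF m(2)], where 'a=real]
    by (simp_all add: x_def)
  have "m < 2 ^ m" by simp
  then have mJ: "m < J" using m(1) n by linarith
  have "(2 ^ m)\<^sup>2 \<le> x\<^sup>2" using xm(1) by (intro power_mono) auto
  moreover have "((2 :: real) ^ m)\<^sup>2 = 4 ^ m" by (simp add: power2_eq_square flip: power_mult_distrib)
  ultimately have one: "min 1 (x\<^sup>2 / 4 ^ m) = 1" by (simp add: divide_simps)
  have "x powr (2 * \<theta>) \<le> (2 * 2 ^ m) powr (2 * \<theta>)"
    using xm q(4) by (intro powr_mono2) (auto simp: x_def)
  also have "\<dots> = ((2 * 2 ^ m) powr 2) powr \<theta>" by (rule powr_powr[symmetric])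
  also have "(2 * 2 ^ m) powr 2 = (4 :: real) * 4 ^ m"
    by (simp add: powr_numeral power2_eq_square flip: power_mult_distrib)
  also have "(4 * 4 ^ m) powr \<theta> = q * q ^ m"
    unfolding q(3) powr_mult by (simp add: powr_powr powr_realpow[symmetric] mult.commute)
  also have "\<dots> \<le> 4 * q ^ m" using q by (intro mult_right_mono) auto
  also have "q ^ m = q ^ m * min 1 (x\<^sup>2 / 4 ^ m)" using one by simp
  also have "\<dots> \<le> (\<Sum>k<J. q ^ k * min 1 (x\<^sup>2 / 4 ^ k))"
    using mJ q by (intro member_le_sum) auto
  finally show ?thesis by (simp add: pw_def x_def)
qed

text \<open>A sharp cut-off of the coefficients at \<open>2\<^sup>k\<close> realises the K-functional of the pair of
  weights, up to a constant.\<close>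
lemma comp_bounded_interpolate:
  assumes \<phi>: "\<phi> holomorphic_on \<D>" "\<phi> ` \<D> \<subseteq> \<D>"
    and B: "comp_bounded (pw s) \<phi>" "comp_bounded (pw (s + 1)) \<phi>" and \<theta>: "0 < \<theta>" "\<theta> < 1"
  shows "comp_bounded (pw (s + \<theta>)) \<phi>"
proof -
  obtain M0 where M0: "M0 \<ge> 0" "\<And>f. hardy_fun (pw s) f \<Longrightarrow>
      hardy_fun (pw s) (\<lambda>z. f (\<phi> z)) \<and> nsq (pw s) (\<lambda>z. f (\<phi> z)) \<le> M0 * nsq (pw s) f"
    using B(1) unfolding comp_bounded_def by blast
  obtain M1 where M1: "M1 \<ge> 0" "\<And>f. hardy_fun (pw (s + 1)) f \<Longrightarrow>
      hardy_fun (pw (s + 1)) (\<lambda>z. f (\<phi> z)) \<and> nsq (pw (s + 1)) (\<lambda>z. f (\<phi> z)) \<le> M1 * nsq (pw (s + 1)) f"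
    using B(2) unfolding comp_bounded_def by blast
  define M where "M = max M0 M1"
  define q :: real where "q = 4 powr \<theta>"
  have q: "1 < q" "q < 4" "q = 4 powr \<theta>" "\<theta> > 0"
    using \<theta> powr_less_mono[of 0 \<theta> "4 :: real"] powr_less_mono[of \<theta> 1 "4 :: real"] by (auto simp: q_def)
  obtain C where C: "C \<ge> 0"
      "\<And>n J. (\<Sum>k<J. q ^ k * min 1 ((1 + real n)\<^sup>2 / 4 ^ k)) \<le> C * pw (2 * \<theta>) n"
    using dyadic_sum_upper[OF q] by blast
  \<comment> \<open>\<open>(pw s n)\<^sup>2 * mm k n\<close> is the smaller of
    \<open>(pw s n)\<^sup>2\<close> and \<open>(pw (s + 1) n)\<^sup>2 / 4 ^ k\<close>; the two agree
    at \<open>1 + n = 2 ^ k\<close>.\<close>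
  define mm where "mm k n = min 1 ((1 + real n)\<^sup>2 / 4 ^ k)" for k n :: nat
  have mm_nn: "mm k n \<ge> 0" for k n by (simp add: mm_def)
  have pw1: "(pw (s + 1) n)\<^sup>2 = (pw s n)\<^sup>2 * (1 + real n)\<^sup>2" for n
    by (simp add: pw_add power_mult_distrib) (simp add: pw_def)
  have pwt: "(pw (s + \<theta>) n)\<^sup>2 = (pw s n)\<^sup>2 * pw (2 * \<theta>) n" for n
    by (simp add: pw_add power_mult_distrib pw_sq) (simp add: pw_def)
  have "comp_bounded (pw (s + \<theta>)) \<phi>"
    unfolding comp_bounded_def
  \<comment> \<open>The 8 is 2 from splitting the composite into a low and a high part, times 4 from
    \<open>dyadic_sum_lower\<close>.\<close>
  proof (intro exI[of _ "8 * M * C"] conjI allI impI)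
    show "8 * M * C \<ge> 0" using M0 M1 C by (simp add: M_def)
    fix f assume f: "hardy_fun (pw (s + \<theta>)) f"
    then have hf: "f holomorphic_on \<D>" and sf: "wsummable (pw (s + \<theta>)) (taylor_coeff f)"
      by (auto simp: hardy_fun_def)
    define a where "a = taylor_coeff f"
    define b where "b = taylor_coeff (\<lambda>z. f (\<phi> z))"
    have hc: "(\<lambda>z. g (\<phi> z)) holomorphic_on \<D>" if "g holomorphic_on \<D>" for g
      using holomorphic_on_compose_gen[OF \<phi>(1) that \<phi>(2)] by (simp add: o_def)
    define S where "S k = (\<Sum>n. (cmod (a n))\<^sup>2 * ((pw s n)\<^sup>2 * mm k n))" for k
    have step: "(\<lambda>n. (cmod (a n))\<^sup>2 * ((pw s n)\<^sup>2 * mm k n)) sums S k \<and>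
        (\<Sum>m<K. (cmod (b m))\<^sup>2 * ((pw s m)\<^sup>2 * mm k m)) \<le> 2 * M * S k" for k K
    proof -
      define N :: nat where "N = 2 ^ k"
      define lo where "lo = poly (taylor_poly f N)"
      define hi where "hi z = f z - lo z" for z
      have hlo: "hardy_fun \<beta> lo" for \<beta> unfolding lo_def by (rule hardy_fun_poly)
      have lo_hol: "lo holomorphic_on \<D>" using hlo by (simp add: hardy_fun_def)
      have tlo: "taylor_coeff lo n = (if n < N then a n else 0)" for n
        by (simp add: lo_def taylor_coeff_poly coeff_taylor_poly a_def)
      have thi: "taylor_coeff hi n = (if n < N then 0 else a n)" for n
        unfolding hi_def taylor_coeff_diff[OF hf lo_hol] tlo by (simp add: a_def)
      have hi_hol: "hi holomorphic_on \<D>" unfolding hi_def by (intro holomorphic_intros hf lo_hol)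
      \<comment> \<open>The low part is a polynomial and belongs to every space. The high part needs
        only the smaller weight, and positivity of \<theta> makes \<open>pw s\<close> at most
        \<open>pw (s + \<theta>)\<close>.\<close>
      have "wsummable (pw s) (taylor_coeff hi)"
      proof (rule wsq_dominated(1)[OF sf])
        fix n
        have "pw (2 * \<theta>) n \<ge> 1" unfolding pw_def using \<theta> by (intro ge_one_powr_ge_zero) auto
        then show "(cmod (taylor_coeff hi n))\<^sup>2 * (pw s n)\<^sup>2 \<le>
            1 * ((cmod (taylor_coeff f n))\<^sup>2 * (pw (s + \<theta>) n)\<^sup>2)"
          unfolding thi pwt a_def by (simp add: mult_left_mono mult_le_cancel_left1)
      qed
      then have hhi: "hardy_fun (pw s) hi" using hi_hol by (simp add: hardy_fun_def)
      note L = M1(2)[OF hlo] and H = M0(2)[OF hhi]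
      have sl: "(\<lambda>n. (cmod (taylor_coeff lo n))\<^sup>2 * (pw (s + 1) n)\<^sup>2) sums nsq (pw (s + 1)) lo"
        using hlo by (intro wsq_sums) (simp add: hardy_fun_def)
      have sh: "(\<lambda>n. (cmod (taylor_coeff hi n))\<^sup>2 * (pw s n)\<^sup>2) sums nsq (pw s) hi"
        using hhi by (intro wsq_sums) (simp add: hardy_fun_def)
      have eq: "1 / 4 ^ k * ((cmod (taylor_coeff lo n))\<^sup>2 * (pw (s + 1) n)\<^sup>2) +
          (cmod (taylor_coeff hi n))\<^sup>2 * (pw s n)\<^sup>2 = (cmod (a n))\<^sup>2 * ((pw s n)\<^sup>2 * mm k n)" for n
      proof (cases "n < N")
        case True
        then have "1 + real n \<le> 2 ^ k"
          using of_nat_mono[of "Suc n" N, where 'a = real] by (simp add: N_def)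
        then have "(1 + real n)\<^sup>2 \<le> (2 ^ k)\<^sup>2" by (intro power_mono) auto
        also have "((2 :: real) ^ k)\<^sup>2 = 4 ^ k" by (simp add: power2_eq_square flip: power_mult_distrib)
        finally have "mm k n = (1 + real n)\<^sup>2 / 4 ^ k" by (simp add: mm_def)
        then show ?thesis using True by (simp add: tlo thi pw1)
      next
        case False
        then have "real N \<le> real n" by simp
        then have "2 ^ k \<le> real n" unfolding N_def of_nat_power of_nat_numeral .
        then have "2 ^ k \<le> 1 + real n" by linarith
        then have "(2 ^ k)\<^sup>2 \<le> (1 + real n)\<^sup>2" by (intro power_mono) auto
        also have "((2 :: real) ^ k)\<^sup>2 = 4 ^ k" by (simp add: power2_eq_square flip: power_mult_distrib)
        finally have "mm k n = 1" by (simp add: mm_def)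
        then show ?thesis using False by (simp add: tlo thi)
      qed
      have sums: "(\<lambda>n. (cmod (a n))\<^sup>2 * ((pw s n)\<^sup>2 * mm k n)) sums
          (1 / 4 ^ k * nsq (pw (s + 1)) lo + nsq (pw s) hi)"
        using sums_add[OF sums_mult[OF sl, of "1 / 4 ^ k"] sh] unfolding eq .
      then have Sk: "S k = 1 / 4 ^ k * nsq (pw (s + 1)) lo + nsq (pw s) hi"
        unfolding S_def by (rule sums_unique[symmetric])
      define l where "l = taylor_coeff (\<lambda>z. lo (\<phi> z))"
      define h where "h = taylor_coeff (\<lambda>z. hi (\<phi> z))"
      have b: "b m = l m + h m" for m
      proof -
        have "(\<lambda>z. f (\<phi> z)) = (\<lambda>z. lo (\<phi> z) + hi (\<phi> z))" by (simp add: hi_def)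
        then show ?thesis
          unfolding b_def l_def h_def by (simp add: taylor_coeff_add[OF hc[OF lo_hol] hc[OF hi_hol]])
      qed
      have le: "(cmod (b m))\<^sup>2 * ((pw s m)\<^sup>2 * mm k m) \<le>
          2 * (1 / 4 ^ k * ((cmod (l m))\<^sup>2 * (pw (s + 1) m)\<^sup>2)) + 2 * ((cmod (h m))\<^sup>2 * (pw s m)\<^sup>2)" for m
      proof -
        have "(cmod (b m))\<^sup>2 * ((pw s m)\<^sup>2 * mm k m) \<le>
            (2 * (cmod (l m))\<^sup>2 + 2 * (cmod (h m))\<^sup>2) * ((pw s m)\<^sup>2 * mm k m)"
          unfolding b by (intro mult_right_mono cmod_add_sq_le) (simp add: mm_nn)
        also have "\<dots> = 2 * ((cmod (l m))\<^sup>2 * ((pw s m)\<^sup>2 * mm k m)) + 2 * ((cmod (h m))\<^sup>2 * ((pw s m)\<^sup>2 * mm k m))"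
          by (simp add: algebra_simps)
        also have "\<dots> \<le> 2 * ((cmod (l m))\<^sup>2 * ((pw s m)\<^sup>2 * ((1 + real m)\<^sup>2 / 4 ^ k))) +
            2 * ((cmod (h m))\<^sup>2 * ((pw s m)\<^sup>2 * 1))"
          by (intro add_mono mult_left_mono) (auto simp: mm_def)
        finally show ?thesis unfolding pw1 by (simp add: field_simps)
      qed
      have "(\<Sum>m<K. (cmod (b m))\<^sup>2 * ((pw s m)\<^sup>2 * mm k m)) \<le>
          (\<Sum>m<K. 2 * (1 / 4 ^ k * ((cmod (l m))\<^sup>2 * (pw (s + 1) m)\<^sup>2)) + 2 * ((cmod (h m))\<^sup>2 * (pw s m)\<^sup>2))"
        by (intro sum_mono le)
      also have "\<dots> = 2 * (1 / 4 ^ k * (\<Sum>m<K. (cmod (l m))\<^sup>2 * (pw (s + 1) m)\<^sup>2)) +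
          2 * (\<Sum>m<K. (cmod (h m))\<^sup>2 * (pw s m)\<^sup>2)"
        by (simp add: sum.distrib sum_distrib_left)
      also have "\<dots> \<le> 2 * (1 / 4 ^ k * (M * nsq (pw (s + 1)) lo)) + 2 * (M * nsq (pw s) hi)"
      proof (intro add_mono mult_left_mono)
        have "(\<Sum>m<K. (cmod (l m))\<^sup>2 * (pw (s + 1) m)\<^sup>2) \<le> nsq (pw (s + 1)) (\<lambda>z. lo (\<phi> z))"
          unfolding l_def using L by (intro wsq_sum_le) (auto simp: hardy_fun_def)
        also have "\<dots> \<le> M1 * nsq (pw (s + 1)) lo" using L by simp
        also have "\<dots> \<le> M * nsq (pw (s + 1)) lo"
          using hlo[of "pw (s + 1)"] by (intro mult_right_mono wsq_nonneg) (auto simp: hardy_fun_def M_def)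
        finally show "(\<Sum>m<K. (cmod (l m))\<^sup>2 * (pw (s + 1) m)\<^sup>2) \<le> M * nsq (pw (s + 1)) lo" .
        have "(\<Sum>m<K. (cmod (h m))\<^sup>2 * (pw s m)\<^sup>2) \<le> nsq (pw s) (\<lambda>z. hi (\<phi> z))"
          unfolding h_def using H by (intro wsq_sum_le) (auto simp: hardy_fun_def)
        also have "\<dots> \<le> M0 * nsq (pw s) hi" using H by simp
        also have "\<dots> \<le> M * nsq (pw s) hi"
          using hhi by (intro mult_right_mono wsq_nonneg) (auto simp: hardy_fun_def M_def)
        finally show "(\<Sum>m<K. (cmod (h m))\<^sup>2 * (pw s m)\<^sup>2) \<le> M * nsq (pw s) hi" .
      qed auto
      also have "\<dots> = 2 * M * S k" unfolding Sk by (simp add: algebra_simps)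
      finally show ?thesis using sums Sk by simp
    qed
    have part: "(\<Sum>m<K. (cmod (b m))\<^sup>2 * (pw (s + \<theta>) m)\<^sup>2) \<le> 8 * M * C * nsq (pw (s + \<theta>)) f" for K
    proof -
      \<comment> \<open>The dyadic sum may stop at the same \<open>K\<close> as the coefficient sum,
        because \<open>dyadic_sum_lower\<close> asks only for \<open>m < K\<close>; the sum over
        \<open>k\<close> stays finite.\<close>
      define Q where "Q n = (\<Sum>k<K. q ^ k * mm k n)" for n
      have "(\<lambda>n. \<Sum>k<K. q ^ k * ((cmod (a n))\<^sup>2 * ((pw s n)\<^sup>2 * mm k n))) sums (\<Sum>k<K. q ^ k * S k)"
        using step by (intro sums_sum sums_mult) blast
      then have s1: "(\<lambda>n. (cmod (a n))\<^sup>2 * (pw s n)\<^sup>2 * Q n) sums (\<Sum>k<K. q ^ k * S k)"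
        by (simp add: Q_def sum_distrib_left mult_ac)
      have s2: "(\<lambda>n. C * ((cmod (a n))\<^sup>2 * (pw (s + \<theta>) n)\<^sup>2)) sums (C * nsq (pw (s + \<theta>)) f)"
        unfolding a_def by (intro sums_mult wsq_sums sf)
      have le: "(cmod (a n))\<^sup>2 * (pw s n)\<^sup>2 * Q n \<le> C * ((cmod (a n))\<^sup>2 * (pw (s + \<theta>) n)\<^sup>2)" for n
      proof -
        have "(cmod (a n))\<^sup>2 * (pw s n)\<^sup>2 * Q n \<le> (cmod (a n))\<^sup>2 * (pw s n)\<^sup>2 * (C * pw (2 * \<theta>) n)"
          using C(2)[of n K] by (intro mult_left_mono) (auto simp: Q_def mm_def)
        then show ?thesis by (simp add: pwt mult_ac)
      qed
      have up: "(\<Sum>k<K. q ^ k * S k) \<le> C * nsq (pw (s + \<theta>)) f"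
        by (rule sums_le[OF le s1 s2])
      have "(\<Sum>m<K. (cmod (b m))\<^sup>2 * (pw (s + \<theta>) m)\<^sup>2) \<le>
          (\<Sum>m<K. 4 * ((cmod (b m))\<^sup>2 * (pw s m)\<^sup>2 * Q m))"
      proof (rule sum_mono)
        fix m assume "m \<in> {..<K}"
        then have "pw (2 * \<theta>) m \<le> 4 * Q m"
          using dyadic_sum_lower[OF q, of m K] by (simp add: Q_def mm_def)
        then have "(cmod (b m))\<^sup>2 * (pw s m)\<^sup>2 * pw (2 * \<theta>) m \<le> (cmod (b m))\<^sup>2 * (pw s m)\<^sup>2 * (4 * Q m)"
          by (intro mult_left_mono) auto
        then show "(cmod (b m))\<^sup>2 * (pw (s + \<theta>) m)\<^sup>2 \<le> 4 * ((cmod (b m))\<^sup>2 * (pw s m)\<^sup>2 * Q m)"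
          by (simp add: pwt mult_ac)
      qed
      also have "\<dots> = 4 * (\<Sum>m<K. \<Sum>k<K. q ^ k * ((cmod (b m))\<^sup>2 * ((pw s m)\<^sup>2 * mm k m)))"
        by (simp add: Q_def sum_distrib_left mult_ac)
      also have "\<dots> = 4 * (\<Sum>k<K. q ^ k * (\<Sum>m<K. (cmod (b m))\<^sup>2 * ((pw s m)\<^sup>2 * mm k m)))"
        by (subst sum.swap) (simp add: sum_distrib_left)
      also have "\<dots> \<le> 4 * (\<Sum>k<K. q ^ k * (2 * M * S k))"
        using step q by (intro mult_left_mono sum_mono) auto
      also have "\<dots> = 8 * M * (\<Sum>k<K. q ^ k * S k)"
        by (simp add: sum_distrib_left mult_ac)
      also have "\<dots> \<le> 8 * M * (C * nsq (pw (s + \<theta>)) f)"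
        using M0 M1 by (intro mult_left_mono up) (simp add: M_def)
      finally show ?thesis by (simp add: mult_ac)
    qed
    show "hardy_fun (pw (s + \<theta>)) (\<lambda>z. f (\<phi> z))"
      using wsq_leI(1)[OF part] hc[OF hf] by (simp add: hardy_fun_def b_def)
    show "nsq (pw (s + \<theta>)) (\<lambda>z. f (\<phi> z)) \<le> 8 * M * C * nsq (pw (s + \<theta>)) f"
      using wsq_leI(2)[OF part] by (simp add: b_def)
  qed
  then show ?thesis .
qed

lemma comp_bounded_pw:
  assumes \<phi>: "lft_self a b c d" "a * d - b * c \<noteq> 0"
  shows "comp_bounded (pw t) (\<lambda>z. (a * z + b) / (c * z + d))"
proof (cases "frac t = 0")
  case True
  then have "t = of_int \<lfloor>t\<rfloor>" by (simp add: frac_def)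
  then show ?thesis using comp_bounded_int[OF \<phi>, of "\<lfloor>t\<rfloor>"] by metis
next
  case False
  then have "0 < frac t" "frac t < 1" using frac_ge_0[of t] frac_lt_1[of t] by linarith+
  moreover have "comp_bounded (pw (of_int \<lfloor>t\<rfloor> + 1)) (\<lambda>z. (a * z + b) / (c * z + d))"
    using comp_bounded_int[OF \<phi>, of "\<lfloor>t\<rfloor> + 1"] by simp
  ultimately have "comp_bounded (pw (of_int \<lfloor>t\<rfloor> + frac t)) (\<lambda>z. (a * z + b) / (c * z + d))"
    by (rule comp_bounded_interpolate[OF lft_self_holomorphic[OF \<phi>(1)] comp_bounded_int[OF \<phi>], rotated])
  then show ?thesis by (simp add: frac_def)
qed

section \<open>Transfer to weights comparable to a power\<close>

lemma power_weight_compare: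
  assumes "power_weight t \<beta>"
  obtains c C where "c > 0" "C > 0"
    "\<And>f. hardy_fun \<beta> f \<longleftrightarrow> hardy_fun (pw t) f"
    "\<And>f. hardy_fun \<beta> f \<Longrightarrow> nsq \<beta> f \<le> C * nsq (pw t) f"
    "\<And>f. hardy_fun \<beta> f \<Longrightarrow> nsq (pw t) f \<le> c * nsq \<beta> f"
proof -
  obtain c C where c: "c > 0" and C: "C > 0" and le: "\<And>n. c * pw t n \<le> \<beta> n" "\<And>n. \<beta> n \<le> C * pw t n"
    using assms unfolding power_weight_def by blast
  have p: "\<beta> n > 0" for n by (rule power_weight_pos[OF assms])
  have 1: "(cmod (x n))\<^sup>2 * (\<beta> n)\<^sup>2 \<le> C\<^sup>2 * ((cmod (x n))\<^sup>2 * (pw t n)\<^sup>2)" for x :: "nat \<Rightarrow> complex" and n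
  proof -
    have "(\<beta> n)\<^sup>2 \<le> (C * pw t n)\<^sup>2" using le(2)[of n] p[of n] by (intro power_mono) auto
    from mult_left_mono[OF this, of "(cmod (x n))\<^sup>2"] show ?thesis by (simp add: power_mult_distrib mult_ac)
  qed
  have 2: "(cmod (x n))\<^sup>2 * (pw t n)\<^sup>2 \<le> (1 / c)\<^sup>2 * ((cmod (x n))\<^sup>2 * (\<beta> n)\<^sup>2)" for x :: "nat \<Rightarrow> complex" and n
  proof -
    have "pw t n \<le> 1 / c * \<beta> n" using le(1)[of n] c by (simp add: field_simps)
    then have "(pw t n)\<^sup>2 \<le> (1 / c * \<beta> n)\<^sup>2" by (intro power_mono) (auto simp: less_imp_le)
    from mult_left_mono[OF this, of "(cmod (x n))\<^sup>2"] show ?thesis by (simp add: power_mult_distrib mult_ac power_divide)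
  qed
  have 3: "wsummable \<beta> x" "wsq \<beta> x \<le> C\<^sup>2 * wsq (pw t) x" if "wsummable (pw t) x" for x
    by (rule wsq_dominated[OF that], rule 1)+
  have 4: "wsummable (pw t) x" "wsq (pw t) x \<le> (1 / c)\<^sup>2 * wsq \<beta> x" if "wsummable \<beta> x" for x
    by (rule wsq_dominated[OF that], rule 2)+
  show thesis
  proof (rule that[of "(1 / c)\<^sup>2" "C\<^sup>2"])
    show *: "hardy_fun \<beta> f \<longleftrightarrow> hardy_fun (pw t) f" for f
      unfolding hardy_fun_def using 3(1) 4(1) by blast
    show "nsq \<beta> f \<le> C\<^sup>2 * nsq (pw t) f" if "hardy_fun \<beta> f" for f
      using that *[of f] 3(2) unfolding hardy_fun_def by blast
    show "nsq (pw t) f \<le> (1 / c)\<^sup>2 * nsq \<beta> f" if "hardy_fun \<beta> f" for f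
      using that 4(2) unfolding hardy_fun_def by blast
  qed (use c C in auto)
qed

lemma comp_bounded_power_weight:
  assumes \<phi>: "lft_self a b c d" "a * d - b * c \<noteq> 0" and \<beta>: "power_weight t \<beta>"
  shows "comp_bounded \<beta> (\<lambda>z. (a * z + b) / (c * z + d))"
proof -
  obtain k K where K: "k > 0" "K > 0" "\<And>f. hardy_fun \<beta> f \<longleftrightarrow> hardy_fun (pw t) f"
    "\<And>f. hardy_fun \<beta> f \<Longrightarrow> nsq \<beta> f \<le> K * nsq (pw t) f"
    "\<And>f. hardy_fun \<beta> f \<Longrightarrow> nsq (pw t) f \<le> k * nsq \<beta> f"
    using power_weight_compare[OF \<beta>] by blast
  obtain M where M: "M \<ge> 0" "\<And>f. hardy_fun (pw t) f \<Longrightarrow>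
      hardy_fun (pw t) (\<lambda>z. f ((a * z + b) / (c * z + d))) \<and>
      nsq (pw t) (\<lambda>z. f ((a * z + b) / (c * z + d))) \<le> M * nsq (pw t) f"
    using comp_bounded_pw[OF \<phi>, of t] unfolding comp_bounded_def by blast
  show ?thesis unfolding comp_bounded_def
  proof (intro exI[of _ "K * (M * k)"] conjI allI impI)
    fix f assume f: "hardy_fun \<beta> f"
    note M' = M(2)[OF f[unfolded K(3)]]
    show h: "hardy_fun \<beta> (\<lambda>z. f ((a * z + b) / (c * z + d)))" using M' K(3) by blast
    have "nsq \<beta> (\<lambda>z. f ((a * z + b) / (c * z + d))) \<le> K * nsq (pw t) (\<lambda>z. f ((a * z + b) / (c * z + d)))"
      by (rule K(4)[OF h])
    also have "\<dots> \<le> K * (M * nsq (pw t) f)" using K M' by (intro mult_left_mono) auto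
    also have "\<dots> \<le> K * (M * (k * nsq \<beta> f))" using K M f by (intro mult_left_mono) auto
    finally show "nsq \<beta> (\<lambda>z. f ((a * z + b) / (c * z + d))) \<le> K * (M * k) * nsq \<beta> f"
      by (simp add: mult_ac)
  qed (use K M in auto)
qed

lemma moderate_power_weight:
  assumes "power_weight t \<beta>"
  shows "moderate \<beta>"
proof -
  obtain c C where c: "c > 0" and C: "C > 0" and le: "\<And>n. c * pw t n \<le> \<beta> n" "\<And>n. \<beta> n \<le> C * pw t n"
    using assms unfolding power_weight_def by blast
  obtain K s where K: "\<And>n j. pw t (n + j) \<le> K * (1 + real j) ^ s * pw t n"
    using moderate_pw unfolding moderate_def by blast
  have "pw t 0 \<le> K * pw t 0" using K[of 0 0] by simp
  then have "0 < K * pw t 0" by (rule order.strict_trans2[OF pw_pos])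
  then have Kp: "K > 0" by (rule zero_less_mult_pos2) simp
  have "\<beta> (n + j) \<le> (C * K / c) * (1 + real j) ^ s * \<beta> n" for n j
  proof -
    have "\<beta> (n + j) \<le> C * pw t (n + j)" by (rule le)
    also have "\<dots> \<le> C * (K * (1 + real j) ^ s * pw t n)" using C K by (intro mult_left_mono) auto
    also have "\<dots> \<le> C * (K * (1 + real j) ^ s * (\<beta> n / c))"
      using C Kp le(1)[of n] c by (intro mult_left_mono) (auto simp: field_simps)
    finally show ?thesis by (simp add: mult_ac)
  qed
  then show ?thesis unfolding moderate_def using power_weight_pos[OF assms] by blast
qed

subsection \<open>Bounded operators and adjoints\<close>

lemma weighted_hardy_iff: "f \<in> weighted_hardy \<beta> \<longleftrightarrow> hardy_fun \<beta> f \<and> (\<forall>z. z \<notin> \<D> \<longrightarrow> f z = 0)"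
  by (auto simp: weighted_hardy_def hardy_fun_def wsummable_def)

lemma weighted_hardyD:
  assumes "f \<in> weighted_hardy \<beta>"
  shows "hardy_fun \<beta> f" "f holomorphic_on \<D>" "wsummable \<beta> (taylor_coeff f)" "\<And>z. z \<notin> \<D> \<Longrightarrow> f z = 0"
    "nsq \<beta> f \<ge> 0"
  using assms by (auto simp: weighted_hardy_iff hardy_fun_def wsq_nonneg)

lemma wh_inner_eq: "wh_inner \<beta> f g = winner \<beta> (taylor_coeff f) (taylor_coeff g)"
  by (simp add: wh_inner_def winner_def)

lemma wh_norm_eq: "wh_norm \<beta> f = sqrt (nsq \<beta> f)"
  by (simp add: wh_norm_def wsq_def)

lemma weighted_hardy_add:
  "f \<in> weighted_hardy \<beta> \<Longrightarrow> g \<in> weighted_hardy \<beta> \<Longrightarrow> (\<lambda>z. f z + g z) \<in> weighted_hardy \<beta>"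
  by (simp add: weighted_hardy_iff hardy_fun_add)

lemma weighted_hardy_cmult: "f \<in> weighted_hardy \<beta> \<Longrightarrow> (\<lambda>z. s * f z) \<in> weighted_hardy \<beta>"
  by (simp add: weighted_hardy_iff hardy_fun_cmult)

lemma weighted_hardy_diff:
  assumes "f \<in> weighted_hardy \<beta>" "g \<in> weighted_hardy \<beta>"
  shows "(\<lambda>z. f z - g z) \<in> weighted_hardy \<beta>" "nsq \<beta> (\<lambda>z. f z - g z) \<le> 2 * nsq \<beta> f + 2 * nsq \<beta> g"
proof -
  have e: "(\<lambda>z. f z - g z) = (\<lambda>z. f z + (-1) * g z)" by simp
  note g = weighted_hardy_cmult[OF assms(2), of "-1"]
  show "(\<lambda>z. f z - g z) \<in> weighted_hardy \<beta>"
    unfolding e by (intro weighted_hardy_add assms g)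
  have "nsq \<beta> (\<lambda>z. f z + (-1) * g z) \<le> 2 * nsq \<beta> f + 2 * nsq \<beta> (\<lambda>z. (-1) * g z)"
    by (intro hardy_fun_add weighted_hardyD assms g)
  also have "nsq \<beta> (\<lambda>z. (-1) * g z) = nsq \<beta> g"
    using hardy_fun_cmult(2)[OF weighted_hardyD(1)[OF assms(2)], of "-1"] by simp
  finally show "nsq \<beta> (\<lambda>z. f z - g z) \<le> 2 * nsq \<beta> f + 2 * nsq \<beta> g" unfolding e .
qed

definition wh_bounded ::
    "(nat \<Rightarrow> real) \<Rightarrow> ((complex \<Rightarrow> complex) \<Rightarrow> complex \<Rightarrow> complex) \<Rightarrow> bool"
  where "wh_bounded \<beta> T \<longleftrightarrow> wh_linear \<beta> T \<and>
    (\<exists>M\<ge>0. \<forall>f\<in>weighted_hardy \<beta>. nsq \<beta> (T f) \<le> M * nsq \<beta> f)"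

lemma wh_linearD:
  assumes "wh_linear \<beta> T" "f \<in> weighted_hardy \<beta>"
  shows "T f \<in> weighted_hardy \<beta>"
    and "g \<in> weighted_hardy \<beta> \<Longrightarrow> T (\<lambda>z. f z + g z) = (\<lambda>z. T f z + T g z)"
    and "T (\<lambda>z. s * f z) = (\<lambda>z. s * T f z)"
    and "g \<in> weighted_hardy \<beta> \<Longrightarrow> T (\<lambda>z. f z - g z) = (\<lambda>z. T f z - T g z)"
proof -
  show 1: "T f \<in> weighted_hardy \<beta>" and 3: "T (\<lambda>z. s * f z) = (\<lambda>z. s * T f z)" for s
    using assms by (auto simp: wh_linear_def)
  show 2: "T (\<lambda>z. f z + g z) = (\<lambda>z. T f z + T g z)" if "g \<in> weighted_hardy \<beta>" for g
    using assms that by (auto simp: wh_linear_def)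
  assume g: "g \<in> weighted_hardy \<beta>"
  have "T (\<lambda>z. (-1) * g z) = (\<lambda>z. (-1) * T g z)" using assms(1) g unfolding wh_linear_def by blast
  then show "T (\<lambda>z. f z - g z) = (\<lambda>z. T f z - T g z)"
    using 2[OF weighted_hardy_cmult[OF g, of "-1"]] by simp
qed

lemma wh_bounded_comp_op:
  assumes "comp_bounded \<beta> \<phi>"
  shows "wh_bounded \<beta> (comp_op \<phi>)"
proof -
  obtain M where M: "M \<ge> 0" "\<And>f. hardy_fun \<beta> f \<Longrightarrow>
      hardy_fun \<beta> (\<lambda>z. f (\<phi> z)) \<and> nsq \<beta> (\<lambda>z. f (\<phi> z)) \<le> M * nsq \<beta> f"
    using assms unfolding comp_bounded_def by blast
  have e: "comp_op \<phi> f z = f (\<phi> z)" if "z \<in> \<D>" for f z using that by (simp add: comp_op_def)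
  have h: "hardy_fun \<beta> (comp_op \<phi> f) = hardy_fun \<beta> (\<lambda>z. f (\<phi> z))"
    and t: "taylor_coeff (comp_op \<phi> f) = taylor_coeff (\<lambda>z. f (\<phi> z))" for f
    by (rule hardy_fun_cong taylor_coeff_cong; use e in simp)+
  show ?thesis
    unfolding wh_bounded_def wh_linear_def
  proof (intro conjI exI[of _ M] ballI allI M(1))
    fix f assume f: "f \<in> weighted_hardy \<beta>"
    show "comp_op \<phi> f \<in> weighted_hardy \<beta>"
      unfolding weighted_hardy_iff h using M(2)[of f] f by (simp add: weighted_hardy_iff comp_op_def)
    show "nsq \<beta> (comp_op \<phi> f) \<le> M * nsq \<beta> f"
      unfolding t using M(2)[of f] f by (simp add: weighted_hardy_iff)
  qed (auto simp: comp_op_def)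
qed

lemma wh_bounded_mult_op:
  assumes "u holomorphic_on ball 0 R" "R > 1" "moderate \<beta>"
  shows "wh_bounded \<beta> (mult_op u)"
proof -
  obtain M where M: "M \<ge> 0" "\<And>f. hardy_fun \<beta> f \<Longrightarrow>
      hardy_fun \<beta> (\<lambda>z. u z * f z) \<and> nsq \<beta> (\<lambda>z. u z * f z) \<le> M * nsq \<beta> f"
    using mult_bounded[OF assms] by blast
  have e: "mult_op u f z = u z * f z" if "z \<in> \<D>" for f z using that by (simp add: mult_op_def)
  have h: "hardy_fun \<beta> (mult_op u f) = hardy_fun \<beta> (\<lambda>z. u z * f z)"
    and t: "taylor_coeff (mult_op u f) = taylor_coeff (\<lambda>z. u z * f z)" for f
    by (rule hardy_fun_cong taylor_coeff_cong; use e in simp)+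
  show ?thesis
    unfolding wh_bounded_def wh_linear_def
  proof (intro conjI exI[of _ M] ballI allI M(1))
    fix f assume f: "f \<in> weighted_hardy \<beta>"
    show "mult_op u f \<in> weighted_hardy \<beta>"
      unfolding weighted_hardy_iff h using M(2)[of f] f by (simp add: weighted_hardy_iff mult_op_def)
    show "nsq \<beta> (mult_op u f) \<le> M * nsq \<beta> f"
      unfolding t using M(2)[of f] f by (simp add: weighted_hardy_iff)
  qed (auto simp: mult_op_def algebra_simps)
qed

text \<open>Inverse to \<open>taylor_coeff\<close> on the space; the value 0 outside the disk
  matches the encoding of \<open>weighted_hardy\<close>.\<close>

definition of_coeffs :: "(nat \<Rightarrow> complex) \<Rightarrow> complex \<Rightarrow> complex"
  where "of_coeffs a z = (if z \<in> \<D> then \<Sum>n. a n * z ^ n else 0)"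

text \<open>The power series at \<open>z\<close> is the inner product series of \<open>a\<close>
  with the kernel coefficients at \<open>z\<close>, and that series converges.\<close>

lemma of_coeffs_sums:
  assumes "power_weight t \<beta>" "wsummable \<beta> a" "z \<in> \<D>"
  shows "(\<lambda>n. a n * z ^ n) sums of_coeffs a z"
proof -
  have "\<beta> n \<noteq> 0" for n using power_weight_pos[OF assms(1), of n] by simp
  then have "(\<lambda>n. a n * cnj (kernel_coeff \<beta> z n) * complex_of_real ((\<beta> n)\<^sup>2)) = (\<lambda>n. a n * z ^ n)"
    by (simp add: kernel_coeff_def)
  then have "summable (\<lambda>n. a n * z ^ n)"
    using winner_sums[OF assms(2) wsummable_kernel_coeff[OF assms(1,3)]] by (simp add: sums_iff)
  then show ?thesis using assms(3) by (simp add: of_coeffs_def summable_sums)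
qed

lemma of_coeffs_hardy:
  assumes "power_weight t \<beta>" "wsummable \<beta> a"
  shows "taylor_coeff (of_coeffs a) = a" "of_coeffs a \<in> weighted_hardy \<beta>"
proof -
  note I = taylor_coeffI[OF of_coeffs_sums[OF assms]]
  show "taylor_coeff (of_coeffs a) = a" by (rule I(2)) simp
  moreover have "of_coeffs a holomorphic_on \<D>" by (rule I(1)) simp
  moreover have "\<forall>z. z \<notin> \<D> \<longrightarrow> of_coeffs a z = 0" by (simp add: of_coeffs_def)
  ultimately show "of_coeffs a \<in> weighted_hardy \<beta>"
    using assms(2) by (simp add: weighted_hardy_iff hardy_fun_def)
qed

lemma of_coeffs_taylor:
  assumes "f \<in> weighted_hardy \<beta>"
  shows "of_coeffs (taylor_coeff f) = f"
proof
  fix z show "of_coeffs (taylor_coeff f) z = f z"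
    using weighted_hardyD(2,4)[OF assms] taylor_coeff_sums[of f z]
    by (cases "z \<in> \<D>") (auto simp: of_coeffs_def sums_iff)
qed

text \<open>Testing against the reproducing kernel at \<open>w\<close> recovers the conjugate of the
  value at \<open>w\<close>.\<close>

lemma weighted_hardy_eqI:
  assumes "power_weight t \<beta>" "x \<in> weighted_hardy \<beta>" "y \<in> weighted_hardy \<beta>"
    and "\<And>f. f \<in> weighted_hardy \<beta> \<Longrightarrow> wh_inner \<beta> f x = wh_inner \<beta> f y"
  shows "x = y"
proof
  fix w
  show "x w = y w"
  proof (cases "w \<in> \<D>")
    case True
    note k = wsummable_kernel_coeff[OF assms(1) True]
    note K = of_coeffs_hardy[OF assms(1) k]
    have "cnj (u w) = winner \<beta> (kernel_coeff \<beta> w) (taylor_coeff u)" if "u \<in> weighted_hardy \<beta>" for u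
      using winner_kernel_coeff[OF assms(1) weighted_hardyD(2)[OF that] True]
        winner_cnj[OF weighted_hardyD(3)[OF that] k] by simp
    then have "cnj (x w) = cnj (y w)"
      using assms(2,3) assms(4)[OF K(2)] by (simp add: wh_inner_eq K(1))
    then show ?thesis by simp
  next
    case False
    then show ?thesis using weighted_hardyD(4)[OF assms(2)] weighted_hardyD(4)[OF assms(3)] by simp
  qed
qed

lemma wh_inner_bound:
  assumes "f \<in> weighted_hardy \<beta>" "g \<in> weighted_hardy \<beta>"
  shows "(cmod (wh_inner \<beta> f g))\<^sup>2 \<le> nsq \<beta> f * nsq \<beta> g"
  unfolding wh_inner_eq by (intro winner_cauchy_schwarz weighted_hardyD assms)

lemma wh_inner_linear:
  assumes "f \<in> weighted_hardy \<beta>" "k \<in> weighted_hardy \<beta>"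
  shows "g \<in> weighted_hardy \<beta> \<Longrightarrow> wh_inner \<beta> (\<lambda>z. f z + g z) k = wh_inner \<beta> f k + wh_inner \<beta> g k"
    and "wh_inner \<beta> (\<lambda>z. s * f z) k = s * wh_inner \<beta> f k"
    and "wh_inner \<beta> k f = cnj (wh_inner \<beta> f k)"
    and "wh_inner \<beta> f f = complex_of_real (nsq \<beta> f)"
  using assms unfolding wh_inner_eq
  by (auto simp: taylor_coeff_add taylor_coeff_cmult weighted_hardyD winner_add_left winner_cmult_left
      winner_self intro: winner_cnj)

lemma wsq_tail:
  assumes "wsummable \<beta> a"
  shows "wsq \<beta> (\<lambda>n. if n < N then 0 else a n) = wsq \<beta> a - (\<Sum>n<N. (cmod (a n))\<^sup>2 * (\<beta> n)\<^sup>2)"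
    and "wsummable \<beta> (\<lambda>n. if n < N then 0 else a n)"
proof -
  let ?h = "\<lambda>n. (if n < N then (cmod (a n))\<^sup>2 * (\<beta> n)\<^sup>2 else 0)"
  have "?h sums (\<Sum>n<N. ?h n)" by (rule sums_finite) auto
  then have f: "?h sums (\<Sum>n<N. (cmod (a n))\<^sup>2 * (\<beta> n)\<^sup>2)" by simp
  have "(\<lambda>n. (cmod (a n))\<^sup>2 * (\<beta> n)\<^sup>2 - ?h n) sums (wsq \<beta> a - (\<Sum>n<N. (cmod (a n))\<^sup>2 * (\<beta> n)\<^sup>2))"
    by (intro sums_diff f wsq_sums assms)
  moreover have "(\<lambda>n. (cmod (a n))\<^sup>2 * (\<beta> n)\<^sup>2 - ?h n) = (\<lambda>n. (cmod (if n < N then 0 else a n))\<^sup>2 * (\<beta> n)\<^sup>2)"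
    by auto
  ultimately show "wsq \<beta> (\<lambda>n. if n < N then 0 else a n) = wsq \<beta> a - (\<Sum>n<N. (cmod (a n))\<^sup>2 * (\<beta> n)\<^sup>2)"
      "wsummable \<beta> (\<lambda>n. if n < N then 0 else a n)"
    by (auto simp: wsq_def wsummable_def sums_iff)
qed

text \<open>The values of \<open>L\<close> on monomials force the coefficients \<open>x\<close> of
  the representing function. Testing \<open>L\<close> on the finite sections of \<open>x\<close>
  itself gives \<open>P\<^sup>2 \<le> B * P\<close>, hence square-summability; boundedness then
  carries the identity from polynomials to all \<open>f\<close>, as the tails tend to 0 in
  norm.\<close>

lemma riesz_representation:
  assumes \<beta>: "power_weight t \<beta>" and B: "B \<ge> 0"
    and add: "\<And>f g. f \<in> weighted_hardy \<beta> \<Longrightarrow> g \<in> weighted_hardy \<beta> \<Longrightarrow> L (\<lambda>z. f z + g z) = L f + L g"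
    and scale: "\<And>f s. f \<in> weighted_hardy \<beta> \<Longrightarrow> L (\<lambda>z. s * f z) = s * L f"
    and bound: "\<And>f. f \<in> weighted_hardy \<beta> \<Longrightarrow> (cmod (L f))\<^sup>2 \<le> B * nsq \<beta> f"
  shows "\<exists>k\<in>weighted_hardy \<beta>. (\<forall>f\<in>weighted_hardy \<beta>. L f = wh_inner \<beta> f k) \<and> nsq \<beta> k \<le> B"
proof -
  have \<beta>_nz: "\<beta> n \<noteq> 0" for n using power_weight_pos[OF \<beta>, of n] by simp
  define e where "e n = of_coeffs (\<lambda>i. if i = n then 1 else 0)" for n :: nat
  have se: "wsummable \<beta> (\<lambda>i. if i = n then 1 else 0)" for n
    unfolding wsummable_def by (rule summable_finite[of "{n}"]) auto
  note e = of_coeffs_hardy[OF \<beta> se, folded e_def]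
  define x where "x n = cnj (L (e n)) / complex_of_real ((\<beta> n)\<^sup>2)" for n
  have Le: "L (e n) = cnj (x n) * complex_of_real ((\<beta> n)\<^sup>2)" for n
    using \<beta>_nz[of n] by (simp add: x_def)
  have fin: "wsummable \<beta> (\<lambda>i. if i < N then a i else 0)" for a and N :: nat
    unfolding wsummable_def by (rule summable_finite[of "{..<N}"]) auto
  note F = of_coeffs_hardy[OF \<beta> fin]
  have LF: "L (of_coeffs (\<lambda>i. if i < N then a i else 0)) = (\<Sum>i<N. a i * L (e i))" for a and N :: nat
  proof (induction N)
    case 0
    have "of_coeffs (\<lambda>i. if i < 0 then a i else 0) = (\<lambda>z. 0 * e 0 z)"
      by (auto simp: of_coeffs_def)
    then show ?case using scale[OF e(2), of 0 0] by simp
  next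
    case (Suc N)
    have "of_coeffs (\<lambda>i. if i < Suc N then a i else 0) =
        (\<lambda>z. of_coeffs (\<lambda>i. if i < N then a i else 0) z + a N * e N z)" (is "?l = ?r")
    proof -
      have r: "?r \<in> weighted_hardy \<beta>" by (intro weighted_hardy_add weighted_hardy_cmult F e)
      have "taylor_coeff ?r = (\<lambda>i. (if i < N then a i else 0) + a N * (if i = N then 1 else 0))"
        using taylor_coeff_add[OF weighted_hardyD(2)[OF F(2)] weighted_hardyD(2)[OF weighted_hardy_cmult[OF e(2)]]]
          taylor_coeff_cmult[OF weighted_hardyD(2)[OF e(2)]] F(1) e(1) by simp
      also have "\<dots> = (\<lambda>i. if i < Suc N then a i else 0)" by (auto simp: less_Suc_eq)
      finally show "?l = ?r" using of_coeffs_taylor[OF r] by metis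
    qed
    then show ?case
      using add[OF F(2) weighted_hardy_cmult[OF e(2)]] scale[OF e(2)] Suc by simp
  qed
  have part: "(\<Sum>i<N. (cmod (x i))\<^sup>2 * (\<beta> i)\<^sup>2) \<le> B" for N
  proof -
    define P where "P = (\<Sum>i<N. (cmod (x i))\<^sup>2 * (\<beta> i)\<^sup>2)"
    have P: "P \<ge> 0" unfolding P_def by (intro sum_nonneg) auto
    let ?f = "of_coeffs (\<lambda>i. if i < N then x i else 0)"
    have "x i * (cnj (x i) * complex_of_real ((\<beta> i)\<^sup>2)) = complex_of_real ((cmod (x i))\<^sup>2 * (\<beta> i)\<^sup>2)" for i
      by (simp only: of_real_mult complex_norm_square mult.assoc)
    then have "L ?f = complex_of_real P"
      unfolding LF Le P_def of_real_sum by (simp only:)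
    moreover have nf: "nsq \<beta> ?f = P"
    proof -
      have "(\<lambda>n. (cmod (if n < N then x n else 0))\<^sup>2 * (\<beta> n)\<^sup>2) sums
          (\<Sum>n<N. (cmod (if n < N then x n else 0))\<^sup>2 * (\<beta> n)\<^sup>2)"
        by (rule sums_finite) auto
      then show ?thesis unfolding F(1) wsq_def P_def by (simp add: sums_iff)
    qed
    ultimately have "P\<^sup>2 \<le> B * P" using bound[OF F(2)[of N x]] P by simp
    then show "P \<le> B" using P B by (cases "P = 0") (auto simp: power2_eq_square)
  qed
  define k where "k = of_coeffs x"
  note X = wsq_leI[OF part]
  note k = of_coeffs_hardy[OF \<beta> X(1), folded k_def]
  show ?thesis
  proof (intro bexI[OF _ k(2)] conjI ballI)
    show "nsq \<beta> k \<le> B" unfolding k(1) by (rule X(2))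
    fix f assume f: "f \<in> weighted_hardy \<beta>"
    define a where "a = taylor_coeff f"
    have sa: "wsummable \<beta> a" unfolding a_def by (rule weighted_hardyD[OF f])
    let ?lo = "\<lambda>N. of_coeffs (\<lambda>i. if i < N then a i else 0)"
    let ?hi = "\<lambda>N. of_coeffs (\<lambda>i. if i < N then 0 else a i)"
    note H = of_coeffs_hardy[OF \<beta> wsq_tail(2)[OF sa]]
    have "(\<lambda>N. L (?lo N)) \<longlonglongrightarrow> winner \<beta> a x"
      using winner_sums[OF sa X(1)] unfolding LF Le sums_def by (simp add: mult.assoc)
    moreover have "(\<lambda>N. L (?lo N)) \<longlonglongrightarrow> L f"
    proof -
      have split: "L f = L (?lo N) + L (?hi N)" for N
      proof -
        have r: "(\<lambda>z. ?lo N z + ?hi N z) \<in> weighted_hardy \<beta>" by (intro weighted_hardy_add F H)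
        have "taylor_coeff (\<lambda>z. ?lo N z + ?hi N z) = (\<lambda>i. (if i < N then a i else 0) + (if i < N then 0 else a i))"
          using taylor_coeff_add[OF weighted_hardyD(2)[OF F(2)] weighted_hardyD(2)[OF H(2)]] F(1) H(1) by simp
        also have "\<dots> = a" by auto
        finally have "f = (\<lambda>z. ?lo N z + ?hi N z)"
          using of_coeffs_taylor[OF r] of_coeffs_taylor[OF f] unfolding a_def by metis
        then have "L f = L (\<lambda>z. ?lo N z + ?hi N z)" by (rule arg_cong)
        also have "\<dots> = L (?lo N) + L (?hi N)" by (rule add[OF F(2) H(2)])
        finally show ?thesis .
      qed
      have "(\<lambda>N. wsq \<beta> a - (\<Sum>n<N. (cmod (a n))\<^sup>2 * (\<beta> n)\<^sup>2)) \<longlonglongrightarrow> wsq \<beta> a - wsq \<beta> a"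
        using wsq_sums[OF sa] unfolding sums_def by (intro tendsto_intros)
      then have "(\<lambda>N. nsq \<beta> (?hi N)) \<longlonglongrightarrow> 0"
        unfolding H(1) wsq_tail(1)[OF sa] by simp
      then have lim0: "(\<lambda>N. B * nsq \<beta> (?hi N)) \<longlonglongrightarrow> 0" by (rule tendsto_mult_right_zero)
      have "(\<lambda>N. (cmod (L (?hi N)))\<^sup>2) \<longlonglongrightarrow> 0"
        by (rule tendsto_sandwich[OF _ _ tendsto_const lim0])
          (use bound[OF H(2)] in \<open>auto intro!: always_eventually\<close>)
      then have "(\<lambda>N. sqrt ((cmod (L (?hi N)))\<^sup>2)) \<longlonglongrightarrow> sqrt 0" by (rule tendsto_real_sqrt)
      then have "(\<lambda>N. L (?hi N)) \<longlonglongrightarrow> 0" by (simp add: tendsto_norm_zero_iff)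
      then have "(\<lambda>N. L f - L (?hi N)) \<longlonglongrightarrow> L f - 0" by (intro tendsto_intros)
      moreover have "L f - L (?hi N) = L (?lo N)" for N using split[of N] by simp
      ultimately show ?thesis by simp
    qed
    ultimately show "L f = wh_inner \<beta> f k"
      unfolding wh_inner_eq k(1) a_def by (rule LIMSEQ_unique[symmetric])
  qed
qed

text \<open>Turns the definite description into its defining property: existence is the Riesz
  representation of the functional pairing \<open>T f\<close> with \<open>k\<close>, uniqueness is
  \<open>weighted_hardy_eqI\<close>.\<close>

lemma wh_adjoint:
  assumes \<beta>: "power_weight t \<beta>" and T: "wh_bounded \<beta> T" and k: "k \<in> weighted_hardy \<beta>"
  shows "wh_adjoint \<beta> T k \<in> weighted_hardy \<beta>"
    and "f \<in> weighted_hardy \<beta> \<Longrightarrow> wh_inner \<beta> (T f) k = wh_inner \<beta> f (wh_adjoint \<beta> T k)"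
proof -
  obtain M where M: "M \<ge> 0" "\<And>f. f \<in> weighted_hardy \<beta> \<Longrightarrow> nsq \<beta> (T f) \<le> M * nsq \<beta> f"
    and lin: "wh_linear \<beta> T"
    using T unfolding wh_bounded_def by blast
  note D = wh_linearD[OF lin]
  have "\<exists>k'\<in>weighted_hardy \<beta>. (\<forall>f\<in>weighted_hardy \<beta>. wh_inner \<beta> (T f) k = wh_inner \<beta> f k') \<and>
      nsq \<beta> k' \<le> M * nsq \<beta> k"
  proof (rule riesz_representation[OF \<beta>])
    show "M * nsq \<beta> k \<ge> 0" using M(1) weighted_hardyD(5)[OF k] by simp
  next
    fix f assume f: "f \<in> weighted_hardy \<beta>"
    show "wh_inner \<beta> (T (\<lambda>z. s * f z)) k = s * wh_inner \<beta> (T f) k" for s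
      unfolding D(3)[OF f] by (rule wh_inner_linear(2)[OF D(1)[OF f] k])
    show "wh_inner \<beta> (T (\<lambda>z. f z + g z)) k = wh_inner \<beta> (T f) k + wh_inner \<beta> (T g) k"
      if "g \<in> weighted_hardy \<beta>" for g
      unfolding D(2)[OF f that] by (rule wh_inner_linear(1)[OF D(1)[OF f] k D(1)[OF that]])
    have "(cmod (wh_inner \<beta> (T f) k))\<^sup>2 \<le> nsq \<beta> (T f) * nsq \<beta> k"
      by (rule wh_inner_bound[OF D(1)[OF f] k])
    also have "\<dots> \<le> M * nsq \<beta> f * nsq \<beta> k"
      by (intro mult_right_mono M(2) f weighted_hardyD(5)[OF k])
    finally show "(cmod (wh_inner \<beta> (T f) k))\<^sup>2 \<le> M * nsq \<beta> k * nsq \<beta> f" by (simp add: mult_ac)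
  qed
  then obtain k' where k': "k' \<in> weighted_hardy \<beta>"
    "\<forall>f\<in>weighted_hardy \<beta>. wh_inner \<beta> (T f) k = wh_inner \<beta> f k'" by blast
  have "wh_adjoint \<beta> T k = k'"
    unfolding wh_adjoint_def
  proof (rule the_equality)
    fix k'' assume "k'' \<in> weighted_hardy \<beta> \<and> (\<forall>f\<in>weighted_hardy \<beta>. wh_inner \<beta> (T f) k = wh_inner \<beta> f k'')"
    then show "k'' = k'" using k' by (intro weighted_hardy_eqI[OF \<beta>]) auto
  qed (use k' in simp)
  then show "wh_adjoint \<beta> T k \<in> weighted_hardy \<beta>"
    "f \<in> weighted_hardy \<beta> \<Longrightarrow> wh_inner \<beta> (T f) k = wh_inner \<beta> f (wh_adjoint \<beta> T k)"
    using k' by auto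
qed

lemma wh_bounded_adjoint:
  assumes \<beta>: "power_weight t \<beta>" and T: "wh_bounded \<beta> T"
  shows "wh_bounded \<beta> (wh_adjoint \<beta> T)"
proof -
  obtain M where M: "M \<ge> 0" "\<And>f. f \<in> weighted_hardy \<beta> \<Longrightarrow> nsq \<beta> (T f) \<le> M * nsq \<beta> f"
    and lin: "wh_linear \<beta> T"
    using T unfolding wh_bounded_def by blast
  note A = wh_adjoint[OF \<beta> T]
  have TD: "T f \<in> weighted_hardy \<beta>" if "f \<in> weighted_hardy \<beta>" for f by (rule wh_linearD[OF lin that])
  have inner_add: "wh_inner \<beta> f (\<lambda>z. u z + v z) = wh_inner \<beta> f u + wh_inner \<beta> f v"
    and inner_cmult: "wh_inner \<beta> f (\<lambda>z. s * u z) = cnj s * wh_inner \<beta> f u"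
    if "f \<in> weighted_hardy \<beta>" "u \<in> weighted_hardy \<beta>" "v \<in> weighted_hardy \<beta>" for f u v s
  proof -
    note c = wh_inner_linear(3)
    show "wh_inner \<beta> f (\<lambda>z. u z + v z) = wh_inner \<beta> f u + wh_inner \<beta> f v"
      using c[OF weighted_hardy_add[OF that(2,3)] that(1)] wh_inner_linear(1)[OF that(2,1,3)]
        c[OF that(2,1)] c[OF that(3,1)] by simp
    show "wh_inner \<beta> f (\<lambda>z. s * u z) = cnj s * wh_inner \<beta> f u"
      using c[OF weighted_hardy_cmult[OF that(2)] that(1)] wh_inner_linear(2)[OF that(2,1)]
        c[OF that(2,1)] by simp
  qed
  show ?thesis unfolding wh_bounded_def wh_linear_def
  proof (intro conjI ballI allI exI[of _ M] M(1) A(1))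
    fix k l assume k: "k \<in> weighted_hardy \<beta>" and l: "l \<in> weighted_hardy \<beta>"
    show "wh_adjoint \<beta> T (\<lambda>z. k z + l z) = (\<lambda>z. wh_adjoint \<beta> T k z + wh_adjoint \<beta> T l z)"
    proof (rule weighted_hardy_eqI[OF \<beta> A(1)[OF weighted_hardy_add[OF k l]]
          weighted_hardy_add[OF A(1)[OF k] A(1)[OF l]]])
      fix f assume f: "f \<in> weighted_hardy \<beta>"
      show "wh_inner \<beta> f (wh_adjoint \<beta> T (\<lambda>z. k z + l z)) =
          wh_inner \<beta> f (\<lambda>z. wh_adjoint \<beta> T k z + wh_adjoint \<beta> T l z)"
        using A(2)[OF weighted_hardy_add[OF k l] f] inner_add[OF TD[OF f] k l]
          inner_add[OF f A(1)[OF k] A(1)[OF l]] A(2)[OF k f] A(2)[OF l f] by simp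
    qed
  next
    fix k s assume k: "k \<in> weighted_hardy \<beta>"
    show "wh_adjoint \<beta> T (\<lambda>z. s * k z) = (\<lambda>z. s * wh_adjoint \<beta> T k z)"
    proof (rule weighted_hardy_eqI[OF \<beta> A(1)[OF weighted_hardy_cmult[OF k]]
          weighted_hardy_cmult[OF A(1)[OF k]]])
      fix f assume f: "f \<in> weighted_hardy \<beta>"
      show "wh_inner \<beta> f (wh_adjoint \<beta> T (\<lambda>z. s * k z)) = wh_inner \<beta> f (\<lambda>z. s * wh_adjoint \<beta> T k z)"
        using A(2)[OF weighted_hardy_cmult[OF k] f] inner_cmult[OF TD[OF f] k k]
          inner_cmult[OF f A(1)[OF k] A(1)[OF k]] A(2)[OF k f] by simp
    qed
  next
    fix k assume k: "k \<in> weighted_hardy \<beta>"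
    \<comment> \<open>Pairing the adjoint value with itself gives |x|^2 = (T x, k), and
      Cauchy-Schwarz followed by division by |x|^2 transfers the bound of \<open>T\<close>.\<close>
    define x where "x = wh_adjoint \<beta> T k"
    have x: "x \<in> weighted_hardy \<beta>" unfolding x_def by (rule A(1)[OF k])
    have "complex_of_real (nsq \<beta> x) = wh_inner \<beta> (T x) k"
      using A(2)[OF k x] wh_inner_linear(4)[OF x x] by (simp add: x_def)
    then have "(nsq \<beta> x)\<^sup>2 = (cmod (wh_inner \<beta> (T x) k))\<^sup>2"
      by (metis norm_of_real power2_abs)
    also have "\<dots> \<le> nsq \<beta> (T x) * nsq \<beta> k" by (rule wh_inner_bound[OF TD[OF x] k])
    also have "\<dots> \<le> M * nsq \<beta> x * nsq \<beta> k"
      by (intro mult_right_mono M(2) x weighted_hardyD(5)[OF k])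
    finally have le: "nsq \<beta> x * nsq \<beta> x \<le> (M * nsq \<beta> k) * nsq \<beta> x"
      by (simp add: power2_eq_square mult_ac)
    show "nsq \<beta> (wh_adjoint \<beta> T k) \<le> M * nsq \<beta> k"
    proof (cases "nsq \<beta> x = 0")
      case True
      then show ?thesis using M(1) weighted_hardyD(5)[OF k] by (simp add: x_def)
    next
      case False
      then have "nsq \<beta> x > 0" using weighted_hardyD(5)[OF x] by simp
      then show ?thesis using le by (simp add: x_def)
    qed
  qed
qed

subsection \<open>Compact operators\<close>

lemma wh_compact_iff_nsq:
  "wh_compact \<beta> T \<longleftrightarrow> wh_linear \<beta> T \<and>
    (\<forall>F B. (\<forall>n::nat. F n \<in> weighted_hardy \<beta> \<and> nsq \<beta> (F n) \<le> B) \<longrightarrow>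
       (\<exists>r k. strict_mono r \<and> k \<in> weighted_hardy \<beta> \<and>
          (\<lambda>n. nsq \<beta> (\<lambda>z. T (F (r n)) z - k z)) \<longlonglongrightarrow> 0))" (is "?c \<longleftrightarrow> _ \<and> ?d")
proof (cases "wh_linear \<beta> T")
  case True
  note D = wh_linearD[OF True]
  have lim: "(\<lambda>n. wh_norm \<beta> (\<lambda>z. T (F (r n)) z - k z)) \<longlonglongrightarrow> 0 \<longleftrightarrow>
      (\<lambda>n. nsq \<beta> (\<lambda>z. T (F (r n)) z - k z)) \<longlonglongrightarrow> 0"
    if F: "\<forall>n::nat. F n \<in> weighted_hardy \<beta>" and k: "k \<in> weighted_hardy \<beta>" for F :: "nat \<Rightarrow> complex \<Rightarrow> complex" and r :: "nat \<Rightarrow> nat" and k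
  proof -
    define x where "x n = nsq \<beta> (\<lambda>z. T (F (r n)) z - k z)" for n
    have "x n \<ge> 0" for n
      unfolding x_def by (intro weighted_hardyD(5) weighted_hardy_diff D k F[rule_format])
    then have "(\<lambda>n. sqrt (x n)) \<longlonglongrightarrow> 0 \<longleftrightarrow> x \<longlonglongrightarrow> 0"
      using tendsto_real_sqrt[of x 0 sequentially] tendsto_power[of "\<lambda>n. sqrt (x n)" 0 sequentially 2] by auto
    then show ?thesis by (simp add: wh_norm_eq x_def[abs_def])
  qed
  have "?c \<longleftrightarrow> ?d"
  proof
    assume c: ?c
    show ?d
    proof (intro allI impI)
      fix F :: "nat \<Rightarrow> complex \<Rightarrow> complex" and B
      assume F: "\<forall>n. F n \<in> weighted_hardy \<beta> \<and> nsq \<beta> (F n) \<le> B"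
      then have "\<forall>n. F n \<in> weighted_hardy \<beta> \<and> wh_norm \<beta> (F n) \<le> sqrt B"
        unfolding wh_norm_eq by simp
      then obtain r k where r: "strict_mono r" and k: "k \<in> weighted_hardy \<beta>"
        and l: "(\<lambda>n. wh_norm \<beta> (\<lambda>z. T (F (r n)) z - k z)) \<longlonglongrightarrow> 0"
        using c unfolding wh_compact_def by blast
      have "(\<lambda>n. nsq \<beta> (\<lambda>z. T (F (r n)) z - k z)) \<longlonglongrightarrow> 0"
        using l lim[of F k r] F k by blast
      then show "\<exists>r k. strict_mono r \<and> k \<in> weighted_hardy \<beta> \<and>
          (\<lambda>n. nsq \<beta> (\<lambda>z. T (F (r n)) z - k z)) \<longlonglongrightarrow> 0" using r k by blast
    qed
  next
    assume d: ?d
    show ?c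
      unfolding wh_compact_def
    proof (intro conjI allI impI True)
      fix F :: "nat \<Rightarrow> complex \<Rightarrow> complex" and B
      assume F: "\<forall>n. F n \<in> weighted_hardy \<beta> \<and> wh_norm \<beta> (F n) \<le> B"
      then have "\<forall>n. F n \<in> weighted_hardy \<beta> \<and> nsq \<beta> (F n) \<le> B\<^sup>2"
        unfolding wh_norm_eq by (simp add: sqrt_le_D)
      then obtain r k where r: "strict_mono r" and k: "k \<in> weighted_hardy \<beta>"
        and l: "(\<lambda>n. nsq \<beta> (\<lambda>z. T (F (r n)) z - k z)) \<longlonglongrightarrow> 0"
        using d by blast
      have "(\<lambda>n. wh_norm \<beta> (\<lambda>z. T (F (r n)) z - k z)) \<longlonglongrightarrow> 0"
        using l lim[of F k r] F k by blast
      then show "\<exists>r k. strict_mono r \<and> k \<in> weighted_hardy \<beta> \<and>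
          (\<lambda>n. wh_norm \<beta> (\<lambda>z. T (F (r n)) z - k z)) \<longlonglongrightarrow> 0" using r k by blast
    qed
  qed
  then show ?thesis using True by simp
qed (simp add: wh_compact_def)

lemma wh_linear_add:
  assumes "wh_linear \<beta> S" "wh_linear \<beta> T"
  shows "wh_linear \<beta> (\<lambda>f z. S f z + T f z)"
  using assms unfolding wh_linear_def by (auto intro!: weighted_hardy_add simp: algebra_simps fun_eq_iff)

lemma nsq_diff_tendsto_add:
  assumes F: "\<And>n. F n \<in> weighted_hardy \<beta>" "k \<in> weighted_hardy \<beta>" "(\<lambda>n. nsq \<beta> (\<lambda>z. F n z - k z)) \<longlonglongrightarrow> 0"
    and G: "\<And>n. G n \<in> weighted_hardy \<beta>" "l \<in> weighted_hardy \<beta>" "(\<lambda>n. nsq \<beta> (\<lambda>z. G n z - l z)) \<longlonglongrightarrow> 0"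
  shows "(\<lambda>n. nsq \<beta> (\<lambda>z. (F n z + G n z) - (k z + l z))) \<longlonglongrightarrow> 0"
proof (rule tendsto_sandwich[OF _ _ tendsto_const])
  have e: "(\<lambda>z. (F n z + G n z) - (k z + l z)) = (\<lambda>z. (F n z - k z) + (G n z - l z))" for n
    by (auto simp: algebra_simps)
  note d = weighted_hardy_diff(1)[OF F(1,2)] weighted_hardy_diff(1)[OF G(1,2)]
  show "\<forall>\<^sub>F n in sequentially. 0 \<le> nsq \<beta> (\<lambda>z. (F n z + G n z) - (k z + l z))"
    unfolding e by (intro always_eventually allI weighted_hardyD(5) weighted_hardy_add d)
  show "\<forall>\<^sub>F n in sequentially. nsq \<beta> (\<lambda>z. (F n z + G n z) - (k z + l z)) \<le>
      2 * nsq \<beta> (\<lambda>z. F n z - k z) + 2 * nsq \<beta> (\<lambda>z. G n z - l z)"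
    unfolding e by (intro always_eventually allI hardy_fun_add(2) weighted_hardyD(1) d)
  show "(\<lambda>n. 2 * nsq \<beta> (\<lambda>z. F n z - k z) + 2 * nsq \<beta> (\<lambda>z. G n z - l z)) \<longlonglongrightarrow> 0"
    using tendsto_add[OF tendsto_mult_left[OF F(3), of 2] tendsto_mult_left[OF G(3), of 2]] by simp
qed

lemma wh_compact_add:
  assumes "wh_compact \<beta> S" "wh_compact \<beta> T"
  shows "wh_compact \<beta> (\<lambda>f z. S f z + T f z)"
proof -
  have S: "wh_linear \<beta> S" and T: "wh_linear \<beta> T" using assms by (auto simp: wh_compact_def)
  show ?thesis
    unfolding wh_compact_iff_nsq
  proof (intro conjI allI impI wh_linear_add S T)
    fix F :: "nat \<Rightarrow> complex \<Rightarrow> complex" and B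
    assume F: "\<forall>n. F n \<in> weighted_hardy \<beta> \<and> nsq \<beta> (F n) \<le> B"
    obtain r k where r: "strict_mono r" and k: "k \<in> weighted_hardy \<beta>"
      "(\<lambda>n. nsq \<beta> (\<lambda>z. S (F (r n)) z - k z)) \<longlonglongrightarrow> 0"
      using assms(1) F unfolding wh_compact_iff_nsq by blast
    \<comment> \<open>The second operator is applied along the subsequence found for the first, so
      that one common subsequence serves both.\<close>
    have "\<forall>n. F (r n) \<in> weighted_hardy \<beta> \<and> nsq \<beta> (F (r n)) \<le> B" using F by blast
    then obtain s l where s: "strict_mono s" and l: "l \<in> weighted_hardy \<beta>"
      "(\<lambda>n. nsq \<beta> (\<lambda>z. T (F (r (s n))) z - l z)) \<longlonglongrightarrow> 0"
      using assms(2) unfolding wh_compact_iff_nsq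
      by (elim conjE allE[where x = "\<lambda>n. F (r n)"]) blast
    have "(\<lambda>n. nsq \<beta> (\<lambda>z. S (F (r (s n))) z - k z)) \<longlonglongrightarrow> 0"
      using LIMSEQ_subseq_LIMSEQ[OF k(2) s] by (simp add: o_def)
    then have "(\<lambda>n. nsq \<beta> (\<lambda>z. (S (F (r (s n))) z + T (F (r (s n))) z) - (k z + l z))) \<longlonglongrightarrow> 0"
      by (intro nsq_diff_tendsto_add k l wh_linearD(1)[OF S] wh_linearD(1)[OF T])
        (use F in auto)
    moreover have "strict_mono (\<lambda>n. r (s n))" using strict_mono_o[OF r s] by (simp add: o_def)
    moreover have "(\<lambda>z. k z + l z) \<in> weighted_hardy \<beta>" by (intro weighted_hardy_add k l)
    ultimately show "\<exists>r k. strict_mono r \<and> k \<in> weighted_hardy \<beta> \<and>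
        (\<lambda>n. nsq \<beta> (\<lambda>z. (S (F (r n)) z + T (F (r n)) z) - k z)) \<longlonglongrightarrow> 0"
      by (intro exI[of _ "\<lambda>n. r (s n)"] exI[of _ "\<lambda>z. k z + l z"] conjI)
  qed
qed

lemma wh_bounded_compose_compact:
  assumes S: "wh_bounded \<beta> S" and T: "wh_compact \<beta> T"
  shows "wh_compact \<beta> (\<lambda>f. S (T f))"
proof -
  obtain M where M: "M \<ge> 0" "\<And>f. f \<in> weighted_hardy \<beta> \<Longrightarrow> nsq \<beta> (S f) \<le> M * nsq \<beta> f"
    and lin: "wh_linear \<beta> S"
    using S unfolding wh_bounded_def by blast
  have linT: "wh_linear \<beta> T" using T by (simp add: wh_compact_def)
  note TD = wh_linearD(1)[OF linT] and SD = wh_linearD[OF lin]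
  show ?thesis
    unfolding wh_compact_iff_nsq
  proof (intro conjI allI impI)
    show "wh_linear \<beta> (\<lambda>f. S (T f))"
      using lin linT unfolding wh_linear_def by simp
    fix F :: "nat \<Rightarrow> complex \<Rightarrow> complex" and B
    assume F: "\<forall>n. F n \<in> weighted_hardy \<beta> \<and> nsq \<beta> (F n) \<le> B"
    obtain r k where r: "strict_mono r" and k: "k \<in> weighted_hardy \<beta>"
      "(\<lambda>n. nsq \<beta> (\<lambda>z. T (F (r n)) z - k z)) \<longlonglongrightarrow> 0"
      using T F unfolding wh_compact_iff_nsq by blast
    have d: "(\<lambda>z. T (F (r n)) z - k z) \<in> weighted_hardy \<beta>" for n
      using F by (intro weighted_hardy_diff TD k) auto
    have e: "S (\<lambda>z. T (F (r n)) z - k z) = (\<lambda>z. S (T (F (r n))) z - S k z)" for n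
      using F by (intro SD(4) TD k) auto
    have "(\<lambda>n. nsq \<beta> (\<lambda>z. S (T (F (r n))) z - S k z)) \<longlonglongrightarrow> 0"
    proof (rule tendsto_sandwich[OF _ _ tendsto_const])
      show "\<forall>\<^sub>F n in sequentially. 0 \<le> nsq \<beta> (\<lambda>z. S (T (F (r n))) z - S k z)"
        unfolding e[symmetric] by (intro always_eventually allI weighted_hardyD(5) SD(1) d)
      show "\<forall>\<^sub>F n in sequentially. nsq \<beta> (\<lambda>z. S (T (F (r n))) z - S k z) \<le> M * nsq \<beta> (\<lambda>z. T (F (r n)) z - k z)"
        unfolding e[symmetric] by (intro always_eventually allI M(2) d)
      show "(\<lambda>n. M * nsq \<beta> (\<lambda>z. T (F (r n)) z - k z)) \<longlonglongrightarrow> 0"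
        using tendsto_mult_left[OF k(2), of M] by simp
    qed
    then show "\<exists>r k. strict_mono r \<and> k \<in> weighted_hardy \<beta> \<and>
        (\<lambda>n. nsq \<beta> (\<lambda>z. S (T (F (r n))) z - k z)) \<longlonglongrightarrow> 0"
      using r SD(1)[OF k(1)] by blast
  qed
qed

lemma wh_compact_compose_bounded:
  assumes S: "wh_compact \<beta> S" and T: "wh_bounded \<beta> T"
  shows "wh_compact \<beta> (\<lambda>f. S (T f))"
proof -
  obtain M where M: "M \<ge> 0" "\<And>f. f \<in> weighted_hardy \<beta> \<Longrightarrow> nsq \<beta> (T f) \<le> M * nsq \<beta> f"
    and lin: "wh_linear \<beta> T"
    using T unfolding wh_bounded_def by blast
  have linS: "wh_linear \<beta> S" using S by (simp add: wh_compact_def)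
  show ?thesis
    unfolding wh_compact_iff_nsq
  proof (intro conjI allI impI)
    show "wh_linear \<beta> (\<lambda>f. S (T f))"
      using lin linS unfolding wh_linear_def by simp
    fix F :: "nat \<Rightarrow> complex \<Rightarrow> complex" and B
    assume F: "\<forall>n. F n \<in> weighted_hardy \<beta> \<and> nsq \<beta> (F n) \<le> B"
    have "\<forall>n. T (F n) \<in> weighted_hardy \<beta> \<and> nsq \<beta> (T (F n)) \<le> M * B"
    proof
      fix n
      have "nsq \<beta> (T (F n)) \<le> M * nsq \<beta> (F n)" using F M(2) by blast
      also have "\<dots> \<le> M * B" using F M(1) by (intro mult_left_mono) auto
      finally show "T (F n) \<in> weighted_hardy \<beta> \<and> nsq \<beta> (T (F n)) \<le> M * B"
        using F wh_linearD(1)[OF lin] by blast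
    qed
    then show "\<exists>r k. strict_mono r \<and> k \<in> weighted_hardy \<beta> \<and>
        (\<lambda>n. nsq \<beta> (\<lambda>z. S (T (F (r n))) z - k z)) \<longlonglongrightarrow> 0"
      using S unfolding wh_compact_iff_nsq
      by (elim conjE allE[where x = "\<lambda>n. T (F n)"]) blast
  qed
qed

text \<open>The scalars \<open>wh_inner \<beta> (F n) v\<close> are bounded by Cauchy-Schwarz and
  have a convergent subsequence.\<close>

lemma wh_compact_rank_one:
  assumes u: "u \<in> weighted_hardy \<beta>" and v: "v \<in> weighted_hardy \<beta>"
  shows "wh_compact \<beta> (\<lambda>f z. wh_inner \<beta> f v * u z)"
  unfolding wh_compact_iff_nsq
proof (intro conjI allI impI)
  show "wh_linear \<beta> (\<lambda>f z. wh_inner \<beta> f v * u z)"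
    unfolding wh_linear_def
    by (intro conjI ballI allI weighted_hardy_cmult[OF u])
      (simp_all add: wh_inner_linear(1,2)[OF _ v] algebra_simps)
  fix F :: "nat \<Rightarrow> complex \<Rightarrow> complex" and B
  assume F: "\<forall>n. F n \<in> weighted_hardy \<beta> \<and> nsq \<beta> (F n) \<le> B"
  have "cmod (wh_inner \<beta> (F n) v) \<le> sqrt (B * nsq \<beta> v)" for n
  proof (rule real_le_rsqrt)
    have "(cmod (wh_inner \<beta> (F n) v))\<^sup>2 \<le> nsq \<beta> (F n) * nsq \<beta> v"
      using F by (intro wh_inner_bound v) auto
    also have "\<dots> \<le> B * nsq \<beta> v"
      using F by (intro mult_right_mono weighted_hardyD(5)[OF v]) auto
    finally show "(cmod (wh_inner \<beta> (F n) v))\<^sup>2 \<le> B * nsq \<beta> v" .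
  qed
  then have "bounded (range (\<lambda>n. wh_inner \<beta> (F n) v))" unfolding bounded_iff by blast
  then obtain l r where r: "strict_mono r" "(\<lambda>n. wh_inner \<beta> (F (r n)) v) \<longlonglongrightarrow> l"
    using bounded_imp_convergent_subsequence[of "\<lambda>n. wh_inner \<beta> (F n) v"] by (auto simp: o_def)
  have e: "(\<lambda>z. wh_inner \<beta> (F (r n)) v * u z - l * u z) = (\<lambda>z. (wh_inner \<beta> (F (r n)) v - l) * u z)" for n
    by (simp add: algebra_simps)
  have "(\<lambda>n. (cmod (wh_inner \<beta> (F (r n)) v - l))\<^sup>2 * nsq \<beta> u) \<longlonglongrightarrow> (cmod (l - l))\<^sup>2 * nsq \<beta> u"
    by (intro tendsto_intros r)
  then have "(\<lambda>n. nsq \<beta> (\<lambda>z. wh_inner \<beta> (F (r n)) v * u z - l * u z)) \<longlonglongrightarrow> 0"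
    unfolding e hardy_fun_cmult(2)[OF weighted_hardyD(1)[OF u]] by simp
  then show "\<exists>r k. strict_mono r \<and> k \<in> weighted_hardy \<beta> \<and>
      (\<lambda>n. nsq \<beta> (\<lambda>z. wh_inner \<beta> (F (r n)) v * u z - k z)) \<longlonglongrightarrow> 0"
    using r weighted_hardy_cmult[OF u, of l] by blast
qed

lemma wh_compact_zero: "wh_compact \<beta> (\<lambda>f z. 0)"
proof -
  have 0: "(\<lambda>z. 0) \<in> weighted_hardy \<beta>"
  proof -
    have "hardy_fun \<beta> (poly 0)" by (rule hardy_fun_poly)
    moreover have "poly 0 = (\<lambda>z::complex. 0)" by auto
    ultimately show ?thesis by (simp add: weighted_hardy_iff)
  qed
  from wh_compact_rank_one[OF 0 0] show ?thesis by simp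
qed

lemma wh_compact_sum:
  assumes "finite I" "\<And>i. i \<in> I \<Longrightarrow> wh_compact \<beta> (T i)"
  shows "wh_compact \<beta> (\<lambda>f z. \<Sum>i\<in>I. T i f z)"
  using assms
proof (induction I rule: finite_induct)
  case empty
  then show ?case by (simp add: wh_compact_zero)
next
  case (insert x I)
  then show ?case using wh_compact_add[of \<beta> "T x" "\<lambda>f z. \<Sum>i\<in>I. T i f z"] by simp
qed

text \<open>Adjoints are specified only on the space, so operator identities are available there and
  not as equations between HOL functions.\<close>

lemma wh_compact_cong:
  assumes "wh_compact \<beta> S" "\<And>f. f \<in> weighted_hardy \<beta> \<Longrightarrow> T f = S f"
  shows "wh_compact \<beta> T"
proof -
  have l: "wh_linear \<beta> T"
    using assms unfolding wh_compact_def wh_linear_def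
    by (auto simp: weighted_hardy_add weighted_hardy_cmult)
  show ?thesis
    unfolding wh_compact_def
  proof (intro conjI allI impI l)
    fix F :: "nat \<Rightarrow> complex \<Rightarrow> complex" and B
    assume F: "\<forall>n. F n \<in> weighted_hardy \<beta> \<and> wh_norm \<beta> (F n) \<le> B"
    then have "T (F n) = S (F n)" for n using assms(2) by blast
    moreover obtain r k where "strict_mono r" "k \<in> weighted_hardy \<beta>"
        "(\<lambda>n. wh_norm \<beta> (\<lambda>z. S (F (r n)) z - k z)) \<longlonglongrightarrow> 0"
      using assms(1) F unfolding wh_compact_def by blast
    ultimately show "\<exists>r k. strict_mono r \<and> k \<in> weighted_hardy \<beta> \<and>
        (\<lambda>n. wh_norm \<beta> (\<lambda>z. T (F (r n)) z - k z)) \<longlonglongrightarrow> 0"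
      by (intro exI[of _ r] exI[of _ k]) simp
  qed
qed

definition diag_op :: "(nat \<Rightarrow> real) \<Rightarrow> (complex \<Rightarrow> complex) \<Rightarrow> complex \<Rightarrow> complex"
  where "diag_op \<delta> f = of_coeffs (\<lambda>n. complex_of_real (\<delta> n) * taylor_coeff f n)"

lemma diag_op_coeffs:
  assumes \<beta>: "power_weight t \<beta>" and \<delta>: "\<And>n. \<bar>\<delta> n\<bar> \<le> D" and f: "f \<in> weighted_hardy \<beta>"
  shows "diag_op \<delta> f \<in> weighted_hardy \<beta>"
    and "taylor_coeff (diag_op \<delta> f) = (\<lambda>n. complex_of_real (\<delta> n) * taylor_coeff f n)"
proof -
  have "wsummable \<beta> (\<lambda>n. complex_of_real (\<delta> n) * taylor_coeff f n)"
  proof (rule wsq_dominated(1)[OF weighted_hardyD(3)[OF f]])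
    fix n
    have "(\<delta> n)\<^sup>2 \<le> D\<^sup>2" using \<delta>[of n] by (metis abs_ge_zero power2_abs power_mono)
    then have "(\<delta> n)\<^sup>2 * ((cmod (taylor_coeff f n))\<^sup>2 * (\<beta> n)\<^sup>2) \<le> D\<^sup>2 * ((cmod (taylor_coeff f n))\<^sup>2 * (\<beta> n)\<^sup>2)"
      by (rule mult_right_mono) simp
    then show "(cmod (complex_of_real (\<delta> n) * taylor_coeff f n))\<^sup>2 * (\<beta> n)\<^sup>2 \<le>
        D\<^sup>2 * ((cmod (taylor_coeff f n))\<^sup>2 * (\<beta> n)\<^sup>2)"
      by (simp add: norm_mult power_mult_distrib mult.assoc)
  qed
  then show "diag_op \<delta> f \<in> weighted_hardy \<beta>"
    "taylor_coeff (diag_op \<delta> f) = (\<lambda>n. complex_of_real (\<delta> n) * taylor_coeff f n)"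
    unfolding diag_op_def using of_coeffs_hardy[OF \<beta>] by auto
qed

text \<open>Weak sequential compactness of balls, in coordinates: a diagonal argument for the
  coefficients, and finite sections to bound the limit.\<close>

lemma bounded_coeffs_subsequence:
  fixes a :: "nat \<Rightarrow> nat \<Rightarrow> complex"
  assumes \<beta>: "\<And>n. \<beta> n > 0" and a: "\<And>n. wsummable \<beta> (a n)" "\<And>n. wsq \<beta> (a n) \<le> B"
  shows "\<exists>r x. strict_mono r \<and> wsummable \<beta> x \<and> wsq \<beta> x \<le> B \<and> (\<forall>j. (\<lambda>n. a (r n) j) \<longlonglongrightarrow> x j)"
proof -
  \<comment> \<open>Multiplication by \<open>\<beta> j\<close> gives one bound valid for all
    coordinates at once, as the diagonal argument requires.\<close>
  have bd: "cmod (a n j * complex_of_real (\<beta> j)) \<le> sqrt B" for n j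
  proof (rule real_le_rsqrt)
    have "(cmod (a n j * complex_of_real (\<beta> j)))\<^sup>2 = (cmod (a n j))\<^sup>2 * (\<beta> j)\<^sup>2"
      by (simp add: norm_mult power_mult_distrib)
    also have "\<dots> \<le> B" using wsq_term_le[OF a(1)[of n], of j] a(2)[of n] by linarith
    finally show "(cmod (a n j * complex_of_real (\<beta> j)))\<^sup>2 \<le> B" .
  qed
  have "\<exists>r. strict_mono (r :: nat \<Rightarrow> nat) \<and>
      (\<forall>j. \<exists>l. (\<lambda>n. a (r n) j * complex_of_real (\<beta> j)) \<longlonglongrightarrow> l)"
  proof (rule function_convergent_subsequence[where f = "\<lambda>n j. a n j * complex_of_real (\<beta> j)"])
    show "countable (UNIV :: nat set)" by simp
    show "norm (a n j * complex_of_real (\<beta> j)) \<le> sqrt B" for n j by (rule bd)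
  qed blast
  then obtain r where r: "strict_mono (r :: nat \<Rightarrow> nat)"
    "\<And>j. \<exists>l. (\<lambda>n. a (r n) j * complex_of_real (\<beta> j)) \<longlonglongrightarrow> l"
    by blast
  then obtain l where l: "\<And>j. (\<lambda>n. a (r n) j * complex_of_real (\<beta> j)) \<longlonglongrightarrow> l j" by metis
  define x where "x j = l j / complex_of_real (\<beta> j)" for j
  have lim: "(\<lambda>n. a (r n) j) \<longlonglongrightarrow> x j" for j
  proof -
    have "\<beta> j \<noteq> 0" using \<beta>[of j] by simp
    then show ?thesis
      using tendsto_divide[OF l[of j] tendsto_const[of "complex_of_real (\<beta> j)"]] by (simp add: x_def)
  qed
  have part: "(\<Sum>j<N. (cmod (x j))\<^sup>2 * (\<beta> j)\<^sup>2) \<le> B" for N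
  proof (rule LIMSEQ_le_const2)
    show "(\<lambda>n. \<Sum>j<N. (cmod (a (r n) j))\<^sup>2 * (\<beta> j)\<^sup>2) \<longlonglongrightarrow> (\<Sum>j<N. (cmod (x j))\<^sup>2 * (\<beta> j)\<^sup>2)"
      by (intro tendsto_intros lim)
    have "(\<Sum>j<N. (cmod (a (r n) j))\<^sup>2 * (\<beta> j)\<^sup>2) \<le> B" for n
      using wsq_sum_le[OF a(1)[of "r n"], of "{..<N}"] a(2)[of "r n"] by simp
    then show "\<exists>N'. \<forall>n\<ge>N'. (\<Sum>j<N. (cmod (a (r n) j))\<^sup>2 * (\<beta> j)\<^sup>2) \<le> B" by blast
  qed
  show ?thesis using r(1) wsq_leI[OF part] lim by blast
qed

text \<open>Along a coefficientwise convergent subsequence, finitely many coordinates of the image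
  converge in norm, while the remaining ones are uniformly small because \<delta> is small there and
  the norms are bounded.\<close>

lemma wh_compact_diag_op:
  assumes \<beta>: "power_weight t \<beta>" and \<delta>: "\<delta> \<longlonglongrightarrow> 0"
  shows "wh_compact \<beta> (diag_op \<delta>)"
proof -
  obtain D where D: "\<And>n. \<bar>\<delta> n\<bar> \<le> D"
    using convergent_imp_Bseq[OF convergentI[OF \<delta>]] unfolding Bseq_def by auto
  note C = diag_op_coeffs[where \<delta> = \<delta>, OF \<beta> D]
  have eqI: "x = y" if "x \<in> weighted_hardy \<beta>" "y \<in> weighted_hardy \<beta>" "taylor_coeff x = taylor_coeff y" for x y
    using that of_coeffs_taylor by metis
  have lin: "wh_linear \<beta> (diag_op \<delta>)"
    unfolding wh_linear_def
  proof (intro conjI ballI allI C(1))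
    fix f k assume f: "f \<in> weighted_hardy \<beta>" and k: "k \<in> weighted_hardy \<beta>"
    note h = weighted_hardyD(2)[OF f] weighted_hardyD(2)[OF k]
      weighted_hardyD(2)[OF C(1)[OF f]] weighted_hardyD(2)[OF C(1)[OF k]]
    show "diag_op \<delta> (\<lambda>z. f z + k z) = (\<lambda>z. diag_op \<delta> f z + diag_op \<delta> k z)"
      by (rule eqI) (use f k h in \<open>auto intro!: C(1) weighted_hardy_add
          simp: C(2) weighted_hardy_add taylor_coeff_add algebra_simps\<close>)
  next
    fix f s assume f: "f \<in> weighted_hardy \<beta>"
    note h = weighted_hardyD(2)[OF f] weighted_hardyD(2)[OF C(1)[OF f]]
    show "diag_op \<delta> (\<lambda>z. s * f z) = (\<lambda>z. s * diag_op \<delta> f z)"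
      by (rule eqI) (use f h in \<open>auto intro!: C(1) weighted_hardy_cmult
          simp: C(2) weighted_hardy_cmult taylor_coeff_cmult algebra_simps\<close>)
  qed
  show ?thesis
    unfolding wh_compact_iff_nsq
  proof (intro conjI allI impI lin)
    fix F :: "nat \<Rightarrow> complex \<Rightarrow> complex" and B
    assume "\<forall>n. F n \<in> weighted_hardy \<beta> \<and> nsq \<beta> (F n) \<le> B"
    then have F: "\<And>n. F n \<in> weighted_hardy \<beta>" "\<And>n. nsq \<beta> (F n) \<le> B" by auto
    obtain r x where r: "strict_mono r" and x: "wsummable \<beta> x" "wsq \<beta> x \<le> B"
      "\<And>j. (\<lambda>n. taylor_coeff (F (r n)) j) \<longlonglongrightarrow> x j"
      using bounded_coeffs_subsequence[of \<beta> "\<lambda>n. taylor_coeff (F n)" B]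
        power_weight_pos[OF \<beta>] weighted_hardyD(3)[OF F(1)] F(2) by blast
    define X where "X = of_coeffs x"
    have X: "taylor_coeff X = x" "X \<in> weighted_hardy \<beta>"
      unfolding X_def by (rule of_coeffs_hardy[OF \<beta> x(1)])+
    define y where "y n j = taylor_coeff (F (r n)) j - x j" for n j
    have Y: "(\<lambda>z. F (r n) z - X z) \<in> weighted_hardy \<beta>" "taylor_coeff (\<lambda>z. F (r n) z - X z) = y n" for n
      using weighted_hardy_diff(1)[OF F(1) X(2)]
        taylor_coeff_diff[OF weighted_hardyD(2)[OF F(1)] weighted_hardyD(2)[OF X(2)]]
      by (auto simp: y_def X(1))
    have y: "wsummable \<beta> (y n)" "wsq \<beta> (y n) \<le> 4 * B" for n
    proof -
      show "wsummable \<beta> (y n)" using weighted_hardyD(3)[OF Y(1)[of n]] by (simp add: Y(2))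
      show "wsq \<beta> (y n) \<le> 4 * B"
        using weighted_hardy_diff(2)[OF F(1)[of "r n"] X(2)] F(2)[of "r n"] x(2) unfolding Y(2) X(1) by linarith
    qed
    have eq: "(\<lambda>z. diag_op \<delta> (F (r n)) z - diag_op \<delta> X z) = diag_op \<delta> (\<lambda>z. F (r n) z - X z)" for n
      using wh_linearD(4)[OF lin F(1) X(2)] by simp
    define z where "z n j = complex_of_real (\<delta> j) * y n j" for n j
    have z: "taylor_coeff (diag_op \<delta> (\<lambda>z. F (r n) z - X z)) = z n" "wsummable \<beta> (z n)" for n
      using C(2)[OF Y(1)[of n]] weighted_hardyD(3)[OF C(1)[OF Y(1)[of n]]] by (auto simp: Y(2) z_def[abs_def])
    have "(\<lambda>n. wsq \<beta> (z n)) \<longlonglongrightarrow> 0"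
    proof (rule LIMSEQ_I)
      fix \<epsilon> :: real assume \<epsilon>: "\<epsilon> > 0"
      have B: "B \<ge> 0" using wsq_nonneg[OF x(1)] x(2) by linarith
      \<comment> \<open>The tail is at most \<open>\<eta> * (4 * B)\<close>, and the added 1 keeps
        this strictly below \<open>\<epsilon> / 2\<close> and the denominator positive even if
        \<open>B = 0\<close>.\<close>
      define \<eta> where "\<eta> = \<epsilon> / (2 * (4 * B + 1))"
      have \<eta>: "\<eta> > 0" using \<epsilon> B by (simp add: \<eta>_def)
      have "(\<lambda>n. (\<delta> n)\<^sup>2) \<longlonglongrightarrow> 0" using tendsto_power[OF \<delta>, of 2] by simp
      from LIMSEQ_D[OF this \<eta>] obtain J where J: "\<And>n. n \<ge> J \<Longrightarrow> (\<delta> n)\<^sup>2 < \<eta>" by auto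
      have "(\<lambda>n. \<Sum>j<J. (cmod (z n j))\<^sup>2 * (\<beta> j)\<^sup>2) \<longlonglongrightarrow>
          (\<Sum>j<J. (cmod (complex_of_real (\<delta> j) * (x j - x j)))\<^sup>2 * (\<beta> j)\<^sup>2)"
        unfolding z_def y_def by (intro tendsto_intros x(3))
      then have "(\<lambda>n. \<Sum>j<J. (cmod (z n j))\<^sup>2 * (\<beta> j)\<^sup>2) \<longlonglongrightarrow> 0" by simp
      from LIMSEQ_D[OF this, of "\<epsilon> / 2"] \<epsilon> obtain N where
        N: "\<And>n. n \<ge> N \<Longrightarrow> \<bar>\<Sum>j<J. (cmod (z n j))\<^sup>2 * (\<beta> j)\<^sup>2\<bar> < \<epsilon> / 2" by auto
      have "norm (wsq \<beta> (z n) - 0) < \<epsilon>" if n: "n \<ge> N" for n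
      proof -
        have "wsq \<beta> (\<lambda>j. if j < J then 0 else z n j) \<le> \<eta> * wsq \<beta> (y n)"
        proof (rule wsq_dominated(2)[OF y(1)])
          fix j
          show "(cmod (if j < J then 0 else z n j))\<^sup>2 * (\<beta> j)\<^sup>2 \<le> \<eta> * ((cmod (y n j))\<^sup>2 * (\<beta> j)\<^sup>2)"
          proof (cases "j < J")
            case False
            then have "(\<delta> j)\<^sup>2 * ((cmod (y n j))\<^sup>2 * (\<beta> j)\<^sup>2) \<le> \<eta> * ((cmod (y n j))\<^sup>2 * (\<beta> j)\<^sup>2)"
              using J[of j] by (intro mult_right_mono) auto
            then show ?thesis using False by (simp add: z_def norm_mult power_mult_distrib mult.assoc)
          qed (use \<eta> in simp)
        qed
        also have "\<dots> \<le> \<eta> * (4 * B)" using \<eta> y(2) by (intro mult_left_mono) auto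
        also have "\<dots> < \<epsilon> / 2"
          using \<epsilon> B by (simp add: \<eta>_def divide_simps)
        finally have "wsq \<beta> (\<lambda>j. if j < J then 0 else z n j) < \<epsilon> / 2" .
        moreover have "wsq \<beta> (z n) = (\<Sum>j<J. (cmod (z n j))\<^sup>2 * (\<beta> j)\<^sup>2) + wsq \<beta> (\<lambda>j. if j < J then 0 else z n j)"
          using wsq_tail(1)[OF z(2)] by simp
        ultimately show ?thesis using N[OF n] wsq_nonneg[OF z(2)[of n]] by simp
      qed
      then show "\<exists>N. \<forall>n\<ge>N. norm (wsq \<beta> (z n) - 0) < \<epsilon>" by blast
    qed
    then have "(\<lambda>n. nsq \<beta> (\<lambda>z. diag_op \<delta> (F (r n)) z - diag_op \<delta> X z)) \<longlonglongrightarrow> 0"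
      unfolding eq z(1) .
    then show "\<exists>r k. strict_mono r \<and> k \<in> weighted_hardy \<beta> \<and>
        (\<lambda>n. nsq \<beta> (\<lambda>z. diag_op \<delta> (F (r n)) z - k z)) \<longlonglongrightarrow> 0"
      using r C(1)[OF X(2)] by blast
  qed
qed

subsection \<open>From a kernel identity to compactness\<close>

text \<open>Real entries make the diagonal operator self-adjoint.\<close>

lemma wh_inner_diag_op:
  assumes \<beta>: "power_weight t \<beta>" and \<delta>: "\<And>n. \<bar>\<delta> n\<bar> \<le> D"
    and f: "f \<in> weighted_hardy \<beta>" and k: "k \<in> weighted_hardy \<beta>"
  shows "wh_inner \<beta> (diag_op \<delta> f) k = wh_inner \<beta> f (diag_op \<delta> k)"
  unfolding wh_inner_eq winner_def diag_op_coeffs(2)[where \<delta> = \<delta>, OF \<beta> \<delta> f]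
    diag_op_coeffs(2)[where \<delta> = \<delta>, OF \<beta> \<delta> k]
  by (simp add: mult_ac)

lemma wh_inner_sum_left:
  assumes "finite I" "\<And>i. i \<in> I \<Longrightarrow> v i \<in> weighted_hardy \<beta>" "k \<in> weighted_hardy \<beta>"
  shows "(\<lambda>z. \<Sum>i\<in>I. c i * v i z) \<in> weighted_hardy \<beta> \<and>
    wh_inner \<beta> (\<lambda>z. \<Sum>i\<in>I. c i * v i z) k = (\<Sum>i\<in>I. c i * wh_inner \<beta> (v i) k)"
  using assms
proof (induction I rule: finite_induct)
  case empty
  have "wh_linear \<beta> (\<lambda>f z. 0)" using wh_compact_zero by (simp add: wh_compact_def)
  then have 0: "(\<lambda>z. 0) \<in> weighted_hardy \<beta>" using empty by (auto simp: wh_linear_def)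
  then show ?case using wh_inner_linear(2)[OF 0 empty(2), of 0] by simp
next
  case (insert x I)
  then have IH: "(\<lambda>z. \<Sum>i\<in>I. c i * v i z) \<in> weighted_hardy \<beta>"
      "wh_inner \<beta> (\<lambda>z. \<Sum>i\<in>I. c i * v i z) k = (\<Sum>i\<in>I. c i * wh_inner \<beta> (v i) k)"
    and x: "v x \<in> weighted_hardy \<beta>" by auto
  have e: "(\<lambda>z. \<Sum>i\<in>insert x I. c i * v i z) = (\<lambda>z. c x * v x z + (\<Sum>i\<in>I. c i * v i z))"
    using insert by simp
  note cx = weighted_hardy_cmult[OF x, of "c x"]
  show ?case
    unfolding e using weighted_hardy_add[OF cx IH(1)] wh_inner_linear(1)[OF cx insert(5) IH(1)]
      wh_inner_linear(2)[OF x insert(5)] IH(2) insert by simp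
qed

text \<open>With \<open>K\<^sub>w\<close> the function with coefficients \<open>\<kappa>\<^sub>n (cnj w)\<^sup>n\<close> and \<open>k\<^sub>w\<close> the reproducing kernel,
  \<open>k\<^sub>w = K\<^sub>w / \<mu> + G k\<^sub>w\<close> for a diagonal operator \<open>G\<close> whose entries tend to \<open>0\<close>.
  Testing the difference against \<open>k\<^sub>w\<close> therefore exhibits it as a finite rank operator plus
  \<open>G C\<^sub>\<phi>\<^sup>* - M\<^sub>g C\<^sub>\<sigma> G M\<^sub>h\<^sup>*\<close>.\<close>
lemma compact_of_kernel_identity:
  fixes \<kappa> :: "nat \<Rightarrow> real" and \<mu> :: real
  assumes \<beta>: "power_weight t \<beta>"
    and C: "comp_bounded \<beta> \<phi>" and S: "comp_bounded \<beta> \<sigma>"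
    and \<phi>: "\<And>z. z \<in> \<D> \<Longrightarrow> \<phi> z \<in> \<D>" and \<sigma>: "\<And>z. z \<in> \<D> \<Longrightarrow> \<sigma> z \<in> \<D>"
    and g: "wh_bounded \<beta> (mult_op g)" and h: "wh_bounded \<beta> (mult_op h)"
    and \<mu>: "\<mu> \<noteq> 0" "(\<lambda>n. \<kappa> n * (\<beta> n)\<^sup>2) \<longlonglongrightarrow> \<mu>"
    and k: "\<And>x. x \<in> \<D> \<Longrightarrow> (\<lambda>n. complex_of_real (\<kappa> n) * x ^ n) sums k x"
    and I: "finite I" "\<And>i. i \<in> I \<Longrightarrow> u i \<in> weighted_hardy \<beta>" "\<And>i. i \<in> I \<Longrightarrow> v i \<in> weighted_hardy \<beta>"
    and id: "\<And>w z. w \<in> \<D> \<Longrightarrow> z \<in> \<D> \<Longrightarrow>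
      k (cnj w * \<phi> z) - cnj (g w) * h z * k (cnj (\<sigma> w) * z) = (\<Sum>i\<in>I. cnj (u i w) * v i z)"
  shows "wh_compact \<beta> (\<lambda>f z. wh_adjoint \<beta> (comp_op \<phi>) f z
           - mult_op g (comp_op \<sigma> (wh_adjoint \<beta> (mult_op h) f)) z)"
proof -
  \<comment> \<open>Solves \<open>\<kappa> n / \<mu> + \<delta> n / (\<beta> n)\<^sup>2 = 1 /
    (\<beta> n)\<^sup>2\<close>: the explicit kernel plus the diagonal correction has the
    coefficients of the reproducing kernel.\<close>
  define \<delta> where "\<delta> n = 1 - \<kappa> n * (\<beta> n)\<^sup>2 / \<mu>" for n
  have "(\<lambda>n. 1 - \<kappa> n * (\<beta> n)\<^sup>2 / \<mu>) \<longlonglongrightarrow> 1 - \<mu> / \<mu>"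
    by (intro tendsto_intros \<mu>)
  then have \<delta>0: "\<delta> \<longlonglongrightarrow> 0" using \<mu>(1) by (simp add: \<delta>_def[abs_def])
  obtain D where D: "\<And>n. \<bar>\<delta> n\<bar> \<le> D"
    using convergent_imp_Bseq[OF convergentI[OF \<delta>0]] unfolding Bseq_def by auto
  define G where "G = diag_op \<delta>"
  have GH: "G f \<in> weighted_hardy \<beta>" if "f \<in> weighted_hardy \<beta>" for f
    unfolding G_def by (rule diag_op_coeffs(1)[where \<delta> = \<delta>, OF \<beta> D that])
  have Gc: "wh_compact \<beta> G" unfolding G_def by (rule wh_compact_diag_op[OF \<beta> \<delta>0])
  define kk where "kk w = of_coeffs (kernel_coeff \<beta> w)" for w
  have kk: "taylor_coeff (kk w) = kernel_coeff \<beta> w" "kk w \<in> weighted_hardy \<beta>" if "w \<in> \<D>" for w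
    unfolding kk_def by (rule of_coeffs_hardy[OF \<beta> wsummable_kernel_coeff[OF \<beta> that]])+
  have eval: "wh_inner \<beta> (kk w) f = cnj (f w)" if "f \<in> weighted_hardy \<beta>" "w \<in> \<D>" for f w
    using wh_inner_linear(3)[OF that(1) kk(2)[OF that(2)]]
      winner_kernel_coeff[OF \<beta> weighted_hardyD(2)[OF that(1)] that(2)]
    by (simp add: wh_inner_eq kk(1)[OF that(2)])
  define KK where "KK w z = (if z \<in> \<D> then k (cnj w * z) else 0)" for w z
  have KK: "KK w \<in> weighted_hardy \<beta>" "kk w = (\<lambda>z. complex_of_real (1 / \<mu>) * KK w z + G (kk w) z)"
    if w: "w \<in> \<D>" for w
  proof -
    note kw = kk[OF w] and Gw = GH[OF kk(2)[OF w]]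
    have tG: "taylor_coeff (G (kk w)) = (\<lambda>n. complex_of_real (\<delta> n) * kernel_coeff \<beta> w n)"
      unfolding G_def using diag_op_coeffs(2)[where \<delta> = \<delta>, OF \<beta> D kw(2)] kw(1) by simp
    have eq: "complex_of_real \<mu> * (kk w z - G (kk w) z) = KK w z" for z
    proof (cases "z \<in> \<D>")
      case True
      have "cmod (cnj w * z) < 1 * 1"
        unfolding norm_mult using w True by (intro mult_strict_mono') auto
      then have "(\<lambda>n. complex_of_real (\<kappa> n) * (cnj w * z) ^ n) sums k (cnj w * z)"
        by (intro k) simp
      moreover have "(\<lambda>n. complex_of_real \<mu> * (kernel_coeff \<beta> w n * z ^ n -
          complex_of_real (\<delta> n) * kernel_coeff \<beta> w n * z ^ n)) sums
          (complex_of_real \<mu> * (kk w z - G (kk w) z))"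
        using taylor_coeff_sums[OF weighted_hardyD(2)[OF kw(2)] True]
          taylor_coeff_sums[OF weighted_hardyD(2)[OF Gw] True]
        unfolding kw(1) tG by (intro sums_mult sums_diff)
      moreover have "complex_of_real \<mu> * (kernel_coeff \<beta> w n * z ^ n -
          complex_of_real (\<delta> n) * kernel_coeff \<beta> w n * z ^ n) = complex_of_real (\<kappa> n) * (cnj w * z) ^ n" for n
      proof -
        have "\<beta> n \<noteq> 0" using power_weight_pos[OF \<beta>, of n] by simp
        then show ?thesis using \<mu>(1)
          by (simp add: \<delta>_def kernel_coeff_def power_mult_distrib field_simps)
      qed
      ultimately show ?thesis using True by (simp add: KK_def sums_iff)
    next
      case False
      then show ?thesis
        using weighted_hardyD(4)[OF kw(2)] weighted_hardyD(4)[OF Gw] by (simp add: KK_def)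
    qed
    have "KK w = (\<lambda>z. complex_of_real \<mu> * (kk w z - G (kk w) z))" using eq by auto
    then show "KK w \<in> weighted_hardy \<beta>"
      using weighted_hardy_cmult[OF weighted_hardy_diff(1)[OF kw(2) Gw]] by simp
    show "kk w = (\<lambda>z. complex_of_real (1 / \<mu>) * KK w z + G (kk w) z)"
      using \<mu>(1) by (auto simp flip: eq)
  qed
  note Cb = wh_bounded_comp_op[OF C] and Sb = wh_bounded_comp_op[OF S]
  have Cl: "wh_linear \<beta> (comp_op \<phi>)" and hl: "wh_linear \<beta> (mult_op h)"
    using Cb h by (auto simp: wh_bounded_def)
  define Ca where "Ca = wh_adjoint \<beta> (comp_op \<phi>)"
  define Ha where "Ha = wh_adjoint \<beta> (mult_op h)"
  note Ca = wh_adjoint[OF \<beta> Cb, folded Ca_def] and Ha = wh_adjoint[OF \<beta> h, folded Ha_def]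
  have Cab: "wh_bounded \<beta> Ca" and Hab: "wh_bounded \<beta> Ha"
    unfolding Ca_def Ha_def by (rule wh_bounded_adjoint[OF \<beta>], rule Cb h)+
  \<comment> \<open>Evaluation at \<open>w\<close> is pairing with \<open>kk w\<close>;
    \<open>T\<close> moves across, and the split of \<open>kk w\<close> separates the explicit
    kernel from the diagonal correction. It is applied to composition with \<phi> at
    \<open>z\<close> and to multiplication by \<open>h\<close> at \<open>\<sigma> z\<close>.\<close>
  have adj_eval: "cnj (wh_adjoint \<beta> T f w) =
      complex_of_real (1 / \<mu>) * wh_inner \<beta> (T (KK w)) f + cnj (G (wh_adjoint \<beta> T f) w)"
    if T: "wh_bounded \<beta> T" and f: "f \<in> weighted_hardy \<beta>" and w: "w \<in> \<D>" for T f w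
  proof -
    have lin: "wh_linear \<beta> T" using T by (simp add: wh_bounded_def)
    note A = wh_adjoint[OF \<beta> T f]
    note TK = wh_linearD(1)[OF lin KK(1)[OF w]] and Gk = GH[OF kk(2)[OF w]]
    have cK: "(\<lambda>z. complex_of_real (1 / \<mu>) * KK w z) \<in> weighted_hardy \<beta>"
      by (rule weighted_hardy_cmult[OF KK(1)[OF w]])
    have Tkk: "T (kk w) = (\<lambda>z. complex_of_real (1 / \<mu>) * T (KK w) z + T (G (kk w)) z)"
      by (subst KK(2)[OF w]) (simp only: wh_linearD(2)[OF lin cK Gk] wh_linearD(3)[OF lin KK(1)[OF w]])
    have "cnj (wh_adjoint \<beta> T f w) = wh_inner \<beta> (kk w) (wh_adjoint \<beta> T f)"
      by (rule eval[OF A(1) w, symmetric])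
    also have "\<dots> = wh_inner \<beta> (T (kk w)) f" by (rule A(2)[OF kk(2)[OF w], symmetric])
    also have "\<dots> = complex_of_real (1 / \<mu>) * wh_inner \<beta> (T (KK w)) f + wh_inner \<beta> (T (G (kk w))) f"
      unfolding Tkk wh_inner_linear(1)[OF weighted_hardy_cmult[OF TK] f wh_linearD(1)[OF lin Gk]]
        wh_inner_linear(2)[OF TK f] ..
    also have "wh_inner \<beta> (T (G (kk w))) f = wh_inner \<beta> (G (kk w)) (wh_adjoint \<beta> T f)"
      by (rule A(2)[OF Gk])
    also have "\<dots> = wh_inner \<beta> (kk w) (G (wh_adjoint \<beta> T f))"
      unfolding G_def by (rule wh_inner_diag_op[where \<delta> = \<delta>, OF \<beta> D kk(2)[OF w] A(1)])
    also have "\<dots> = cnj (G (wh_adjoint \<beta> T f) w)" by (rule eval[OF GH[OF A(1)] w])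
    finally show ?thesis .
  qed
  have main: "Ca f z - mult_op g (comp_op \<sigma> (Ha f)) z =
      ((\<Sum>i\<in>I. wh_inner \<beta> f (v i) * (complex_of_real (1 / \<mu>) * u i z)) + G (Ca f) z) +
      (-1) * mult_op g (comp_op \<sigma> (G (Ha f))) z" if f: "f \<in> weighted_hardy \<beta>" for f z
  proof (cases "z \<in> \<D>")
    case False
    have "u i z = 0" if "i \<in> I" for i using weighted_hardyD(4)[OF I(2)[OF that] False] .
    then show ?thesis
      using False weighted_hardyD(4)[OF Ca(1)[OF f] False] weighted_hardyD(4)[OF GH[OF Ca(1)[OF f]] False]
      by (simp add: mult_op_def)
  next
    case z: True
    note sz = \<sigma>[OF z]
    note K1 = wh_linearD(1)[OF Cl KK(1)[OF z]] and K2 = wh_linearD(1)[OF hl KK(1)[OF sz]]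
    \<comment> \<open>The kernel identity with the first variable fixed at \<open>z\<close>, read as
      an equation between functions of the second.\<close>
    have fun_eq: "(\<lambda>x. comp_op \<phi> (KK z) x + (- cnj (g z)) * mult_op h (KK (\<sigma> z)) x) =
        (\<lambda>x. \<Sum>i\<in>I. cnj (u i z) * v i x)"
    proof
      fix x
      show "comp_op \<phi> (KK z) x + (- cnj (g z)) * mult_op h (KK (\<sigma> z)) x = (\<Sum>i\<in>I. cnj (u i z) * v i x)"
      proof (cases "x \<in> \<D>")
        case True
        then show ?thesis
          using id[OF z True] \<phi>[OF True] by (simp add: comp_op_def mult_op_def KK_def mult.assoc)
      next
        case False
        then have "v i x = 0" if "i \<in> I" for i using weighted_hardyD(4)[OF I(3)[OF that]] by blast
        then show ?thesis using False by (simp add: comp_op_def mult_op_def)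
      qed
    qed
    have "wh_inner \<beta> (comp_op \<phi> (KK z)) f - cnj (g z) * wh_inner \<beta> (mult_op h (KK (\<sigma> z))) f =
        wh_inner \<beta> (\<lambda>x. comp_op \<phi> (KK z) x + (- cnj (g z)) * mult_op h (KK (\<sigma> z)) x) f"
      unfolding wh_inner_linear(1)[OF K1 f weighted_hardy_cmult[OF K2]] wh_inner_linear(2)[OF K2 f] by simp
    also have "\<dots> = (\<Sum>i\<in>I. cnj (u i z) * wh_inner \<beta> (v i) f)"
      unfolding fun_eq using wh_inner_sum_left[where c = "\<lambda>i. cnj (u i z)" and v = v, OF I(1,3) f] by blast
    also have "\<dots> = (\<Sum>i\<in>I. cnj (u i z * wh_inner \<beta> f (v i)))"
      using wh_inner_linear(3)[OF f I(3)] by (intro sum.cong) auto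
    finally have fin: "wh_inner \<beta> (comp_op \<phi> (KK z)) f - cnj (g z) * wh_inner \<beta> (mult_op h (KK (\<sigma> z))) f =
        (\<Sum>i\<in>I. cnj (u i z * wh_inner \<beta> f (v i)))" .
    have "cnj (Ca f z - g z * Ha f (\<sigma> z)) =
       complex_of_real (1 / \<mu>) * (wh_inner \<beta> (comp_op \<phi> (KK z)) f - cnj (g z) * wh_inner \<beta> (mult_op h (KK (\<sigma> z))) f)
        + (cnj (G (Ca f) z) - cnj (g z) * cnj (G (Ha f) (\<sigma> z)))"
      using adj_eval[OF Cb f z] adj_eval[OF h f sz]
      by (simp add: Ca_def[symmetric] Ha_def[symmetric] algebra_simps)
    also have "\<dots> = cnj (complex_of_real (1 / \<mu>) * (\<Sum>i\<in>I. u i z * wh_inner \<beta> f (v i)) +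
        (G (Ca f) z - g z * G (Ha f) (\<sigma> z)))"
      unfolding fin by simp
    finally have "Ca f z - g z * Ha f (\<sigma> z) = complex_of_real (1 / \<mu>) * (\<Sum>i\<in>I. u i z * wh_inner \<beta> f (v i)) +
        (G (Ca f) z - g z * G (Ha f) (\<sigma> z))"
      using complex_cnj_cancel_iff by blast
    then show ?thesis
      using z by (simp add: mult_op_def comp_op_def sum_distrib_left mult_ac)
  qed
  have "wh_compact \<beta> (\<lambda>f z. ((\<Sum>i\<in>I. wh_inner \<beta> f (v i) * (complex_of_real (1 / \<mu>) * u i z)) + G (Ca f) z) +
      (-1) * mult_op g (comp_op \<sigma> (G (Ha f))) z)"
  proof (intro wh_compact_add wh_compact_sum I(1) wh_compact_rank_one weighted_hardy_cmult I(2,3))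
    show "wh_compact \<beta> (\<lambda>f. G (Ca f))" by (rule wh_compact_compose_bounded[OF Gc Cab])
    have "wh_compact \<beta> (\<lambda>f. mult_op g (comp_op \<sigma> (G (Ha f))))"
      by (rule wh_bounded_compose_compact[OF g wh_bounded_compose_compact[OF Sb
            wh_compact_compose_bounded[OF Gc Hab]]])
    moreover have "wh_bounded \<beta> (\<lambda>f z. (-1) * f z)"
    proof -
      have "wh_linear \<beta> (\<lambda>f z. (-1) * f z)"
        unfolding wh_linear_def by (intro conjI ballI allI weighted_hardy_cmult) (auto simp: algebra_simps)
      moreover have "nsq \<beta> (\<lambda>z. (-1) * f z) \<le> 1 * nsq \<beta> f" if "f \<in> weighted_hardy \<beta>" for f
        unfolding hardy_fun_cmult(2)[OF weighted_hardyD(1)[OF that]] by simp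
      ultimately show ?thesis unfolding wh_bounded_def by (intro conjI exI[of _ 1]) auto
    qed
    ultimately show "wh_compact \<beta> (\<lambda>f z. (-1) * mult_op g (comp_op \<sigma> (G (Ha f))) z)"
      by (rule wh_bounded_compose_compact[rotated])
  qed
  then show ?thesis
    unfolding Ca_def[symmetric] Ha_def[symmetric]
    by (rule wh_compact_cong) (use main in blast)
qed

subsection \<open>The kernels\<close>

text \<open>These are the coefficients of the power \<open>- s\<close> of \<open>1 - x\<close>. Away
  from the poles of Gamma the limit is nonzero, which makes \<mu> admissible.\<close>

lemma gbinomial_kernel_asymp:
  fixes s :: real
  assumes "s \<notin> \<int>\<^sub>\<le>\<^sub>0"
  shows "(\<lambda>n. (-1) ^ n * ((- s) gchoose n) * real n powr (1 - s)) \<longlonglongrightarrow> inverse (Gamma s)"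
proof -
  have "(\<lambda>n. ((- s) gchoose n) / ((-1) ^ n / exp ((- s + 1) * of_real (ln (real n))))) \<longlonglongrightarrow>
      inverse (Gamma (- (- s)))"
    by (rule gbinomial_asymptotic)
  moreover have "\<forall>\<^sub>F n in sequentially. ((- s) gchoose n) / ((-1) ^ n / exp ((- s + 1) * of_real (ln (real n)))) =
      (-1) ^ n * ((- s) gchoose n) * real n powr (1 - s)"
    using eventually_gt_at_top[of 0]
  proof eventually_elim
    case (elim n)
    then have "real n powr (1 - s) = exp ((- s + 1) * of_real (ln (real n)))" by (simp add: powr_def)
    moreover have "(-1 :: real) ^ n = 1 \<or> (-1 :: real) ^ n = -1" by (simp add: power_one_over minus_one_power_iff)
    ultimately show ?case by auto
  qed
  ultimately have "(\<lambda>n. (-1) ^ n * ((- s) gchoose n) * real n powr (1 - s)) \<longlonglongrightarrow> inverse (Gamma (- (- s)))"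
    by (rule Lim_transform_eventually)
  then show ?thesis by simp
qed

lemma gbinomial_kernel_sums:
  fixes x :: complex and s :: real
  assumes "cmod x < 1"
  shows "(\<lambda>n. complex_of_real ((-1) ^ n * ((- s) gchoose n)) * x ^ n) sums
    exp (- complex_of_real s * Ln (1 - x))"
proof -
  have nz: "1 - x \<noteq> 0" using assms by auto
  have c: "complex_of_real (r gchoose n) = (complex_of_real r gchoose n)" for r n
    by (simp add: gbinomial_prod_rev)
  have "(\<lambda>n. (complex_of_real (- s) gchoose n) * (- x) ^ n) sums (1 + (- x)) powr (complex_of_real (- s))"
    using assms by (intro gen_binomial_complex) simp
  moreover have "(complex_of_real (- s) gchoose n) * (- x) ^ n =
      complex_of_real ((-1) ^ n * ((- s) gchoose n)) * x ^ n" for n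
    unfolding c[symmetric] power_minus[of x] by simp
  ultimately show ?thesis using nz by (simp add: powr_def)
qed

text \<open>Coefficients of \<open>(1 - x) ^ m * Ln (1 - x)\<close>; the recursion is multiplication
  by \<open>1 - x\<close>. At \<open>n = 0\<close> the division by zero in the base case gives 0,
  the correct constant term.\<close>

primrec log_coeff :: "nat \<Rightarrow> nat \<Rightarrow> real" where
  "log_coeff 0 n = - 1 / real n"
| "log_coeff (Suc m) n = log_coeff m n - (if n = 0 then 0 else log_coeff m (n - 1))"

lemma log_kernel_sums:
  assumes "cmod x < 1"
  shows "(\<lambda>n. complex_of_real (log_coeff m n) * x ^ n) sums ((1 - x) ^ m * Ln (1 - x))"
proof (induction m)
  case 0
  then show ?case using Ln_series'[of "- x"] assms by simp
next
  case (Suc m)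
  have "(\<lambda>n. complex_of_real (log_coeff m n) * x ^ Suc n) sums (x * ((1 - x) ^ m * Ln (1 - x)))"
    using sums_mult[OF Suc, of x] by (simp add: mult_ac)
  then have "(\<lambda>n. if n = 0 then 0 else complex_of_real (log_coeff m (n - 1)) * x ^ n) sums
      (x * ((1 - x) ^ m * Ln (1 - x)))"
    using sums_Suc[of "\<lambda>n. if n = 0 then 0 else complex_of_real (log_coeff m (n - 1)) * x ^ n"] by simp
  from sums_diff[OF Suc this]
  have "(\<lambda>n. complex_of_real (log_coeff m n) * x ^ n -
      (if n = 0 then 0 else complex_of_real (log_coeff m (n - 1)) * x ^ n)) sums
      ((1 - x) ^ m * Ln (1 - x) - x * ((1 - x) ^ m * Ln (1 - x)))" .
  moreover have "complex_of_real (log_coeff m n) * x ^ n -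
      (if n = 0 then 0 else complex_of_real (log_coeff m (n - 1)) * x ^ n) =
      complex_of_real (log_coeff (Suc m) n) * x ^ n" for n
    by (simp add: algebra_simps)
  ultimately show ?case by (simp add: algebra_simps)
qed

text \<open>Each recursion step is a backward difference, and the difference of two consecutive
  reciprocals of falling factorials is again one, with one more factor. The requirement
  \<open>n > m\<close> avoids vanishing denominators.\<close>

lemma log_coeff_eq:
  "n > m \<Longrightarrow> log_coeff m n = (-1) ^ Suc m * fact m / (\<Prod>j\<le>m. real n - real j)"
proof (induction m arbitrary: n)
  case 0
  then show ?case by simp
next
  case (Suc m)
  \<comment> \<open>The common factor of the products for \<open>n\<close> and for
    \<open>n - 1\<close>.\<close>
  define Q where "Q = (\<Prod>j<m. real n - real (Suc j))"
  have Q: "Q \<noteq> 0" unfolding Q_def using Suc.prems by auto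
  have p1: "(\<Prod>j\<le>m. real n - real j) = real n * Q"
    unfolding Q_def lessThan_Suc_atMost[symmetric] prod.lessThan_Suc_shift by simp
  have p2: "(\<Prod>j\<le>m. real (n - 1) - real j) = Q * (real n - real (Suc m))"
  proof -
    have "(\<Prod>j\<le>m. real (n - 1) - real j) = (\<Prod>j\<le>m. real n - real (Suc j))"
      using Suc.prems by (intro prod.cong) auto
    then show ?thesis unfolding Q_def lessThan_Suc_atMost[symmetric] by simp
  qed
  have p3: "(\<Prod>j\<le>Suc m. real n - real j) = real n * Q * (real n - real (Suc m))"
    unfolding prod.atMost_Suc p1 by simp
  have n: "real n > 0" "real n - real (Suc m) > 0" using Suc.prems by auto
  have "log_coeff (Suc m) n = (-1) ^ Suc m * fact m / (real n * Q) -
      (-1) ^ Suc m * fact m / (Q * (real n - real (Suc m)))"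
    using Suc.IH[of n] Suc.IH[of "n - 1"] Suc.prems p1 p2 by simp
  also have "\<dots> = (-1) ^ Suc m * fact m * ((real n - real (Suc m)) - real n) / (real n * Q * (real n - real (Suc m)))"
  proof -
    have gen: "x / (y * Q) - x / (Q * z) = x * (z - y) / (y * Q * z)" if "y \<noteq> 0" "z \<noteq> 0" for x y z :: real
      using that Q by (simp add: field_simps)
    show ?thesis by (rule gen) (use n in auto)
  qed
  also have "\<dots> = (-1) ^ Suc (Suc m) * fact (Suc m) / (real n * Q * (real n - real (Suc m)))"
  proof -
    have "(-1) ^ Suc m * fact m * ((real n - real (Suc m)) - real n) = (-1) ^ Suc (Suc m) * fact (Suc m)"
      by (simp add: algebra_simps)
    then show ?thesis by (simp only:)
  qed
  finally show ?case unfolding p3 .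
qed

lemma log_coeff_asymp:
  "(\<lambda>n. log_coeff m n * real n powr (real m + 1)) \<longlonglongrightarrow> (-1) ^ Suc m * fact m"
proof -
  have "(\<lambda>n. (-1) ^ Suc m * fact m / (\<Prod>j\<le>m. 1 - real j / real n)) \<longlonglongrightarrow>
      (-1) ^ Suc m * fact m / (\<Prod>j\<le>m. 1 - 0)"
    by (intro tendsto_intros tendsto_divide_0[OF tendsto_const] filterlim_compose[OF tendsto_divide_0]
        filterlim_real_sequentially filterlim_at_top_imp_at_infinity) auto
  moreover have "\<forall>\<^sub>F n in sequentially. (-1) ^ Suc m * fact m / (\<Prod>j\<le>m. 1 - real j / real n) =
      log_coeff m n * real n powr (real m + 1)"
    using eventually_gt_at_top[of m]
  proof eventually_elim
    case (elim n)
    then have n: "real n > 0" by simp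
    have "(\<Prod>j\<le>m. 1 - real j / real n) = (\<Prod>j\<le>m. (real n - real j) / real n)"
      using n by (intro prod.cong) (auto simp: field_simps)
    also have "\<dots> = (\<Prod>j\<le>m. real n - real j) / real n ^ Suc m"
      by (simp add: prod_dividef)
    also have "real n ^ Suc m = real n powr (real m + 1)"
    proof -
      have "real m + 1 = real (Suc m)" by simp
      then show ?thesis by (simp only: powr_realpow[OF n])
    qed
    finally show ?case using log_coeff_eq[OF elim] by simp
  qed
  ultimately show ?thesis by (simp add: Lim_transform_eventually)
qed

subsection \<open>Linear fractional maps and their Krein adjoints\<close>

text \<open>By continuity the numerator is dominated by the denominator up to the boundary, so a
  boundary zero of \<open>c * z + d\<close> would be a common zero, contradicting the
  determinant.\<close>

lemma lft_self_of_lin_frac: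
  assumes "lin_frac_self_map a b c d"
  shows "lft_self a b c d" "a * d - b * c \<noteq> 0"
proof -
  have det: "a * d - b * c \<noteq> 0" and nz: "\<And>z. z \<in> \<D> \<Longrightarrow> c * z + d \<noteq> 0"
    and self: "\<And>z. z \<in> \<D> \<Longrightarrow> (a * z + b) / (c * z + d) \<in> \<D>"
    using assms unfolding lin_frac_self_map_def by auto
  have less: "cmod (a * z + b) < cmod (c * z + d)" if "z \<in> \<D>" for z
    using self[OF that] nz[OF that] by (simp add: norm_divide divide_simps)
  have le: "cmod (c * z + d) - cmod (a * z + b) \<ge> 0" if "z \<in> cball 0 1" for z
  proof (rule continuous_ge_on_closure[of \<D> "\<lambda>z. cmod (c * z + d) - cmod (a * z + b)"])
    fix x assume "x \<in> \<D>"
    then show "0 \<le> cmod (c * x + d) - cmod (a * x + b)" using less[of x] by simp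
  qed (use that in \<open>auto intro!: continuous_intros\<close>)
  have "c * z + d \<noteq> 0" if "z \<in> cball 0 1" for z
  proof
    assume 0: "c * z + d = 0"
    then have "a * z + b = 0" using le[OF that] by simp
    then have "a * (c * z + d) - c * (a * z + b) = 0" using 0 by simp
    then show False using det by (simp add: algebra_simps)
  qed
  then show "lft_self a b c d" using less by (simp add: lft_self_def)
  show "a * d - b * c \<noteq> 0" by (rule det)
qed

text \<open>For \<open>w\<close> in the disk, \<open>cnj w * \<phi> z = 1\<close> has no solution in
  the closed disk. Cleared of denominators, this says that a linear function of \<open>z\<close> has
  no zero there, and \<open>linear_nonzero_iff\<close> turns it into the required inequality, up to
  conjugation.\<close>

lemma lft_self_krein_adjoint:
  assumes "lft_self a b c d"
  shows "lft_self (cnj a) (- cnj c) (- cnj b) (cnj d)"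
  unfolding lft_self_def
proof (intro conjI)
  have nz: "\<And>z. z \<in> cball 0 1 \<Longrightarrow> c * z + d \<noteq> 0" and less: "\<And>z. z \<in> \<D> \<Longrightarrow> cmod (a * z + b) < cmod (c * z + d)"
    using assms by (auto simp: lft_self_def)
  show "\<forall>z\<in>cball 0 1. - cnj b * z + cnj d \<noteq> 0"
    unfolding linear_nonzero_iff using less[of 0] by simp
  show "\<forall>w\<in>\<D>. cmod (cnj a * w + - cnj c) < cmod (- cnj b * w + cnj d)"
  proof
    fix w :: complex assume w: "w \<in> \<D>"
    have "(c - a * cnj w) * z + (d - b * cnj w) \<noteq> 0" if z: "z \<in> cball 0 1" for z
    proof
      assume "(c - a * cnj w) * z + (d - b * cnj w) = 0"
      then have "c * z + d = cnj w * (a * z + b)" by (simp add: algebra_simps)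
      then have e: "cmod (c * z + d) = cmod w * cmod (a * z + b)" by (metis norm_mult complex_mod_cnj)
      have "cmod (a * z + b) \<le> cmod (c * z + d)"
        using lft_self_closed[OF assms z] nz[OF z] by (simp add: norm_divide divide_simps)
      then have "cmod w * cmod (a * z + b) \<le> cmod w * cmod (c * z + d)" by (rule mult_left_mono) simp
      also have "\<dots> < 1 * cmod (c * z + d)" using w nz[OF z] by (intro mult_strict_right_mono) auto
      finally show False using e by simp
    qed
    then have "cmod (c - a * cnj w) < cmod (d - b * cnj w)"
      using linear_nonzero_iff by blast
    moreover have "cmod (c - a * cnj w) = cmod (cnj a * w + - cnj c)"
      by (metis (no_types, lifting) complex_cnj_cnj complex_cnj_diff complex_cnj_mult complex_mod_cnj
          norm_minus_commute add_uminus_conv_diff)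
    moreover have "cmod (d - b * cnj w) = cmod (- cnj b * w + cnj d)"
      by (metis (no_types, lifting) complex_cnj_cnj complex_cnj_diff complex_cnj_mult complex_mod_cnj
          add.commute add_uminus_conv_diff mult_minus_left)
    ultimately show "cmod (cnj a * w + - cnj c) < cmod (- cnj b * w + cnj d)" by simp
  qed
qed

text \<open>Both arguments lie strictly between -\<pi>/2 and \<pi>/2, so their sum does not leave
  the principal strip.\<close>

lemma Ln_mult_right_half_plane:
  assumes "Re x > 0" "Re y > 0"
  shows "Ln (x * y) = Ln x + Ln y"
  using Re_Ln_pos_lt_imp[OF assms(1)] Re_Ln_pos_lt_imp[OF assms(2)] assms
  by (intro Ln_times_simple) auto

lemma Re_one_add_pos: "cmod x < 1 \<Longrightarrow> Re (1 + x) > 0"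
  using abs_Re_le_cmod[of x] by auto

text \<open>\<open>1 + e * z\<close> stays in the right half-plane, so its principal logarithm is
  holomorphic and has the same derivative as \<open>L\<close>; the two differ by a constant.\<close>

lemma log_branch_linear:
  assumes L: "L holomorphic_on \<D>" "\<And>z. z \<in> \<D> \<Longrightarrow> exp (L z) = u0 * (1 + e * z)" and e: "cmod e \<le> 1"
    and z: "z \<in> \<D>"
  shows "L z = L 0 + Ln (1 + e * z)"
proof -
  have lt: "cmod (e * z) < 1" if "z \<in> \<D>" for z
  proof -
    have "cmod e * cmod z \<le> 1 * cmod z" using e by (intro mult_right_mono) auto
    then show ?thesis using that by (simp add: norm_mult)
  qed
  have u0: "u0 \<noteq> 0" using L(2)[of 0] exp_not_eq_zero[of "L 0"] by auto
  have "((\<lambda>z. L z - Ln (1 + e * z)) has_field_derivative 0) (at z within \<D>)" if z: "z \<in> \<D>" for z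
  proof -
    have "1 + e * z \<notin> \<real>\<^sub>\<le>\<^sub>0"
      using Re_one_add_pos[OF lt[OF z]] by (simp add: complex_nonpos_Reals_iff)
    then have nz: "1 + e * z \<noteq> 0" "1 + e * z \<notin> \<real>\<^sub>\<le>\<^sub>0" by auto
    have L': "(L has_field_derivative deriv L z) (at z)"
      using L(1) z by (intro holomorphic_derivI) auto
    have "((\<lambda>z. exp (L z)) has_field_derivative exp (L z) * deriv L z) (at z)"
      using L' by (auto intro!: derivative_eq_intros)
    moreover have "((\<lambda>z. exp (L z)) has_field_derivative u0 * e) (at z)"
    proof (rule DERIV_cong_ev[THEN iffD1, OF refl _ refl])
      show "((\<lambda>z. u0 * (1 + e * z)) has_field_derivative u0 * e) (at z)"
        by (auto intro!: derivative_eq_intros)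
      show "\<forall>\<^sub>F x in nhds z. u0 * (1 + e * x) = exp (L x)"
        using eventually_nhds_in_open[of \<D> z] z L(2) by (auto elim!: eventually_mono)
    qed
    ultimately have "exp (L z) * deriv L z = u0 * e" by (rule DERIV_unique)
    then have "u0 * ((1 + e * z) * deriv L z) = u0 * e" by (simp add: L(2)[OF z] mult.assoc)
    then have "(1 + e * z) * deriv L z = e" using u0 by (metis mult_left_cancel)
    then have "deriv L z = e / (1 + e * z)" using nz(1) by (simp add: eq_divide_eq mult.commute)
    then have "((\<lambda>z. L z - Ln (1 + e * z)) has_field_derivative 0) (at z)"
      using L' nz by (auto intro!: derivative_eq_intros simp: divide_inverse mult.commute)
    then show ?thesis by (rule has_field_derivative_at_within)
  qed
  then have "\<exists>k. \<forall>z\<in>\<D>. L z - Ln (1 + e * z) = k"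
    by (intro has_field_derivative_zero_constant) auto
  then obtain k where "\<And>z. z \<in> \<D> \<Longrightarrow> L z - Ln (1 + e * z) = k" by blast
  from this[OF z] this[of 0] show ?thesis by (simp add: algebra_simps)
qed

text \<open>Reduces an arbitrary branch to the principal one, so that the choice of branch survives
  only in the value at 0.\<close>

lemma power_branch_linear:
  assumes p: "power_branch u s p" and u: "\<And>z. z \<in> \<D> \<Longrightarrow> u z = u0 * (1 + e * z)" and e: "cmod e \<le> 1"
    and z: "z \<in> \<D>"
  shows "p z = p 0 * exp (complex_of_real s * Ln (1 + e * z))"
proof -
  obtain L where L: "L holomorphic_on \<D>" "\<And>z. z \<in> \<D> \<Longrightarrow> exp (L z) = u z"
    "\<And>z. z \<in> \<D> \<Longrightarrow> p z = exp (complex_of_real s * L z)"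
    using p unfolding power_branch_def by blast
  have "exp (L z) = u0 * (1 + e * z)" if "z \<in> \<D>" for z
    using L(2)[OF that] u[OF that] by simp
  then have "L z = L 0 + Ln (1 + e * z)"
    by (rule log_branch_linear[OF L(1) _ e z])
  then show ?thesis using L(3)[OF z] L(3)[of 0] by (simp add: exp_add distrib_left)
qed

text \<open>The strict bound gives room beyond the closed disk, which makes \<open>g\<close> and
  \<open>h\<close> bounded multipliers.\<close>

lemma holomorphic_Ln_linear:
  assumes "cmod e < 1"
  shows "\<exists>R>1. (\<lambda>z. Ln (1 + e * z)) holomorphic_on ball 0 R"
proof -
  obtain R where R: "R > 1" "\<And>z. z \<in> ball 0 R \<Longrightarrow> cmod (e * z) < cmod 1"
    using linear_nonzero_beyond[of e 1] assms by auto
  have "1 + e * z \<notin> \<real>\<^sub>\<le>\<^sub>0" if "z \<in> ball 0 R" for z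
    using Re_one_add_pos[of "e * z"] R(2)[OF that] by (auto simp: complex_nonpos_Reals_iff)
  then show ?thesis using R(1) by (intro exI[of _ R] conjI holomorphic_intros) auto
qed

lemma mult_op_cong: "(\<And>z. z \<in> \<D> \<Longrightarrow> u z = v z) \<Longrightarrow> mult_op u = mult_op v"
  by (auto simp: mult_op_def fun_eq_iff)

lemma power_weight_of_limit:
  assumes pos: "\<And>n. \<beta> n > 0" and l: "0 < l" and lim: "(\<lambda>n. \<beta> n / real n powr t) \<longlonglongrightarrow> l"
  shows "power_weight t \<beta>"
proof -
  \<comment> \<open>Comparison is with \<open>1 + n\<close>, since \<open>0 powr t\<close> is 0 and
    the given quotient carries no information at \<open>n = 0\<close>. Both \<open>q\<close> and its
    inverse converge and are therefore bounded.\<close>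
  define q where "q n = \<beta> n / pw t n" for n
  have q: "q n > 0" for n using pos[of n] by (simp add: q_def)
  have "(\<lambda>n. real n powr t / (1 + real n) powr t) \<longlonglongrightarrow> 1" by real_asymp
  from tendsto_mult[OF lim this] have "(\<lambda>n. \<beta> n / real n powr t * (real n powr t / (1 + real n) powr t)) \<longlonglongrightarrow> l"
    by simp
  moreover have "\<forall>\<^sub>F n in sequentially. \<beta> n / real n powr t * (real n powr t / (1 + real n) powr t) = q n"
    using eventually_gt_at_top[of 0] by eventually_elim (simp add: q_def pw_def)
  ultimately have lq: "q \<longlonglongrightarrow> l" by (rule Lim_transform_eventually)
  obtain C where C: "\<And>n. norm (q n) \<le> C"
    using convergent_imp_Bseq[OF convergentI[OF lq]] unfolding Bseq_def by blast
  have "(\<lambda>n. inverse (q n)) \<longlonglongrightarrow> inverse l" using lq l by (intro tendsto_inverse) auto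
  from convergent_imp_Bseq[OF convergentI[OF this]]
  obtain D where D: "D > 0" "\<And>n. norm (inverse (q n)) \<le> D"
    unfolding Bseq_def by blast
  have Cp: "C > 0" using C[of 0] q[of 0] by simp
  have qD: "1 / D \<le> q n" for n
    using D(1) D(2)[of n] q[of n] by (simp add: field_simps)
  have "1 / D * pw t n \<le> \<beta> n \<and> \<beta> n \<le> C * pw t n" for n
  proof -
    have "\<beta> n = q n * pw t n" using less_imp_neq[OF pw_pos[of t n]] by (simp add: q_def)
    moreover have "q n * pw t n \<le> C * pw t n"
      using C[of n] q[of n] by (intro mult_right_mono) (auto simp: less_imp_le)
    moreover have "1 / D * pw t n \<le> q n * pw t n"
      by (rule mult_right_mono[OF qD]) (simp add: less_imp_le)
    ultimately show ?thesis by simp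
  qed
  then show ?thesis unfolding power_weight_def
    using D(1) Cp by (intro exI[of _ "1 / D"] exI[of _ C] conjI) auto
qed

lemma kernel_weight_limit:
  assumes "(\<lambda>n. \<beta> n / real n powr t) \<longlonglongrightarrow> l" "(\<lambda>n. \<kappa> n * real n powr (2 * t)) \<longlonglongrightarrow> m"
  shows "(\<lambda>n. \<kappa> n * (\<beta> n)\<^sup>2) \<longlonglongrightarrow> m * l\<^sup>2"
proof -
  have "(\<lambda>n. \<kappa> n * real n powr (2 * t) * (\<beta> n / real n powr t)\<^sup>2) \<longlonglongrightarrow> m * l\<^sup>2"
    by (rule tendsto_mult[OF assms(2) tendsto_power[OF assms(1)]])
  moreover have "\<forall>\<^sub>F n in sequentially. \<kappa> n * real n powr (2 * t) * (\<beta> n / real n powr t)\<^sup>2 = \<kappa> n * (\<beta> n)\<^sup>2"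
    using eventually_gt_at_top[of 0]
  proof eventually_elim
    case (elim n)
    have "(real n powr t)\<^sup>2 = real n powr (2 * t)" using elim by (simp add: powr_power mult.commute)
    then show ?case using elim by (simp add: power_divide)
  qed
  ultimately show ?thesis by (rule Lim_transform_eventually)
qed

theorem theorem3p2:
  fixes t l :: real and \<beta> :: "nat \<Rightarrow> real" and a b c d :: complex
    and \<phi> \<sigma> g h :: "complex \<Rightarrow> complex"
  assumes "\<And>n. \<beta> n > 0"
    and "0 < l"
    and "(\<lambda>n. \<beta> n / real n powr t) \<longlonglongrightarrow> l"
    and "lin_frac_self_map a b c d"
    and "\<phi> = (\<lambda>z. (a * z + b) / (c * z + d))"
    and "\<sigma> = (\<lambda>z. (cnj a * z - cnj c) / (- cnj b * z + cnj d))"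
    and "power_branch (\<lambda>z. - cnj b * z + cnj d) (2 * t - 1) g"
    and "power_branch (\<lambda>z. c * z + d) (- 2 * t + 1) h"
    and "g 0 * cnj (h 0) = 1"
  shows "wh_compact \<beta> (\<lambda>f z. wh_adjoint \<beta> (comp_op \<phi>) f z
           - mult_op g (comp_op \<sigma> (wh_adjoint \<beta> (mult_op h) f)) z)"
proof -
  note L = lft_self_of_lin_frac[OF assms(4)]
  note K = lft_self_krein_adjoint[OF L(1)]
  have \<beta>: "power_weight t \<beta>" by (rule power_weight_of_limit[OF assms(1,2,3)])
  note md = moderate_power_weight[OF \<beta>]
  have cd: "cmod c < cmod d" and nz: "\<And>z. z \<in> cball 0 1 \<Longrightarrow> c * z + d \<noteq> 0"
    using L(1) linear_nonzero_iff unfolding lft_self_def by blast+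
  have bd: "cmod b < cmod d" using L(1) unfolding lft_self_def by (force dest: bspec[of _ _ 0])
  have d: "d \<noteq> 0" using cd by auto
  \<comment> \<open>Pulling out \<open>d\<close> and \<open>cnj d\<close> leaves factors of the form
    \<open>1 + x\<close> with \<open>cmod x < 1\<close>, for which principal logarithms are
    available.\<close>
  define e where "e = c / d"
  define b' where "b' = - b / d"
  have e: "cmod e < 1" and b': "cmod (cnj b') < 1"
    using cd bd d by (simp_all add: e_def b'_def norm_divide divide_simps)
  have C: "comp_bounded \<beta> \<phi>"
    unfolding assms(5) by (rule comp_bounded_power_weight[OF L \<beta>])
  have det: "cnj a * cnj d - - cnj c * - cnj b \<noteq> 0"
  proof -
    have "cnj a * cnj d - - cnj c * - cnj b = cnj (a * d - b * c)" by (simp add: mult.commute)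
    then show ?thesis using L(2) by (metis complex_cnj_zero_iff)
  qed
  have S: "comp_bounded \<beta> \<sigma>"
    using comp_bounded_power_weight[OF K det \<beta>] unfolding assms(6) by simp
  have \<phi>: "\<phi> z \<in> \<D>" if "z \<in> \<D>" for z
    using lft_self_holomorphic(2)[OF L(1)] that unfolding assms(5) by blast
  have \<sigma>: "\<sigma> z \<in> \<D>" if "z \<in> \<D>" for z
  proof -
    have "\<sigma> = (\<lambda>z. (cnj a * z + - cnj c) / (- cnj b * z + cnj d))" using assms(6) by simp
    then show ?thesis using lft_self_holomorphic(2)[OF K] that by blast
  qed
  \<comment> \<open>The kernel is the power \<open>- s\<close> of \<open>1 - x\<close>;
    \<open>g\<close> has exponent \<open>- s\<close> and \<open>h\<close> has exponent
    \<open>s\<close>.\<close>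
  define s where "s = 1 - 2 * t"
  define p where "p z = Ln (1 + e * z)" for z
  define q where "q z = Ln (1 + cnj b' * z)" for z
  have g: "g z = g 0 * exp (- complex_of_real s * q z)" if "z \<in> \<D>" for z
  proof -
    have "- cnj b * z + cnj d = cnj d * (1 + cnj b' * z)" for z
      using d by (simp add: b'_def field_simps)
    from power_branch_linear[OF assms(7) this _ that] b' show ?thesis by (simp add: q_def s_def)
  qed
  have h: "h z = h 0 * exp (complex_of_real s * p z)" if "z \<in> \<D>" for z
  proof -
    have "c * z + d = d * (1 + e * z)" for z using d by (simp add: e_def field_simps)
    from power_branch_linear[OF assms(8) this _ that] e show ?thesis by (simp add: p_def s_def)
  qed
  obtain R where R: "R > 1" "p holomorphic_on ball 0 R"
    using holomorphic_Ln_linear[OF e] unfolding p_def[abs_def] by blast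
  obtain R' where R': "R' > 1" "q holomorphic_on ball 0 R'"
    using holomorphic_Ln_linear[OF b'] unfolding q_def[abs_def] by blast
  have gb: "wh_bounded \<beta> (mult_op g)"
  proof -
    have "(\<lambda>z. g 0 * exp (- complex_of_real s * q z)) holomorphic_on ball 0 R'"
      by (intro holomorphic_intros R')
    from wh_bounded_mult_op[OF this R'(1) md] show ?thesis using mult_op_cong[OF g] by simp
  qed
  have hb: "wh_bounded \<beta> (mult_op h)"
  proof -
    have "(\<lambda>z. h 0 * exp (complex_of_real s * p z)) holomorphic_on ball 0 R"
      by (intro holomorphic_intros R)
    from wh_bounded_mult_op[OF this R(1) md] show ?thesis using mult_op_cong[OF h] by simp
  qed
  \<comment> \<open>The compatibility of the two branches enters here: it cancels the constants that
    the reduction to principal powers leaves behind.\<close>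
  have gh: "cnj (g 0) * h 0 = 1"
    using arg_cong[OF assms(9), of cnj] by simp
  \<comment> \<open>The logarithm of the Krein identity. It is kept separately from its exponential
    \<open>kid\<close> because the logarithmic kernel needs the logarithms themselves.\<close>
  have lnid: "Ln (1 - cnj w * \<phi> z) = cnj (q w) + Ln (1 - cnj (\<sigma> w) * z) - p z"
    and small: "cmod (cnj w * \<phi> z) < 1" "cmod (cnj (\<sigma> w) * z) < 1"
    if w: "w \<in> \<D>" and z: "z \<in> \<D>" for w z
  proof -
    have prod_less: "cmod (x * y) < 1" if "cmod x < 1" "cmod y < 1" for x y
      using mult_strict_mono'[OF that] by (simp add: norm_mult)
    show sm: "cmod (cnj w * \<phi> z) < 1" "cmod (cnj (\<sigma> w) * z) < 1"
      using w z \<phi>[OF z] \<sigma>[OF w] by (auto intro!: prod_less)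
    have P: "Re (1 + e * z) > 0" "Re (1 + cnj b' * w) > 0"
      by (rule Re_one_add_pos, rule prod_less, use w z e b' in simp, use w z e b' in simp)+
    have Q: "Re (1 - cnj w * \<phi> z) > 0" "Re (1 - cnj (\<sigma> w) * z) > 0"
      using Re_one_add_pos[of "- (cnj w * \<phi> z)"] Re_one_add_pos[of "- (cnj (\<sigma> w) * z)"] sm by auto
    have cq: "cnj (q w) = Ln (1 + b' * cnj w)"
      unfolding q_def using P(2) by (subst cnj_Ln) (auto simp: complex_nonpos_Reals_iff)
    have P': "Re (1 + b' * cnj w) > 0" using P(2) by simp
    have "(1 - cnj w * \<phi> z) * (1 + e * z) = (1 + b' * cnj w) * (1 - cnj (\<sigma> w) * z)"
    proof -
      have n1: "c * z + d \<noteq> 0" using nz z by simp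
      have "- cnj b * w + cnj d \<noteq> 0" using K w unfolding lft_self_def by auto
      then have "cnj (- cnj b * w + cnj d) \<noteq> 0" by (metis complex_cnj_zero_iff)
      then have n2: "d - b * cnj w \<noteq> 0" by (simp add: algebra_simps)
      have "d * ((1 - cnj w * \<phi> z) * (1 + e * z)) = (c * z + d) * (1 - cnj w * \<phi> z)"
        using d by (simp add: e_def field_simps)
      also have "\<dots> = (c * z + d) - cnj w * (a * z + b)"
        using n1 by (simp add: assms(5) field_simps)
      also have "\<dots> = (d - b * cnj w) - (a * cnj w - c) * z" by (simp add: algebra_simps)
      also have "\<dots> = (d - b * cnj w) * (1 - cnj (\<sigma> w) * z)"
      proof -
        have "cnj (\<sigma> w) = (a * cnj w - c) / (d - b * cnj w)" by (simp add: assms(6))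
        then show ?thesis using n2 by (simp add: right_diff_distrib)
      qed
      also have "\<dots> = d * ((1 + b' * cnj w) * (1 - cnj (\<sigma> w) * z))"
        using d by (simp add: b'_def field_simps)
      finally show ?thesis using d by simp
    qed
    then have "Ln (1 - cnj w * \<phi> z) + Ln (1 + e * z) = Ln (1 + b' * cnj w) + Ln (1 - cnj (\<sigma> w) * z)"
      using Ln_mult_right_half_plane[OF Q(1) P(1)] Ln_mult_right_half_plane[OF P' Q(2)] by simp
    then show "Ln (1 - cnj w * \<phi> z) = cnj (q w) + Ln (1 - cnj (\<sigma> w) * z) - p z"
      unfolding cq p_def by (simp add: algebra_simps)
  qed
  have kid: "exp (- complex_of_real s * Ln (1 - cnj w * \<phi> z)) =
      cnj (g w) * h z * exp (- complex_of_real s * Ln (1 - cnj (\<sigma> w) * z))"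
    if w: "w \<in> \<D>" and z: "z \<in> \<D>" for w z
  proof -
    have "cnj (g w) * h z * exp (- complex_of_real s * Ln (1 - cnj (\<sigma> w) * z)) =
        (cnj (g 0) * h 0) * (exp (- complex_of_real s * cnj (q w)) * exp (complex_of_real s * p z) *
          exp (- complex_of_real s * Ln (1 - cnj (\<sigma> w) * z)))"
      unfolding g[OF w] h[OF z] by (simp add: exp_cnj)
    also have "\<dots> = exp (- complex_of_real s * Ln (1 - cnj w * \<phi> z))"
      unfolding gh lnid[OF w z] by (simp add: exp_add[symmetric] algebra_simps)
    finally show ?thesis by simp
  qed
  show ?thesis
  \<comment> \<open>At the nonpositive integers the reciprocal of Gamma vanishes, so the binomial
    coefficients decay too fast to match the weight.\<close>
  proof (cases "s \<in> \<int>\<^sub>\<le>\<^sub>0")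
    case False
    have "(\<lambda>n. (-1) ^ n * ((- s) gchoose n) * (\<beta> n)\<^sup>2) \<longlonglongrightarrow> inverse (Gamma s) * l\<^sup>2"
      using kernel_weight_limit[OF assms(3), of "\<lambda>n. (-1) ^ n * ((- s) gchoose n)" "inverse (Gamma s)"]
        gbinomial_kernel_asymp[OF False] by (simp add: s_def)
    moreover have "inverse (Gamma s) * l\<^sup>2 \<noteq> 0" using False assms(2) by (simp add: Gamma_eq_zero_iff)
    ultimately show ?thesis
      \<comment> \<open>The kernel identity is exact in this case, so the finite rank part is
        indexed by the empty set.\<close>
      using kid by (intro compact_of_kernel_identity[where I = "{} :: nat set" and u = "\<lambda>_ _. 0"
            and v = "\<lambda>_ _. 0" and k = "\<lambda>x. exp (- complex_of_real s * Ln (1 - x))",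
            OF \<beta> C S \<phi> \<sigma> gb hb _ _ gbinomial_kernel_sums]) auto
  next
    case True
    then obtain m :: nat where m: "s = - real m" by (auto elim!: nonpos_Ints_cases')
    \<comment> \<open>The coefficients of the logarithmic kernel decay with exponent
      \<open>m + 1\<close>, exactly the exponent \<open>2 * t\<close> of the squared weight.\<close>
    have t2: "2 * t = real m + 1" using m by (simp add: s_def)
    have lim: "(\<lambda>n. log_coeff m n * (\<beta> n)\<^sup>2) \<longlonglongrightarrow> (-1) ^ Suc m * fact m * l\<^sup>2"
      by (rule kernel_weight_limit[OF assms(3)]) (unfold t2, rule log_coeff_asymp)
    have lim_nz: "(-1) ^ Suc m * fact m * l\<^sup>2 \<noteq> 0" using assms(2) by simp
    define E where "E i z = (if z \<in> \<D> then z ^ i else 0)" for i :: nat and z :: complex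
    have E: "E i \<in> weighted_hardy \<beta>" for i
    proof -
      have "hardy_fun \<beta> (E i) = hardy_fun \<beta> (poly (monom 1 i))"
        by (rule hardy_fun_cong) (simp add: E_def poly_monom)
      then show ?thesis using hardy_fun_poly[of \<beta> "monom 1 i"] by (simp add: weighted_hardy_iff E_def)
    qed
    have EC: "comp_op \<phi> (E i) \<in> weighted_hardy \<beta>" for i
      using wh_bounded_comp_op[OF C] E by (simp add: wh_bounded_def wh_linear_def)
    \<comment> \<open>\<open>r i\<close> are the coefficients in the expansion of the
      \<open>m\<close>-th power of \<open>1 - cnj w * \<phi> z\<close>. The Boolean in the index
      selects the summand \<open>cnj (q w)\<close> (True) or \<open>- p z\<close> (False) of the
      difference of logarithms.\<close>
    define r :: "nat \<Rightarrow> complex" where "r i = of_nat (m choose i) * (-1) ^ i" for i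
    define I where "I = {..m} \<times> (UNIV :: bool set)"
    define u where "u j = (if snd j then mult_op q (E (fst j)) else E (fst j))" for j :: "nat \<times> bool"
    define v where "v j = (if snd j then (\<lambda>z. r (fst j) * comp_op \<phi> (E (fst j)) z)
        else (\<lambda>z. (- r (fst j)) * mult_op p (comp_op \<phi> (E (fst j))) z))" for j :: "nat \<times> bool"
    have u: "u j \<in> weighted_hardy \<beta>" for j
      using E wh_bounded_mult_op[OF R'(2,1) md] by (simp add: u_def wh_bounded_def wh_linear_def)
    have pE: "mult_op p (comp_op \<phi> (E i)) \<in> weighted_hardy \<beta>" for i
      using EC wh_bounded_mult_op[OF R(2,1) md] by (simp add: wh_bounded_def wh_linear_def)
    have v: "v j \<in> weighted_hardy \<beta>" for j
      unfolding v_def using weighted_hardy_cmult[OF EC] weighted_hardy_cmult[OF pE]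
      by (cases "snd j") (simp_all only: if_True if_False)
    have fin: "(1 - cnj w * \<phi> z) ^ m * Ln (1 - cnj w * \<phi> z) - cnj (g w) * h z *
        ((1 - cnj (\<sigma> w) * z) ^ m * Ln (1 - cnj (\<sigma> w) * z)) = (\<Sum>j\<in>I. cnj (u j w) * v j z)"
      if w: "w \<in> \<D>" and z: "z \<in> \<D>" for w z
    proof -
      have ne: "1 - cnj w * \<phi> z \<noteq> 0" "1 - cnj (\<sigma> w) * z \<noteq> 0"
        using small[OF w z] by auto
      have ex: "exp (- complex_of_real s * Ln x) = x ^ m" if "x \<noteq> 0" for x
        using that by (simp add: m exp_of_nat_mult)
      \<comment> \<open>For \<open>s = - m\<close> the identity \<open>kid\<close> becomes an
        identity of polynomial kernels; with it both terms share the factor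
        \<open>(1 - cnj w * \<phi> z) ^ m\<close>, and only a difference of logarithms is
        left.\<close>
      have pow: "(1 - cnj w * \<phi> z) ^ m = cnj (g w) * h z * (1 - cnj (\<sigma> w) * z) ^ m"
        using kid[OF w z] unfolding ex[OF ne(1)] ex[OF ne(2)] .
      have "(1 - cnj w * \<phi> z) ^ m * Ln (1 - cnj w * \<phi> z) - cnj (g w) * h z *
          ((1 - cnj (\<sigma> w) * z) ^ m * Ln (1 - cnj (\<sigma> w) * z)) =
          (1 - cnj w * \<phi> z) ^ m * (Ln (1 - cnj w * \<phi> z) - Ln (1 - cnj (\<sigma> w) * z))"
        unfolding right_diff_distrib pow by (simp add: mult.assoc)
      also have "\<dots> = (- (cnj w * \<phi> z) + 1) ^ m * (cnj (q w) - p z)"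
        unfolding lnid[OF w z] by simp
      also have "\<dots> = (\<Sum>i\<le>m. r i * (cnj w * \<phi> z) ^ i) * (cnj (q w) - p z)"
        unfolding binomial_ring by (simp add: r_def power_minus[of "cnj w * \<phi> z"] mult.assoc)
      also have "\<dots> = (\<Sum>i\<le>m. cnj (u (i, True) w) * v (i, True) z + cnj (u (i, False) w) * v (i, False) z)"
        unfolding sum_distrib_right using w z \<phi>[OF z]
        by (intro sum.cong refl) (simp add: u_def v_def mult_op_def comp_op_def E_def
            power_mult_distrib algebra_simps)
      also have "\<dots> = (\<Sum>i\<le>m. \<Sum>x\<in>UNIV. cnj (u (i, x) w) * v (i, x) z)"
        by (simp add: UNIV_bool add.commute)
      also have "\<dots> = (\<Sum>j\<in>I. cnj (u j w) * v j z)"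
        unfolding I_def by (simp add: sum.cartesian_product split_def)
      finally show ?thesis .
    qed
    show ?thesis
      by (rule compact_of_kernel_identity[where I = I and u = u and v = v
            and k = "\<lambda>x. (1 - x) ^ m * Ln (1 - x)", OF \<beta> C S \<phi> \<sigma> gb hb lim_nz lim log_kernel_sums])
        (use u v fin in \<open>simp_all add: I_def\<close>)
  qed
qed

end
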